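(* Fix $N\ge 1$. For $M\ge N$ let $(Y^{N,M}(t))_{t\ge 0}$ be the Laguerre process, with ordered eigenvalues $\mu_1^{N,M}(t)\le\cdots\le\mu_N^{N,M}(t)$, and let $(X^N(t))_{t\ge 0}$ be Hermitian Brownian motion on $\mathcal{H}_N$, with ordered eigenvalues $\lambda_1^N(t)\le\cdots\le\lambda_N^N(t)$. Then, as $M\to\infty$, $$\Big(\Big(\frac{\mu_i^{N,M}(t)-Mt}{\sqrt{M}}\Big)_{1\le i\le N}\Big)_{t\ge 0}\ \longrightarrow\ \big((\lambda_i^N(t^2))_{1\le i\le N}\big)_{t\ge 0}$$ in distribution, in the sense of weak convergence in $\mathcal{C}(\mathbb{R}_+,\mathbb{R}^N)$.
   Context: $\mathcal{H}_N$ denotes the space of $N\times N$ Hermitian complex matrices, and $\mathcal{C}(\mathbb{R}_+,\mathbb{R}^N)$ the space of continuous functions $\mathbb{R}_+\to\mathbb{R}^N$ with the topology of uniform convergence on compact sets. A standard complex Brownian motion is $(b+\sqrt{-1}\,b')/\sqrt2$ with $b,b'$ independent standard real Brownian motions started at $0$ (so that its squared modulus at time $t$ has expectation $t$). Laguerre process: $Y^{N,M}(t)=A^{N,M}(t)\,(A^{N,M}(t))^{*}$, where $A^{N,M}=(A_{i,j})$ is an $N\times M$ matrix whose entries are independent standard complex Brownian motions and $*$ denotes conjugate transpose. Hermitian Brownian motion: the process $X^N(t)=(X_{i,j}(t))_{1\le i,j\le N}\in\mathcal{H}_N$ where $(X_{i,j})_{1\le i<j\le N}$ are standard complex Brownian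 motions, $(X_{i,i})_{1\le i\le N}$ are standard real Brownian motions, all of these are independent, and $X_{i,j}=\overline{X_{j,i}}$ for $i>j$. *)

theory Defs
  imports "HOL-Probability.Probability" "Jordan_Normal_Form.Schur_Decomposition"
begin

section \<open>Brownian motions\<close>

text \<open>Paths are continuous and start at the origin surely, not just almost surely. Only the
  times \<open>t \<ge> 0\<close> are meaningful.\<close>

definition standard_BM :: "'a measure \<Rightarrow> (real \<Rightarrow> 'a \<Rightarrow> real) \<Rightarrow> bool" where
  "standard_BM P b \<longleftrightarrow>
     prob_space P \<and>
     (\<forall>t\<ge>0. b t \<in> borel_measurable P) \<and>
     (\<forall>\<omega>\<in>space P. b 0 \<omega> = 0) \<and>
     (\<forall>\<omega>\<in>space P. continuous_on {0..} (\<lambda>t. b t \<omega>)) \<and>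
     (\<forall>s t. 0 \<le> s \<and> s < t \<longrightarrow>
        distributed P lborel (\<lambda>\<omega>. b t \<omega> - b s \<omega>) (normal_density 0 (sqrt (t - s)))) \<and>
     (\<forall>(n::nat) (\<tau>::nat \<Rightarrow> real). 0 \<le> \<tau> 0 \<and> (\<forall>k<n. \<tau> k < \<tau> (Suc k)) \<longrightarrow>
        prob_space.indep_vars P (\<lambda>_. borel)
          (\<lambda>k \<omega>. b (\<tau> (Suc k)) \<omega> - b (\<tau> k) \<omega>) {..<n})"

text \<open>The trajectory of a process, as an element of the product space over \<open>[0,\<infinity>)\<close>. Independence
  of processes means independence of the trajectories for the product \<open>\<sigma>\<close>-algebra.\<close>

definition trajectory :: "(real \<Rightarrow> 'a \<Rightarrow> 'c) \<Rightarrow> 'a \<Rightarrow> (real \<Rightarrow> 'c)" where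
  "trajectory Z \<omega> = (\<lambda>t\<in>{0..}. Z t \<omega>)"

abbreviation trajectory_space :: "(real \<Rightarrow> 'c::topological_space) measure" where
  "trajectory_space \<equiv> (\<Pi>\<^sub>M t\<in>{0..}. borel)"

definition independent_processes ::
    "'a measure \<Rightarrow> ('i \<Rightarrow> real \<Rightarrow> 'a \<Rightarrow> 'c::topological_space) \<Rightarrow> 'i set \<Rightarrow> bool" where
  "independent_processes P Z I \<longleftrightarrow>
     prob_space.indep_vars P (\<lambda>_. trajectory_space) (\<lambda>i. trajectory (Z i)) I"

definition standard_complex_BM :: "'a measure \<Rightarrow> (real \<Rightarrow> 'a \<Rightarrow> complex) \<Rightarrow> bool" where
  "standard_complex_BM P Z \<longleftrightarrow>
     (\<exists>b b'. standard_BM P b \<and> standard_BM P b' \<and>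
        prob_space.indep_var P trajectory_space (trajectory b) trajectory_space (trajectory b') \<and>
        (\<forall>t\<ge>0. \<forall>\<omega>\<in>space P.
           Z t \<omega> = (of_real (b t \<omega>) + \<i> * of_real (b' t \<omega>)) / of_real (sqrt 2)))"


section \<open>Matrix-valued processes\<close>

definition complex_BM_matrix ::
    "'a measure \<Rightarrow> nat \<Rightarrow> nat \<Rightarrow> (real \<Rightarrow> 'a \<Rightarrow> complex mat) \<Rightarrow> bool" where
  "complex_BM_matrix P N M A \<longleftrightarrow>
     prob_space P \<and>
     (\<forall>t\<ge>0. \<forall>\<omega>\<in>space P. A t \<omega> \<in> carrier_mat N M) \<and>
     (\<forall>i<N. \<forall>j<M. standard_complex_BM P (\<lambda>t \<omega>. A t \<omega> $$ (i, j))) \<and>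
     independent_processes P (\<lambda>ij t \<omega>. A t \<omega> $$ ij) ({..<N} \<times> {..<M})"

definition laguerre_process ::
    "'a measure \<Rightarrow> nat \<Rightarrow> nat \<Rightarrow> (real \<Rightarrow> 'a \<Rightarrow> complex mat) \<Rightarrow> bool" where
  "laguerre_process P N M Y \<longleftrightarrow>
     (\<exists>A. complex_BM_matrix P N M A \<and>
        (\<forall>t\<ge>0. \<forall>\<omega>\<in>space P. Y t \<omega> = A t \<omega> * mat_adjoint (A t \<omega>)))"

definition hermitian_BM ::
    "'a measure \<Rightarrow> nat \<Rightarrow> (real \<Rightarrow> 'a \<Rightarrow> complex mat) \<Rightarrow> bool" where
  "hermitian_BM P N X \<longleftrightarrow>
     prob_space P \<and>
     (\<forall>t\<ge>0. \<forall>\<omega>\<in>space P. X t \<omega> \<in> carrier_mat N N) \<and>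
     (\<forall>i<N. \<forall>j<N. i < j \<longrightarrow> standard_complex_BM P (\<lambda>t \<omega>. X t \<omega> $$ (i, j))) \<and>
     (\<forall>i<N. \<exists>b. standard_BM P b \<and> (\<forall>t\<ge>0. \<forall>\<omega>\<in>space P. X t \<omega> $$ (i, i) = of_real (b t \<omega>))) \<and>
     independent_processes P (\<lambda>ij t \<omega>. X t \<omega> $$ ij) {(i, j). i \<le> j \<and> j < N} \<and>
     (\<forall>i<N. \<forall>j<N. j < i \<longrightarrow> (\<forall>t\<ge>0. \<forall>\<omega>\<in>space P. X t \<omega> $$ (i, j) = cnj (X t \<omega> $$ (j, i))))"

text \<open>Eigenvalues of a Hermitian matrix, with multiplicity, in increasing order, indexed from 0.
  They are real, so taking real parts loses nothing.\<close>

definition ordered_eigenvalue :: "complex mat \<Rightarrow> nat \<Rightarrow> real" where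
  "ordered_eigenvalue H i =
     sorted_list_of_multiset (image_mset Re (proots (char_poly H))) ! i"


section \<open>The path space and convergence in distribution\<close>

text \<open>Continuous functions from \<open>[0,\<infinity>)\<close> to \<open>\<real>\<^sup>N\<close>, the latter realised as
  \<^const>\<open>Euclidean_space\<close> (coordinates \<open>0, \<dots>, N - 1\<close>, all others zero); the functions are
  \<^const>\<open>undefined\<close> at negative times.\<close>

definition path_space :: "nat \<Rightarrow> (real \<Rightarrow> nat \<Rightarrow> real) set" where
  "path_space N =
     {f \<in> extensional {0..}. continuous_map (top_of_set {0..}) (Euclidean_space N) f}"

text \<open>The topology of uniform convergence on compact sets.\<close>

definition path_topology :: "nat \<Rightarrow> (real \<Rightarrow> nat \<Rightarrow> real) topology" where
  "path_topology N = topology (\<lambda>U. U \<subseteq> path_space N \<and>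
     (\<forall>f\<in>U. \<exists>K \<epsilon>. compact K \<and> K \<subseteq> {0..} \<and> 0 < \<epsilon> \<and>
        (\<forall>g\<in>path_space N. (\<forall>t\<in>K. \<forall>i<N. \<bar>g t i - f t i\<bar> < \<epsilon>) \<longrightarrow> g \<in> U)))"

lemma openin_path_topology:
  "openin (path_topology N) U \<longleftrightarrow> U \<subseteq> path_space N \<and>
     (\<forall>f\<in>U. \<exists>K \<epsilon>. compact K \<and> K \<subseteq> {0..} \<and> 0 < \<epsilon> \<and>
        (\<forall>g\<in>path_space N. (\<forall>t\<in>K. \<forall>i<N. \<bar>g t i - f t i\<bar> < \<epsilon>) \<longrightarrow> g \<in> U))"
proof -
  define nbhd where "nbhd U f \<longleftrightarrow> (\<exists>K \<epsilon>. compact K \<and> K \<subseteq> {0..} \<and> 0 < \<epsilon> \<and>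
        (\<forall>g\<in>path_space N. (\<forall>t\<in>K. \<forall>i<N. \<bar>g t i - f t i\<bar> < \<epsilon>) \<longrightarrow> g \<in> U))"
    for U :: "(real \<Rightarrow> nat \<Rightarrow> real) set" and f
  have mono: "nbhd V f" if "nbhd U f" "U \<subseteq> V" for U V f
    using that unfolding nbhd_def by (meson subsetD)
  have Int: "nbhd (U \<inter> V) f" if U: "nbhd U f" and V: "nbhd V f" for U V f
  proof -
    obtain K \<epsilon> where 1: "compact K" "K \<subseteq> {0..}" "0 < \<epsilon>"
      "\<And>g. g \<in> path_space N \<Longrightarrow> (\<forall>t\<in>K. \<forall>i<N. \<bar>g t i - f t i\<bar> < \<epsilon>) \<Longrightarrow> g \<in> U"
      using U unfolding nbhd_def by blast
    obtain K' \<epsilon>' where 2: "compact K'" "K' \<subseteq> {0..}" "0 < \<epsilon>'"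
      "\<And>g. g \<in> path_space N \<Longrightarrow> (\<forall>t\<in>K'. \<forall>i<N. \<bar>g t i - f t i\<bar> < \<epsilon>') \<Longrightarrow> g \<in> V"
      using V unfolding nbhd_def by blast
    show ?thesis
      unfolding nbhd_def
    proof (intro exI conjI ballI impI)
      show "compact (K \<union> K')" "K \<union> K' \<subseteq> {0..}" "0 < min \<epsilon> \<epsilon>'"
        using 1 2 by auto
      fix g assume "g \<in> path_space N" "\<forall>t\<in>K \<union> K'. \<forall>i<N. \<bar>g t i - f t i\<bar> < min \<epsilon> \<epsilon>'"
      then show "g \<in> U \<inter> V"
        using 1(4)[of g] 2(4)[of g] by simp
    qed
  qed
  have "istopology (\<lambda>U. U \<subseteq> path_space N \<and> (\<forall>f\<in>U. nbhd U f))"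
    unfolding istopology_def
  proof (intro conjI allI impI)
    fix \<K> :: "(real \<Rightarrow> nat \<Rightarrow> real) set set"
    assume K: "\<forall>U\<in>\<K>. U \<subseteq> path_space N \<and> (\<forall>f\<in>U. nbhd U f)"
    then show "\<Union>\<K> \<subseteq> path_space N" by blast
    show "\<forall>f\<in>\<Union>\<K>. nbhd (\<Union>\<K>) f"
      using K by (meson UnionE Union_upper mono)
  qed (use Int in auto)
  then show ?thesis
    unfolding path_topology_def nbhd_def[symmetric] by (simp add: topology_inverse')
qed

lemma topspace_path_topology: "topspace (path_topology N) = path_space N"
proof
  show "topspace (path_topology N) \<subseteq> path_space N"
    using openin_path_topology openin_topspace by blast
  have "openin (path_topology N) (path_space N)"
    unfolding openin_path_topology
    by (intro conjI ballI exI[of _ "{}"] exI[of _ "1::real"]) auto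
  then show "path_space N \<subseteq> topspace (path_topology N)"
    by (rule openin_subset)
qed

definition borel_sigma :: "'c topology \<Rightarrow> 'c measure" where
  "borel_sigma T = sigma (topspace T) {U. openin T U}"

definition random_element :: "'a measure \<Rightarrow> 'c topology \<Rightarrow> ('a \<Rightarrow> 'c) \<Rightarrow> bool" where
  "random_element P T Z \<longleftrightarrow> prob_space P \<and> Z \<in> measurable P (borel_sigma T)"

text \<open>Weak convergence of the laws of \<open>Z n\<close> (on \<open>P n\<close>) to the law of \<open>W\<close> (on \<open>Q\<close>). Since this
  concerns \<open>n \<rightarrow> \<infinity>\<close>, only all sufficiently large \<open>n\<close> need to give random elements.\<close>

definition converges_in_distribution ::
    "'c topology \<Rightarrow> (nat \<Rightarrow> 'a measure) \<Rightarrow> (nat \<Rightarrow> 'a \<Rightarrow> 'c) \<Rightarrow> 'b measure \<Rightarrow> ('b \<Rightarrow> 'c) \<Rightarrow> bool"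
  where
  "converges_in_distribution T P Z Q W \<longleftrightarrow>
     (\<forall>\<^sub>F n in sequentially. random_element (P n) T (Z n)) \<and>
     random_element Q T W \<and>
     (\<forall>F. continuous_map T euclideanreal F \<and> bounded (F ` topspace T) \<longrightarrow>
        (\<lambda>n. \<integral>\<omega>. F (Z n \<omega>) \<partial>P n) \<longlonglongrightarrow> (\<integral>\<omega>. F (W \<omega>) \<partial>Q))"

end

theory Submission
  imports Defs "HOL-Real_Asymp.Real_Asymp"
begin

text \<open>The matrix \<open>(Y(t) - M t I) / \<surd>M\<close> is \<open>M\<close> to the power \<open>-1/2\<close> times a sum of \<open>M\<close> independent centred processes
\<open>a(t) a(t)* - t I\<close>, one for each column \<open>a\<close> of \<open>A\<close>. The limit theorem is therefore a functional central limit
theorem, transported by the map from a Hermitian matrix to its ordered eigenvalues. The covariance of the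
limit is that of one summand: the entries of \<open>a(t) a(t)* - t I\<close> are uncorrelated martingales, and the second
moment of their absolute value is \<open>t\<^sup>2\<close>. A continuous Gaussian martingale with these covariances is Hermitian Brownian
motion at time \<open>t\<^sup>2\<close>, which explains the time change.

Hermitian matrices are encoded by \<open>N \<times> N\<close> real coordinates (\<open>hermitian_of\<close>), and by Weyl's inequality
(\<open>weyl_inequality\<close>) the ordered eigenvalues are Lipschitz functions of these coordinates. Everything that has to be
proved about eigenvalues is thereby reduced to statements about the coordinates, which are polynomials of degree
at most two in independent real Brownian motions.

For weak convergence on the path space let \<open>F\<close> be bounded and continuous. The envelopes
\<open>F\<^sub>k(f) = inf\<^sub>g (F(g) + k d\<^sub>k(f,g))\<close>, with \<open>d\<^sub>k\<close> the truncated uniform distance on \<open>[0,k]\<close>, increase to \<open>F\<close>, so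
convergence of the expectations of all \<open>F\<^sub>k\<close> bounds the lower limit for \<open>F\<close> from below; applied to \<open>F\<close> and \<open>-F\<close> this
gives convergence (\<open>converges_in_distribution_pathI\<close>). An envelope is Lipschitz for \<open>d\<^sub>k\<close>, hence almost unchanged when a
path is replaced by the step function through its values at dyadic times. That error is uniform in \<open>M\<close>, because
the fourth moment of an increment over \<open>[s,t]\<close> is at most a constant times \<open>(t - s)\<^sup>2\<close> and chaining along dyadic times
applies (\<open>dyadic_chaining\<close>). On step functions an envelope is a bounded continuous function of finitely many
coordinates, and for those convergence of all expectations \<open>E cos(w \<bullet> V + \<theta>)\<close> suffices
(\<open>convergence_from_cosines\<close>).

Those expectations are computed as follows. A linear functional \<open>w \<bullet> V\<close> of the coordinates at grid times is a
normalised sum over the columns of independent centred quadratic forms in Gaussian increments. Isserlis' formula gives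
the variance of one form (\<open>gaussian_quadratic_form\<close>, \<open>bm_quadratic\<close>), and Lyapunov's theorem
(\<open>lyapunov_triangular_array\<close>) gives the limit \<open>exp(-\<sigma>\<^sup>2/2) cos \<theta>\<close>. For Hermitian Brownian motion at squared times the
same functional is exactly Gaussian, with the same variance (\<open>time_squared_cos\<close>).\<close>

unbundle no vec_syntax

section \<open>Eigenvalues of Hermitian matrices\<close>

definition cinner :: "nat \<Rightarrow> (nat \<Rightarrow> complex) \<Rightarrow> (nat \<Rightarrow> complex) \<Rightarrow> complex" where
  "cinner n x y = (\<Sum>i<n. cnj (x i) * y i)"

definition orthonormal :: "nat \<Rightarrow> nat \<Rightarrow> (nat \<Rightarrow> nat \<Rightarrow> complex) \<Rightarrow> bool" where
  "orthonormal n m u \<longleftrightarrow> (\<forall>k<m. \<forall>l<m. cinner n (u k) (u l) = (if k = l then 1 else 0))"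

text \<open>The system has \<open>n - 1\<close> equations (all rows but row \<open>k\<close>) in \<open>n\<close> unknowns. Filling row \<open>k\<close> with zeros turns it into a
square system with vanishing determinant, so no theory of dimensions is involved.\<close>

lemma homogeneous_system_nontrivial:
  fixes r :: "nat \<Rightarrow> nat \<Rightarrow> complex"
  assumes "k < n"
  obtains x where "\<And>m. m < n \<Longrightarrow> m \<noteq> k \<Longrightarrow> (\<Sum>j<n. r m j * x j) = 0" "\<exists>i<n. x i \<noteq> 0"
proof -
  define M where "M = mat n n (\<lambda>(m, j). if m = k then 0 else r m j)"
  have M: "M \<in> carrier_mat n n" by (simp add: M_def)
  have "det M = (\<Sum>j<n. M $$ (k, j) * cofactor M k j)"
    by (rule laplace_expansion_row[OF M assms])
  also have "\<dots> = 0" using assms by (intro sum.neutral) (simp add: M_def)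
  finally have "det M = 0" .
  then obtain v where v: "v \<in> carrier_vec n" "v \<noteq> 0\<^sub>v n" "M *\<^sub>v v = 0\<^sub>v n"
    using det_0_iff_vec_prod_zero_field[OF M] by auto
  show thesis
  proof (rule that[of "\<lambda>j. v $ j"])
    fix m assume m: "m < n" "m \<noteq> k"
    have "(M *\<^sub>v v) $ m = 0" using v m by simp
    then show "(\<Sum>j<n. r m j * v $ j) = 0"
      using m v M by (simp add: M_def scalar_prod_def atLeast0LessThan)
  next
    show "\<exists>i<n. v $ i \<noteq> 0" using v by (metis carrier_vecD eq_vecI index_zero_vec)
  qed
qed

lemma cinner_self: "cinner n x x = of_real (\<Sum>i<n. (cmod (x i))\<^sup>2)"
  unfolding cinner_def of_real_sum
  by (rule sum.cong[OF refl]) (metis complex_norm_square mult.commute)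

lemma cinner_cnj: "cnj (cinner n x y) = cinner n y x"
  unfolding cinner_def by (simp add: mult.commute)

lemma cinner_normalise:
  assumes "\<exists>i<n. x i \<noteq> 0"
  obtains c where "cinner n (\<lambda>i. c * x i) (\<lambda>i. c * x i) = 1" "c \<noteq> 0"
proof -
  define s where "s = (\<Sum>i<n. (cmod (x i))\<^sup>2)"
  have s: "s > 0"
  proof -
    obtain i where "i < n" "x i \<noteq> 0" using assms by blast
    then show ?thesis unfolding s_def by (intro sum_pos2[of _ i]) auto
  qed
  have "cinner n (\<lambda>i. of_real (1 / sqrt s) * x i) (\<lambda>i. of_real (1 / sqrt s) * x i) = 1"
    unfolding cinner_self norm_mult power_mult_distrib sum_distrib_left[symmetric] s_def[symmetric]
    using s by (simp add: norm_divide power_divide flip: of_real_power)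
  then show thesis using that[of "of_real (1 / sqrt s)"] s by auto
qed

lemma orthonormal_Suc:
  assumes "orthonormal n m u" "\<And>k. k < m \<Longrightarrow> cinner n (u k) x = 0" "cinner n x x = 1"
  shows "orthonormal n (Suc m) (u(m := x))"
proof -
  have "cinner n x (u k) = 0" if "k < m" for k
    using assms(2)[OF that] cinner_cnj[of n "u k" x] by simp
  then show ?thesis using assms by (auto simp: orthonormal_def less_Suc_eq)
qed

lemma orthonormal_extend:
  assumes "orthonormal n m u" "m \<le> n"
  obtains v where "orthonormal n n v" "\<And>k. k < m \<Longrightarrow> v k = u k"
  using assms
proof (induction "n - m" arbitrary: m u thesis)
  case 0
  then show ?case by auto
next
  case (Suc d)
  then have m: "m < n" by auto
  obtain x where x: "\<And>k. k < n \<Longrightarrow> k \<noteq> m \<Longrightarrow> (\<Sum>j<n. cnj (u k j) * x j) = 0" "\<exists>i<n. x i \<noteq> 0"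
    using homogeneous_system_nontrivial[OF m, of "\<lambda>k j. cnj (u k j)"] by blast
  obtain c where c: "cinner n (\<lambda>i. c * x i) (\<lambda>i. c * x i) = 1" using cinner_normalise[OF x(2)] by blast
  define u' where "u' = u(m := \<lambda>i. c * x i)"
  have o: "cinner n (u k) (\<lambda>i. c * x i) = 0" if "k < m" for k
    using x(1)[of k] that m unfolding cinner_def
    by (simp add: mult.left_commute sum_distrib_left[symmetric])
  have "orthonormal n (Suc m) u'"
    unfolding u'_def by (rule orthonormal_Suc[OF Suc.prems(2) o c])
  then obtain v where "orthonormal n n v" "\<And>k. k < Suc m \<Longrightarrow> v k = u' k"
    using Suc.hyps(1)[of "Suc m" u'] Suc.hyps(2) m
    by (metis Suc_diff_Suc Suc_inject Suc_leI)
  then show ?case using Suc.prems(1)[of v] by (auto simp: u'_def)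
qed

text \<open>For a square matrix a left inverse is a right inverse.\<close>

lemma orthonormal_complete:
  assumes "orthonormal n n u" "i < n" "j < n"
  shows "(\<Sum>k<n. u k i * cnj (u k j)) = (if i = j then 1 else 0)"
proof -
  define U where "U = mat n n (\<lambda>(i, k). u k i)"
  define V where "V = mat n n (\<lambda>(k, i). cnj (u k i))"
  have c: "U \<in> carrier_mat n n" "V \<in> carrier_mat n n" by (auto simp: U_def V_def)
  have "V * U = 1\<^sub>m n"
    using assms(1) by (auto intro!: eq_matI simp: U_def V_def scalar_prod_def orthonormal_def cinner_def atLeast0LessThan)
  then have "U * V = 1\<^sub>m n" using mat_mult_left_right_inverse[OF c(2,1)] by simp
  then have "(U * V) $$ (i, j) = 1\<^sub>m n $$ (i, j)" by simp
  then show ?thesis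
    using assms(2,3) by (simp add: U_def V_def scalar_prod_def atLeast0LessThan)
qed

lemma orthonormal_expansion:
  assumes "orthonormal n n u" "i < n"
  shows "x i = (\<Sum>k<n. u k i * cinner n (u k) x)"
proof -
  have "(\<Sum>k<n. u k i * cinner n (u k) x) = (\<Sum>k<n. \<Sum>j<n. (u k i * cnj (u k j)) * x j)"
    by (simp add: cinner_def sum_distrib_left mult_ac)
  also have "\<dots> = (\<Sum>j<n. (\<Sum>k<n. u k i * cnj (u k j)) * x j)"
    by (subst sum.swap) (simp add: sum_distrib_right)
  also have "\<dots> = (\<Sum>j<n. (if i = j then 1 else 0) * x j)"
    using orthonormal_complete[OF assms(1) assms(2)] by (intro sum.cong) auto
  also have "\<dots> = x i" using assms(2) by (simp add: if_distrib[of "\<lambda>c. c * _"] cong: if_cong)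
  finally show ?thesis by simp
qed

lemma parseval:
  assumes "orthonormal n n u"
  shows "cinner n x y = (\<Sum>k<n. cnj (cinner n (u k) x) * cinner n (u k) y)"
proof -
  have "cinner n x y = (\<Sum>i<n. \<Sum>k<n. cnj (x i) * (u k i * cinner n (u k) y))"
    unfolding sum_distrib_left[symmetric] cinner_def[of n x y]
    using orthonormal_expansion[OF assms, of _ y] by (intro sum.cong) auto
  also have "\<dots> = (\<Sum>k<n. (\<Sum>i<n. cnj (x i) * u k i) * cinner n (u k) y)"
    by (subst sum.swap) (simp add: sum_distrib_right mult.assoc)
  also have "\<dots> = (\<Sum>k<n. cnj (cinner n (u k) x) * cinner n (u k) y)"
    unfolding cinner_cnj by (simp add: cinner_def)
  finally show ?thesis .
qed

definition hermitian_mat :: "nat \<Rightarrow> complex mat \<Rightarrow> bool" where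
  "hermitian_mat n A \<longleftrightarrow> A \<in> carrier_mat n n \<and> (\<forall>i<n. \<forall>j<n. A $$ (i, j) = cnj (A $$ (j, i)))"

definition mat_apply :: "nat \<Rightarrow> complex mat \<Rightarrow> (nat \<Rightarrow> complex) \<Rightarrow> nat \<Rightarrow> complex" where
  "mat_apply n A x i = (\<Sum>j<n. A $$ (i, j) * x j)"

lemma cinner_mat_apply: 
  assumes "hermitian_mat n A"
  shows "cinner n x (mat_apply n A y) = cinner n (mat_apply n A x) y"
proof -
  have "cinner n x (mat_apply n A y) = (\<Sum>i<n. \<Sum>j<n. cnj (x i) * A $$ (i, j) * y j)"
    by (simp add: cinner_def mat_apply_def sum_distrib_left mult_ac)
  also have "\<dots> = (\<Sum>i<n. \<Sum>j<n. cnj (x i) * cnj (A $$ (j, i)) * y j)"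
  proof (intro sum.cong refl)
    fix i j assume "i \<in> {..<n}" "j \<in> {..<n}"
    then have "A $$ (i, j) = cnj (A $$ (j, i))" using assms unfolding hermitian_mat_def lessThan_iff by blast
    then show "cnj (x i) * A $$ (i, j) * y j = cnj (x i) * cnj (A $$ (j, i)) * y j"
      by (rule arg_cong[where f = "\<lambda>c. cnj (x i) * c * y j"])
  qed
  also have "\<dots> = cinner n (mat_apply n A x) y"
    by (subst sum.swap) (simp add: cinner_def mat_apply_def sum_distrib_left sum_distrib_right mult_ac)
  finally show ?thesis .
qed

lemma cinner_scale: "cinner n x (\<lambda>i. c * y i) = c * cinner n x y" "cinner n (\<lambda>i. c * x i) y = cnj c * cinner n x y"
  by (simp_all add: cinner_def sum_distrib_left mult_ac)

text \<open>The orthogonal complement of the eigenvectors found so far is invariant under \<open>A\<close>. In an orthonormal basis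
\<open>v\<^sub>m, \<dots>, v\<^bsub>n-1\<^esub>\<close> of it the restriction of \<open>A\<close> is the matrix \<open>B\<close> of size \<open>n - m\<close>, and any complex matrix of positive size has
an eigenvector.\<close>

lemma hermitian_eigenbasis_extend:
  assumes A: "hermitian_mat n A" and u: "orthonormal n m u" and m: "m < n"
    and ev: "\<And>k i. k < m \<Longrightarrow> i < n \<Longrightarrow> mat_apply n A (u k) i = e k * u k i"
  obtains x c where "cinner n x x = 1" "\<And>k. k < m \<Longrightarrow> cinner n (u k) x = 0" "\<And>i. i < n \<Longrightarrow> mat_apply n A x i = c * x i"
proof -
  obtain v where v: "orthonormal n n v" "\<And>k. k < m \<Longrightarrow> v k = u k"
    using orthonormal_extend[OF u] m by auto
  define d where "d = n - m"
  define B where "B = mat d d (\<lambda>(i, j). cinner n (v (m + i)) (mat_apply n A (v (m + j))))"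
  have B: "B \<in> carrier_mat d d" by (simp add: B_def)
  have "degree (char_poly B) = d" using degree_monic_char_poly[OF B] by simp
  then have "\<not> constant (poly (char_poly B))" using m by (simp add: d_def constant_degree)
  then obtain c where "poly (char_poly B) c = 0"
    using fundamental_theorem_of_algebra by blast
  then obtain z where z: "eigenvector B z c"
    using eigenvalue_root_char_poly[OF B] eigenvalue_def by blast
  then have zc: "z \<in> carrier_vec d" "z \<noteq> 0\<^sub>v d" and Bz: "B *\<^sub>v z = c \<cdot>\<^sub>v z"
    using B by (auto simp: eigenvector_def)
  define x where "x = (\<lambda>i. \<Sum>j<d. z $ j * v (m + j) i)"
  have ipx: "cinner n w x = (\<Sum>j<d. z $ j * cinner n w (v (m + j)))" for w
    unfolding x_def cinner_def sum_distrib_left by (subst sum.swap) (simp add: mult_ac)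
  have ipvx: "cinner n (v k) x = (if k < m then 0 else z $ (k - m))" if "k < n" for k
  proof -
    have "cinner n (v k) x = (\<Sum>j<d. z $ j * (if k = m + j then 1 else 0))"
      unfolding ipx using v(1) that by (intro sum.cong) (auto simp: orthonormal_def d_def)
    also have "\<dots> = (if k < m then 0 else z $ (k - m))"
    proof (cases "k < m")
      case False
      then have "k = m + j \<longleftrightarrow> j = k - m" for j by auto
      moreover have "k - m < d" using False that by (auto simp: d_def)
      ultimately show ?thesis using False by (simp add: if_distrib[of "\<lambda>c. _ * c"] cong: if_cong)
    qed (auto intro!: sum.neutral)
    finally show ?thesis .
  qed
  have appx: "mat_apply n A x i = c * x i" if "i < n" for i
  proof -
    have *: "cinner n (v k) (mat_apply n A x) = c * cinner n (v k) x" if k: "k < n" for k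
    proof (cases "k < m")
      case True
      have "cinner n (v k) (mat_apply n A x) = cinner n (mat_apply n A (v k)) x" by (rule cinner_mat_apply[OF A])
      also have "\<dots> = cinner n (\<lambda>i. e k * v k i) x"
        unfolding cinner_def using ev[OF True] v(2)[OF True] by (intro sum.cong) auto
      also have "\<dots> = 0" unfolding cinner_scale ipvx[OF k] using True by simp
      finally show ?thesis using ipvx[OF k] True by simp
    next
      case False
      then have kd: "k - m < d" using k by (auto simp: d_def)
      have "cinner n (v k) (mat_apply n A x) = cinner n (mat_apply n A (v k)) x" by (rule cinner_mat_apply[OF A])
      also have "\<dots> = (\<Sum>j<d. z $ j * cinner n (v k) (mat_apply n A (v (m + j))))"
        unfolding ipx cinner_mat_apply[OF A] ..
      also have "\<dots> = (B *\<^sub>v z) $ (k - m)"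
        using kd zc False by (simp add: B_def scalar_prod_def atLeast0LessThan mult.commute)
      also have "\<dots> = c * cinner n (v k) x" unfolding Bz ipvx[OF k] using kd zc False by simp
      finally show ?thesis .
    qed
    have "mat_apply n A x i = (\<Sum>k<n. v k i * (c * cinner n (v k) x))"
      by (subst orthonormal_expansion[OF v(1) that]) (simp add: *)
    also have "\<dots> = c * x i"
      by (subst (2) orthonormal_expansion[OF v(1) that]) (simp add: sum_distrib_left mult_ac)
    finally show ?thesis .
  qed
  have nz: "\<exists>i<n. x i \<noteq> 0"
  proof (rule ccontr)
    assume *: "\<not> ?thesis"
    have "z $ j = 0" if "j < d" for j
    proof -
      have "cinner n (v (m + j)) x = 0" using * by (simp add: cinner_def)
      then show ?thesis using ipvx[of "m + j"] that by (simp add: d_def)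
    qed
    then show False using zc by (metis carrier_vecD eq_vecI index_zero_vec)
  qed
  obtain a where a: "cinner n (\<lambda>i. a * x i) (\<lambda>i. a * x i) = 1" using cinner_normalise[OF nz] by blast
  show thesis
  proof (rule that[OF a])
    show "cinner n (u k) (\<lambda>i. a * x i) = 0" if "k < m" for k
      using ipvx[of k] v(2) that m by (simp add: cinner_scale)
    show "mat_apply n A (\<lambda>i. a * x i) i = c * (a * x i)" if "i < n" for i
      using appx[OF that] by (simp add: mat_apply_def mult.left_commute sum_distrib_left[symmetric])
  qed
qed

lemma hermitian_eigenbasis:
  assumes A: "hermitian_mat n A" and "m \<le> n"
  shows "\<exists>u e. orthonormal n m u \<and> (\<forall>k<m. \<forall>i<n. mat_apply n A (u k) i = complex_of_real (e k) * u k i)"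
  using assms(2)
proof (induction m)
  case 0
  then show ?case by (auto simp: orthonormal_def)
next
  case (Suc m)
  then obtain u e where u: "orthonormal n m u" 
     and e: "\<And>k i. k < m \<Longrightarrow> i < n \<Longrightarrow> mat_apply n A (u k) i = complex_of_real (e k) * u k i"
    by auto
  obtain x c where x: "cinner n x x = 1" "\<And>k. k < m \<Longrightarrow> cinner n (u k) x = 0" 
      "\<And>i. i < n \<Longrightarrow> mat_apply n A x i = c * x i"
    using hermitian_eigenbasis_extend[OF A u, of "\<lambda>k. complex_of_real (e k)"] e Suc.prems by (auto simp: Suc_le_eq)
  have "c = cinner n x (mat_apply n A x)" using x(1,3) by (simp add: cinner_def mult.left_commute sum_distrib_left[symmetric])
  moreover have "cnj c = cinner n (mat_apply n A x) x" using calculation by (simp add: cinner_cnj)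
  ultimately have "c = cnj c" using cinner_mat_apply[OF A, of x x] by simp
  then have "c \<in> \<real>" by (simp add: Reals_cnj_iff)
  then obtain r where r: "c = of_real r" by (rule Reals_cases)
  define u' where "u' = u(m := x)"
  have "orthonormal n (Suc m) u'"
    unfolding u'_def by (rule orthonormal_Suc[OF u x(2,1)])
  moreover have "\<forall>k<Suc m. \<forall>i<n. mat_apply n A (u' k) i = complex_of_real ((e(m := r)) k) * u' k i"
    using e x(3) r by (auto simp: u'_def less_Suc_eq)
  ultimately show ?case by blast
qed


lemma eigenbasis_entries:
  assumes u: "orthonormal n n u" and A: "A \<in> carrier_mat n n"
    and e: "\<And>k i. k < n \<Longrightarrow> i < n \<Longrightarrow> mat_apply n A (u k) i = e k * u k i"
    and ij: "i < n" "j < n"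
  shows "A $$ (i, j) = (\<Sum>k<n. e k * u k i * cnj (u k j))"
proof -
  have "(\<Sum>k<n. e k * u k i * cnj (u k j)) = (\<Sum>k<n. \<Sum>l<n. A $$ (i, l) * u k l * cnj (u k j))"
    using e ij by (intro sum.cong refl) (simp flip: e add: mat_apply_def sum_distrib_right)
  also have "\<dots> = (\<Sum>l<n. A $$ (i, l) * (\<Sum>k<n. u k l * cnj (u k j)))"
    by (subst sum.swap) (simp add: sum_distrib_left mult_ac)
  also have "\<dots> = (\<Sum>l<n. A $$ (i, l) * (if l = j then 1 else 0))"
    using orthonormal_complete[OF u _ ij(2)] by (intro sum.cong) auto
  also have "\<dots> = A $$ (i, j)" using ij by (simp add: if_distrib[of "\<lambda>c. _ * c"] cong: if_cong)
  finally show ?thesis by simp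
qed

text \<open>The eigenvectors diagonalise \<open>A\<close>, so the roots of the characteristic polynomial are the \<open>e k\<close> with multiplicity; a
sorted list is then its own sorting.\<close>

lemma ordered_eigenvalueI:
  assumes u: "orthonormal n n u" and A: "A \<in> carrier_mat n n"
    and ev: "\<And>k i. k < n \<Longrightarrow> i < n \<Longrightarrow> mat_apply n A (u k) i = of_real (e k) * u k i"
    and mono: "\<And>i j. i \<le> j \<Longrightarrow> j < n \<Longrightarrow> e i \<le> e j" and k: "k < n"
  shows "ordered_eigenvalue A k = e k"
proof -
  define U where "U = mat n n (\<lambda>(i, k). u k i)"
  define V where "V = mat n n (\<lambda>(k, i). cnj (u k i))"
  define D where "D = mat n n (\<lambda>(i, j). if i = j then complex_of_real (e i) else 0)"
  have c: "U \<in> carrier_mat n n" "V \<in> carrier_mat n n" "D \<in> carrier_mat n n" by (auto simp: U_def V_def D_def)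
  have UV: "U * V = 1\<^sub>m n"
    using orthonormal_complete[OF u] by (intro eq_matI) (auto simp: U_def V_def scalar_prod_def atLeast0LessThan)
  then have VU: "V * U = 1\<^sub>m n" using mat_mult_left_right_inverse[OF c(1,2)] by simp
  have "A = U * D * V"
  proof (rule eq_matI)
    fix i j assume "i < dim_row (U * D * V)" "j < dim_col (U * D * V)"
    then have ij: "i < n" "j < n" by (auto simp: U_def V_def)
    have UD: "(U * D) $$ (i, k) = of_real (e k) * u k i" if "k < n" for k
      using that ij by (simp add: U_def D_def scalar_prod_def atLeast0LessThan mult.commute
        if_distrib[of "\<lambda>c. _ * c"] cong: if_cong)
    have "(W * V) $$ (i, j) = (\<Sum>k<n. W $$ (i, k) * V $$ (k, j))" if "W \<in> carrier_mat n n" for W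
      using ij c that by (simp add: scalar_prod_def atLeast0LessThan)
    from this[of "U * D"] have "(U * D * V) $$ (i, j) = (\<Sum>k<n. (U * D) $$ (i, k) * V $$ (k, j))"
      using c by simp
    also have "\<dots> = (\<Sum>k<n. of_real (e k) * u k i * cnj (u k j))"
      using ij by (intro sum.cong) (auto simp: UD V_def)
    finally show "A $$ (i, j) = (U * D * V) $$ (i, j)"
      using eigenbasis_entries[OF u A ev ij] by simp
  qed (use c A in auto)
  then have "similar_mat A D"
    unfolding similar_mat_def similar_mat_wit_def Let_def
    by (intro exI[of _ U] exI[of _ V]) (use c A UV VU in auto)
  then have "char_poly A = char_poly D" by (rule char_poly_similar)
  also have "\<dots> = (\<Prod>a\<leftarrow>diag_mat D. [:- a, 1:])"
    using char_poly_upper_triangular[OF c(3)] by (auto simp: upper_triangular_def D_def)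
  also have "diag_mat D = map (complex_of_real \<circ> e) [0..<n]"
    using c by (auto simp: diag_mat_def D_def)
  finally have "char_poly A = (\<Prod>p\<leftarrow>map (\<lambda>k. [:- complex_of_real (e k), 1:]) [0..<n]. p)" by (simp add: o_def)
  then have "proots (char_poly A) = sum_list (map proots (map (\<lambda>k. [:- complex_of_real (e k), 1:]) [0..<n]))"
    by (simp only:) (rule proots_prod_list, auto)
  also have "\<dots> = mset (map (complex_of_real \<circ> e) [0..<n])"
  proof -
    have "sum_list (map proots (map (\<lambda>k. [:- complex_of_real (e k), 1:]) xs)) = mset (map (complex_of_real \<circ> e) xs)" for xs
      by (induction xs) auto
    then show ?thesis .
  qed
  finally have "image_mset Re (proots (char_poly A)) = mset (map e [0..<n])"
    by (simp flip: mset_map add: o_def)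
  moreover have "sorted (map e [0..<n])"
    using mono by (auto simp: sorted_iff_nth_mono)
  ultimately have "sorted_list_of_multiset (image_mset Re (proots (char_poly A))) = map e [0..<n]"
    by (simp add: sort_key_id_if_sorted flip: mset_map)
  then show ?thesis using k by (simp add: ordered_eigenvalue_def)
qed

lemma hermitian_spectral:
  assumes A: "hermitian_mat n A"
  obtains u where "orthonormal n n u"
    "\<And>k i. k < n \<Longrightarrow> i < n \<Longrightarrow> mat_apply n A (u k) i = of_real (ordered_eigenvalue A k) * u k i"
    "\<And>i j. i \<le> j \<Longrightarrow> j < n \<Longrightarrow> ordered_eigenvalue A i \<le> ordered_eigenvalue A j"
proof -
  obtain u e where u: "orthonormal n n u" 
     and e: "\<And>k i. k < n \<Longrightarrow> i < n \<Longrightarrow> mat_apply n A (u k) i = complex_of_real (e k) * u k i"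
    using hermitian_eigenbasis[OF A order_refl] by blast
  define p where "p = sort_key e [0..<n]"
  define u' where "u' = (\<lambda>k. u (p ! k))"
  define e' where "e' = (\<lambda>k. e (p ! k))"
  have len: "length p = n" and set: "set p = {..<n}" and dist: "distinct p" and sorted: "sorted (map e p)"
    by (auto simp: p_def)
  have p: "p ! k < n" if "k < n" for k using that len set nth_mem by fastforce
  have ou: "orthonormal n n u'"
    using u p dist len by (auto simp: orthonormal_def u'_def nth_eq_iff_index_eq)
  have ev: "mat_apply n A (u' k) i = of_real (e' k) * u' k i" if "k < n" "i < n" for k i
    using e p that by (simp add: u'_def e'_def)
  have mono: "e' i \<le> e' j" if "i \<le> j" "j < n" for i j
    using sorted that len sorted_nth_mono[of "map e p" i j] by (simp add: e'_def)
  have "ordered_eigenvalue A k = e' k" if "k < n" for k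
    using A that by (intro ordered_eigenvalueI[OF ou _ ev mono]) (auto simp: hermitian_mat_def)
  then show thesis using that[OF ou] ev mono by auto
qed

lemma quadratic_form_eigenbasis:
  assumes A: "hermitian_mat n A" and u: "orthonormal n n u"
    and ev: "\<And>k i. k < n \<Longrightarrow> i < n \<Longrightarrow> mat_apply n A (u k) i = of_real (e k) * u k i"
  shows "cinner n x (mat_apply n A x) = of_real (\<Sum>k<n. e k * (cmod (cinner n (u k) x))\<^sup>2)"
proof -
  have "cinner n (u k) (mat_apply n A x) = of_real (e k) * cinner n (u k) x" if k: "k < n" for k
  proof -
    have "cinner n (u k) (mat_apply n A x) = cinner n (\<lambda>i. of_real (e k) * u k i) x"
      unfolding cinner_mat_apply[OF A] unfolding cinner_def using ev[OF k] by (intro sum.cong) auto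
    then show ?thesis by (simp add: cinner_scale)
  qed
  then have "cinner n x (mat_apply n A x) = (\<Sum>k<n. cnj (cinner n (u k) x) * (of_real (e k) * cinner n (u k) x))"
    unfolding parseval[OF u, of x "mat_apply n A x"] by (intro sum.cong) auto
  also have "\<dots> = of_real (\<Sum>k<n. e k * (cmod (cinner n (u k) x))\<^sup>2)"
    by (simp add: of_real_sum complex_norm_square mult_ac del: of_real_power)
  finally show ?thesis .
qed

text \<open>The Courant-Fischer argument. There is a nonzero \<open>x\<close> that is orthogonal to the eigenvectors of \<open>A\<close> with index below \<open>i\<close> and
to those of \<open>B\<close> with index above \<open>i\<close>, since these are only \<open>n - 1\<close> conditions. For this \<open>x\<close> the quadratic form of \<open>A\<close> is at
least its \<open>i\<close>-th eigenvalue, and that of \<open>B\<close> at most its \<open>i\<close>-th eigenvalue, times the squared norm of \<open>x\<close>.\<close>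

lemma weyl_one_sided:
  assumes A: "hermitian_mat n A" and B: "hermitian_mat n B" and i: "i < n"
  shows "ordered_eigenvalue A i \<le> ordered_eigenvalue B i + (\<Sum>k<n. \<Sum>l<n. cmod (A $$ (k, l) - B $$ (k, l)))"
proof -
  define a where "a = ordered_eigenvalue A"
  define b where "b = ordered_eigenvalue B"
  obtain u where u: "orthonormal n n u"
    "\<And>k i. k < n \<Longrightarrow> i < n \<Longrightarrow> mat_apply n A (u k) i = of_real (a k) * u k i"
    "\<And>i j. i \<le> j \<Longrightarrow> j < n \<Longrightarrow> a i \<le> a j"
    unfolding a_def using hermitian_spectral[OF A] by blast
  obtain v where v: "orthonormal n n v"
    "\<And>k i. k < n \<Longrightarrow> i < n \<Longrightarrow> mat_apply n B (v k) i = of_real (b k) * v k i"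
    "\<And>i j. i \<le> j \<Longrightarrow> j < n \<Longrightarrow> b i \<le> b j"
    unfolding b_def using hermitian_spectral[OF B] by blast
  obtain x where x: "\<And>m. m < n \<Longrightarrow> m \<noteq> i \<Longrightarrow> (\<Sum>j<n. (if m < i then cnj (u m j) else cnj (v m j)) * x j) = 0" 
      "\<exists>i<n. x i \<noteq> 0"
    using homogeneous_system_nontrivial[OF i, of "\<lambda>m j. if m < i then cnj (u m j) else cnj (v m j)"] by blast
  have ux: "cinner n (u m) x = 0" if "m < i" for m using x(1)[of m] that i by (simp add: cinner_def)
  have vx: "cinner n (v m) x = 0" if "i < m" "m < n" for m using x(1)[of m] that by (simp add: cinner_def)
  define s where "s = (\<Sum>i<n. (cmod (x i))\<^sup>2)"
  have s: "s > 0"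
  proof -
    obtain i where "i < n" "x i \<noteq> 0" using x(2) by blast
    then show ?thesis unfolding s_def by (intro sum_pos2[of _ i]) auto
  qed
  have norm: "(\<Sum>k<n. (cmod (cinner n (w k) x))\<^sup>2) = s" if "orthonormal n n w" for w
  proof -
    have "complex_of_real s = complex_of_real (\<Sum>k<n. (cmod (cinner n (w k) x))\<^sup>2)"
      unfolding s_def unfolding cinner_self[of n x, symmetric] parseval[OF that, of x x]
      by (simp add: of_real_sum complex_norm_square mult_ac del: of_real_power)
    then show ?thesis unfolding of_real_eq_iff by simp
  qed
  have "a i * s = (\<Sum>k<n. a i * (cmod (cinner n (u k) x))\<^sup>2)"
    by (simp add: norm[OF u(1)] flip: sum_distrib_left)
  also have "\<dots> \<le> (\<Sum>k<n. a k * (cmod (cinner n (u k) x))\<^sup>2)"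
  proof (rule sum_mono)
    fix k assume "k \<in> {..<n}"
    then show "a i * (cmod (cinner n (u k) x))\<^sup>2 \<le> a k * (cmod (cinner n (u k) x))\<^sup>2"
      using u(3)[of i k] ux[of k] by (cases "k < i") (auto intro: mult_right_mono)
  qed
  finally have 1: "a i * s \<le> Re (cinner n x (mat_apply n A x))"
    using quadratic_form_eigenbasis[OF A u(1), of a x] u(2) by simp
  have "(\<Sum>k<n. b k * (cmod (cinner n (v k) x))\<^sup>2) \<le> (\<Sum>k<n. b i * (cmod (cinner n (v k) x))\<^sup>2)"
  proof (rule sum_mono)
    fix k assume "k \<in> {..<n}"
    then show "b k * (cmod (cinner n (v k) x))\<^sup>2 \<le> b i * (cmod (cinner n (v k) x))\<^sup>2"
      using v(3)[of k i] vx[of k] i by (cases "i < k") (auto intro: mult_right_mono)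
  qed
  also have "\<dots> = b i * s"
    by (simp add: norm[OF v(1)] flip: sum_distrib_left)
  finally have 2: "Re (cinner n x (mat_apply n B x)) \<le> b i * s"
    using quadratic_form_eigenbasis[OF B v(1), of b x] v(2) by simp
  have xs: "cmod (x k) * cmod (x l) \<le> s" if "k < n" "l < n" for k l
  proof -
    have "(cmod (x m))\<^sup>2 \<le> s" if "m < n" for m
      unfolding s_def by (rule member_le_sum) (use that in auto)
    from this[OF that(1)] this[OF that(2)] show ?thesis
      using sum_squares_bound[of "cmod (x k)" "cmod (x l)"] by linarith
  qed
  have "cinner n x (mat_apply n A x) - cinner n x (mat_apply n B x)
      = (\<Sum>k<n. \<Sum>l<n. cnj (x k) * ((A $$ (k, l) - B $$ (k, l)) * x l))"
    by (simp add: cinner_def mat_apply_def sum_distrib_left flip: sum_subtractf) (simp add: algebra_simps)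
  then have "Re (cinner n x (mat_apply n A x)) - Re (cinner n x (mat_apply n B x))
      \<le> cmod (\<Sum>k<n. \<Sum>l<n. cnj (x k) * ((A $$ (k, l) - B $$ (k, l)) * x l))"
    by (metis complex_Re_le_cmod minus_complex.sel(1))
  also have "\<dots> \<le> (\<Sum>k<n. \<Sum>l<n. cmod (cnj (x k) * ((A $$ (k, l) - B $$ (k, l)) * x l)))"
    by (rule order_trans[OF norm_sum sum_mono[OF norm_sum]])
  also have "\<dots> \<le> (\<Sum>k<n. \<Sum>l<n. cmod (A $$ (k, l) - B $$ (k, l)) * s)"
  proof (intro sum_mono)
    fix k l assume "k \<in> {..<n}" "l \<in> {..<n}"
    then show "cmod (cnj (x k) * ((A $$ (k, l) - B $$ (k, l)) * x l)) \<le> cmod (A $$ (k, l) - B $$ (k, l)) * s"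
      using mult_left_mono[OF xs, of k l "cmod (A $$ (k, l) - B $$ (k, l))"] by (simp add: norm_mult mult_ac)
  qed
  also have "\<dots> = (\<Sum>k<n. \<Sum>l<n. cmod (A $$ (k, l) - B $$ (k, l))) * s"
    by (simp add: sum_distrib_right)
  finally have "a i * s \<le> (b i + (\<Sum>k<n. \<Sum>l<n. cmod (A $$ (k, l) - B $$ (k, l)))) * s"
    using 1 2 by (simp add: algebra_simps)
  then show ?thesis using s by (simp add: a_def b_def)
qed

lemma weyl_inequality:
  assumes "hermitian_mat n A" and "hermitian_mat n B" and "i < n"
  shows "\<bar>ordered_eigenvalue A i - ordered_eigenvalue B i\<bar> \<le> (\<Sum>k<n. \<Sum>l<n. cmod (A $$ (k, l) - B $$ (k, l)))"
  using weyl_one_sided[OF assms] weyl_one_sided[OF assms(2,1,3)] by (simp add: norm_minus_commute abs_le_iff)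

lemma ordered_eigenvalue_affine:
  assumes A: "hermitian_mat n A" and B: "B \<in> carrier_mat n n" and s: "s \<ge> 0"
    and BA: "\<And>i j. i < n \<Longrightarrow> j < n \<Longrightarrow> B $$ (i, j) = (if i = j then of_real c else 0) + of_real s * A $$ (i, j)"
    and k: "k < n"
  shows "ordered_eigenvalue B k = c + s * ordered_eigenvalue A k"
proof -
  obtain u where u: "orthonormal n n u"
    "\<And>k i. k < n \<Longrightarrow> i < n \<Longrightarrow> mat_apply n A (u k) i = of_real (ordered_eigenvalue A k) * u k i"
    "\<And>i j. i \<le> j \<Longrightarrow> j < n \<Longrightarrow> ordered_eigenvalue A i \<le> ordered_eigenvalue A j"
    using hermitian_spectral[OF A] by blast
  show ?thesis
  proof (rule ordered_eigenvalueI[OF u(1) B _ _ k])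
    fix k i assume ki: "k < n" "i < n"
    have "mat_apply n B (u k) i = (\<Sum>j<n. (if i = j then of_real c * u k j else 0) + of_real s * (A $$ (i, j) * u k j))"
      unfolding mat_apply_def using ki BA by (intro sum.cong) (auto simp: algebra_simps)
    also have "\<dots> = of_real c * u k i + of_real s * mat_apply n A (u k) i"
      using ki by (simp add: sum.distrib mat_apply_def sum_distrib_left)
    finally show "mat_apply n B (u k) i = complex_of_real (c + s * ordered_eigenvalue A k) * u k i"
      using ki by (simp add: u(2) algebra_simps)
  qed (use s u(3) in \<open>auto intro: mult_left_mono\<close>)
qed

section \<open>Functionals of continuous paths\<close>

lemma continuous_on_finitely_many_coordinates:
  fixes G :: "('i::countable \<Rightarrow> real) \<Rightarrow> real"
  assumes "finite I" "\<And>v w. \<bar>G v - G w\<bar> \<le> c * (\<Sum>i\<in>I. \<bar>v i - w i\<bar>)"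
  shows "continuous_on UNIV G"
proof -
  have "isCont G v" for v
  proof -
    have "((\<lambda>w. c * (\<Sum>i\<in>I. \<bar>w i - v i\<bar>)) \<longlongrightarrow> c * (\<Sum>i\<in>I. \<bar>v i - v i\<bar>)) (at v)"
    proof (intro tendsto_intros)
      fix i show "((\<lambda>w. w i) \<longlongrightarrow> v i) (at v)"
        using continuous_on_product_coordinates[of i, where 'b = real]
        unfolding continuous_on_def by auto
    qed
    then have lim: "((\<lambda>w. c * (\<Sum>i\<in>I. \<bar>w i - v i\<bar>)) \<longlongrightarrow> 0) (at v)" by simp
    have "((\<lambda>w. G w - G v) \<longlongrightarrow> 0) (at v)"
      by (rule Lim_null_comparison[OF always_eventually lim]) (simp add: assms(2))
    then show ?thesis by (simp add: isCont_def LIM_zero_iff)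
  qed
  then show ?thesis by (simp add: continuous_on_eq_continuous_at)
qed

text \<open>The truncation at \<open>1\<close> keeps the supremum meaningful for arbitrary functions, in particular for the discontinuous
step functions below, which are not elements of \<open>path_space\<close>.\<close>

definition path_dist :: "nat \<Rightarrow> nat \<Rightarrow> (real \<Rightarrow> nat \<Rightarrow> real) \<Rightarrow> (real \<Rightarrow> nat \<Rightarrow> real) \<Rightarrow> real" where
  "path_dist N k f g = (SUP (t, i)\<in>{0..real k} \<times> {..<N}. min 1 \<bar>f t i - g t i\<bar>)"

lemma path_dist_bdd:
  fixes f g :: "real \<Rightarrow> nat \<Rightarrow> real"
  shows "bdd_above ((\<lambda>(t, i). min 1 \<bar>f t i - g t i\<bar>) ` ({0..real k} \<times> {..<N}))"
  by (rule bdd_aboveI[of _ 1]) (auto simp: min_le_iff_disj)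

lemma path_dist_upper:
  assumes "0 \<le> t" "t \<le> real k" "i < N"
  shows "min 1 \<bar>f t i - g t i\<bar> \<le> path_dist N k f g"
  unfolding path_dist_def
  using cSUP_upper[OF _ path_dist_bdd[of f g], of "(t, i)" k N] assms by auto

lemma path_dist_least:
  assumes "N \<ge> 1" "\<And>t i. 0 \<le> t \<Longrightarrow> t \<le> real k \<Longrightarrow> i < N \<Longrightarrow> min 1 \<bar>f t i - g t i\<bar> \<le> c"
  shows "path_dist N k f g \<le> c"
  unfolding path_dist_def using assms
  by (intro cSUP_least) (auto simp: lessThan_empty_iff)

lemma path_dist_nonneg: "N \<ge> 1 \<Longrightarrow> 0 \<le> path_dist N k f g"
  using path_dist_upper[of 0 k 0 N f g] by auto

lemma path_dist_le_1: "N \<ge> 1 \<Longrightarrow> path_dist N k f g \<le> 1"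
  by (rule path_dist_least) (auto simp: min_le_iff_disj)

lemma path_dist_refl: "N \<ge> 1 \<Longrightarrow> path_dist N k f f = 0"
  using path_dist_nonneg[of N k f f] by (intro antisym path_dist_least) auto

lemma path_dist_sym: "path_dist N k f g = path_dist N k g f"
  unfolding path_dist_def by (simp add: abs_minus_commute)

lemma path_dist_triangle:
  assumes "N \<ge> 1"
  shows "path_dist N k f h \<le> path_dist N k f g + path_dist N k g h"
proof (rule path_dist_least[OF assms])
  fix t i assume *: "0 \<le> t" "t \<le> real k" "i < N"
  have "min 1 \<bar>f t i - h t i\<bar> \<le> min 1 \<bar>f t i - g t i\<bar> + min 1 \<bar>g t i - h t i\<bar>"
    by (simp only: min_def split: if_split) linarith
  then show "min 1 \<bar>f t i - h t i\<bar> \<le> path_dist N k f g + path_dist N k g h"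
    using path_dist_upper[OF *, of f g] path_dist_upper[OF *, of g h] by linarith
qed

lemma path_dist_mono:
  assumes "N \<ge> 1" "k \<le> l"
  shows "path_dist N k f g \<le> path_dist N l f g"
  using assms by (intro path_dist_least path_dist_upper) auto

text \<open>The Pasch-Hausdorff envelope of \<open>F\<close>. The infimum runs over continuous paths, but the argument \<open>f\<close> may be any function.\<close>

definition lip_env :: "nat \<Rightarrow> ((real \<Rightarrow> nat \<Rightarrow> real) \<Rightarrow> real) \<Rightarrow> nat \<Rightarrow> (real \<Rightarrow> nat \<Rightarrow> real) \<Rightarrow> real" where
  "lip_env N F k f = (INF g\<in>path_space N. F g + real k * path_dist N k f g)"

lemma path_space_iff:
  "f \<in> path_space N \<longleftrightarrow> f \<in> extensional {0..} \<and> (\<forall>i. continuous_on {0..} (\<lambda>t. f t i)) \<and> (\<forall>t\<ge>0. \<forall>i\<ge>N. f t i = 0)"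
  unfolding path_space_def Euclidean_space_def
  by (auto simp: continuous_map_in_subtopology continuous_map_componentwise_UNIV image_subset_iff)

lemma path_space_nonempty: "path_space N \<noteq> {}"
proof -
  have "(\<lambda>t\<in>{0..}. \<lambda>i. 0) \<in> path_space N"
    by (auto simp: path_space_iff intro!: continuous_on_eq[OF continuous_on_const[of _ 0]])
  then show ?thesis by blast
qed

context
  fixes N :: nat and F :: "(real \<Rightarrow> nat \<Rightarrow> real) \<Rightarrow> real" and B :: real
  assumes N: "N \<ge> 1" and F: "\<forall>g\<in>path_space N. \<bar>F g\<bar> \<le> B"
begin

lemma lip_env_bdd: "bdd_below ((\<lambda>g. F g + real k * path_dist N k f g) ` path_space N)"
proof (rule bdd_belowI[of _ "-B"])
  fix y assume "y \<in> (\<lambda>g. F g + real k * path_dist N k f g) ` path_space N"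
  then obtain g where g: "g \<in> path_space N" "y = F g + real k * path_dist N k f g" by auto
  have "0 \<le> real k * path_dist N k f g" using path_dist_nonneg[OF N] by simp
  then show "- B \<le> y" using g(2) bspec[OF F g(1)] by linarith
qed

lemma lip_env_lower: "g \<in> path_space N \<Longrightarrow> lip_env N F k f \<le> F g + real k * path_dist N k f g"
  unfolding lip_env_def by (rule cINF_lower[OF lip_env_bdd])

lemma lip_env_greatest:
  "(\<And>g. g \<in> path_space N \<Longrightarrow> c \<le> F g + real k * path_dist N k f g) \<Longrightarrow> c \<le> lip_env N F k f"
  unfolding lip_env_def by (rule cINF_greatest[OF path_space_nonempty])

lemma lip_env_le: "f \<in> path_space N \<Longrightarrow> lip_env N F k f \<le> F f"
  using lip_env_lower[of f k f] path_dist_refl[OF N] by simp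

lemma lip_env_abs: "\<bar>lip_env N F k f\<bar> \<le> B + real k"
proof -
  have "- B \<le> lip_env N F k f"
  proof (rule lip_env_greatest)
    fix g assume g: "g \<in> path_space N"
    have "0 \<le> real k * path_dist N k f g" using path_dist_nonneg[OF N] by simp
    then show "- B \<le> F g + real k * path_dist N k f g" using bspec[OF F g] by linarith
  qed
  moreover obtain g where g: "g \<in> path_space N" using path_space_nonempty by blast
  have "real k * path_dist N k f g \<le> real k" using path_dist_le_1[OF N, of k f g] by (simp add: mult_left_le)
  then have "lip_env N F k f \<le> B + real k" using lip_env_lower[OF g, of k f] bspec[OF F g] by linarith
  ultimately show ?thesis by linarith
qed

lemma lip_env_mono: "k \<le> l \<Longrightarrow> lip_env N F k f \<le> lip_env N F l f"
proof (rule lip_env_greatest)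
  fix g assume kl: "k \<le> l" and g: "g \<in> path_space N"
  have "real k * path_dist N k f g \<le> real l * path_dist N l f g"
    using kl path_dist_mono[OF N kl] path_dist_nonneg[OF N] by (intro mult_mono) auto
  then show "lip_env N F k f \<le> F g + real l * path_dist N l f g"
    using lip_env_lower[OF g, of k f] by linarith
qed

lemma lip_env_Lipschitz: "\<bar>lip_env N F k f - lip_env N F k f'\<bar> \<le> real k * path_dist N k f f'"
proof -
  have *: "lip_env N F k f - real k * path_dist N k f f' \<le> lip_env N F k f'" for f f'
  proof (rule lip_env_greatest)
    fix g assume g: "g \<in> path_space N"
    have "real k * path_dist N k f g \<le> real k * (path_dist N k f f' + path_dist N k f' g)"
      by (intro mult_left_mono path_dist_triangle[OF N]) auto
    then show "lip_env N F k f - real k * path_dist N k f f' \<le> F g + real k * path_dist N k f' g"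
      using lip_env_lower[OF g, of k f] by (simp add: distrib_left)
  qed
  show ?thesis using *[of f f'] *[of f' f] by (simp add: path_dist_sym[of N k f' f] abs_le_iff)
qed

text \<open>Only lower semicontinuity at \<open>f\<close> is required, so that the lemma also applies to indicators of open sets. Paths close
to \<open>f\<close> on the compact set \<open>K\<close> have almost as large a value of \<open>F\<close>; for all other paths the penalty
\<open>k d\<^sub>k(f,g)\<close> exceeds the oscillation \<open>2B\<close> of \<open>F\<close> as soon as \<open>k\<close> is large.\<close>

lemma lip_env_tendsto:
  assumes f: "f \<in> path_space N"
    and lsc: "\<And>\<eta>. \<eta> > 0 \<Longrightarrow> \<exists>K \<epsilon>. compact K \<and> K \<subseteq> {0..} \<and> 0 < \<epsilon> \<and>
        (\<forall>g\<in>path_space N. (\<forall>t\<in>K. \<forall>i<N. \<bar>g t i - f t i\<bar> < \<epsilon>) \<longrightarrow> F f - \<eta> \<le> F g)"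
  shows "(\<lambda>k. lip_env N F k f) \<longlonglongrightarrow> F f"
proof (rule LIMSEQ_I)
  fix \<eta> :: real assume \<eta>: "\<eta> > 0"
  then obtain K \<epsilon> where K: "compact K" "K \<subseteq> {0..}" "0 < \<epsilon>"
    and near: "\<And>g. g \<in> path_space N \<Longrightarrow> (\<forall>t\<in>K. \<forall>i<N. \<bar>g t i - f t i\<bar> < \<epsilon>) \<Longrightarrow> F f - \<eta> / 2 \<le> F g"
    using lsc[of "\<eta> / 2"] by (auto simp: half_gt_zero)
  obtain T where T: "\<And>t. t \<in> K \<Longrightarrow> t \<le> T"
    using compact_imp_bounded[OF K(1)] by (meson abs_le_D1 bounded_real)
  \<comment> \<open>Beyond \<open>k0\<close> the set \<open>K\<close> lies in \<open>[0,k]\<close>, and the penalty for leaving the neighbourhood is at least \<open>2B\<close>.\<close>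
  define k0 where "k0 = nat \<lceil>max T (2 * B / min 1 \<epsilon>)\<rceil>"
  have k0: "T \<le> real k0" "2 * B / min 1 \<epsilon> \<le> real k0" unfolding k0_def by linarith+
  have low: "F f - \<eta> / 2 \<le> lip_env N F k f" if k: "k \<ge> k0" for k
  proof (rule lip_env_greatest)
    fix g assume g: "g \<in> path_space N"
    show "F f - \<eta> / 2 \<le> F g + real k * path_dist N k f g"
    proof (cases "\<forall>t\<in>K. \<forall>i<N. \<bar>g t i - f t i\<bar> < \<epsilon>")
      case True
      have "0 \<le> real k * path_dist N k f g" using path_dist_nonneg[OF N] by simp
      then show ?thesis using near[OF g True] by linarith
    next
      case False
      then obtain t i where ti: "t \<in> K" "i < N" "\<epsilon> \<le> \<bar>g t i - f t i\<bar>" by (meson not_le)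
      have "min 1 \<bar>f t i - g t i\<bar> \<le> path_dist N k f g"
        using ti T[OF ti(1)] K(2) k0(1) k by (intro path_dist_upper) auto
      then have d: "min 1 \<epsilon> \<le> path_dist N k f g" using ti(3) by (simp add: abs_minus_commute)
      have "2 * B \<le> real k0 * min 1 \<epsilon>" using k0(2) K(3) by (simp add: pos_divide_le_eq)
      also have "\<dots> \<le> real k * path_dist N k f g" using k d K(3) by (intro mult_mono) auto
      finally show ?thesis using bspec[OF F g] bspec[OF F f] \<eta> by linarith
    qed
  qed
  have "norm (lip_env N F k f - F f) < \<eta>" if k: "k \<ge> k0" for k
    using low[OF k] lip_env_le[OF f, of k] \<eta> by simp
  then show "\<exists>no. \<forall>k\<ge>no. norm (lip_env N F k f - F f) < \<eta>" by blast
qed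

end


definition dyadic_floor :: "nat \<Rightarrow> real \<Rightarrow> nat" where
  "dyadic_floor n t = nat \<lfloor>2 ^ n * t\<rfloor>"

definition step_path :: "nat \<Rightarrow> (real \<Rightarrow> 'b) \<Rightarrow> real \<Rightarrow> 'b" where
  "step_path n f t = f (real (dyadic_floor n t) / 2 ^ n)"

lemma dyadic_floor_bounds:
  assumes "t \<ge> 0"
  shows "real (dyadic_floor n t) / 2 ^ n \<le> t" "t < real (Suc (dyadic_floor n t)) / 2 ^ n"
proof -
  have "real (dyadic_floor n t) \<le> 2 ^ n * t" "2 ^ n * t < real (dyadic_floor n t) + 1"
    using assms by (simp_all add: dyadic_floor_def of_nat_nat)
  then show "real (dyadic_floor n t) / 2 ^ n \<le> t" "t < real (Suc (dyadic_floor n t)) / 2 ^ n"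
    by (simp_all add: field_simps)
qed

lemma dyadic_floor_le:
  assumes "t \<ge> 0" "t \<le> real k"
  shows "dyadic_floor n t \<le> k * 2 ^ n"
proof -
  have "real (dyadic_floor n t) \<le> 2 ^ n * t" 
    using dyadic_floor_bounds(1)[OF assms(1), of n] by (simp add: field_simps)
  also have "\<dots> \<le> 2 ^ n * real k" using assms by simp
  finally have "real (dyadic_floor n t) \<le> real (k * 2 ^ n)" by (simp add: mult.commute)
  then show ?thesis by linarith
qed

lemma step_path_uniform:
  fixes f :: "real \<Rightarrow> nat \<Rightarrow> real"
  assumes N: "N \<ge> 1" and f: "f \<in> path_space N"
  shows "(\<lambda>n. path_dist N k f (step_path n f)) \<longlonglongrightarrow> 0"
proof (rule LIMSEQ_I)
  fix \<epsilon> :: real assume \<epsilon>: "\<epsilon> > 0"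
  have "\<forall>i. \<exists>d>0. \<forall>s\<in>{0..real k}. \<forall>t\<in>{0..real k}. dist s t < d \<longrightarrow> dist (f s i) (f t i) < \<epsilon> / 2"
  proof
    fix i
    have "continuous_on {0..real k} (\<lambda>t. f t i)"
      using f by (auto simp: path_space_iff intro: continuous_on_subset)
    then have "uniformly_continuous_on {0..real k} (\<lambda>t. f t i)"
      by (rule compact_uniformly_continuous) auto
    then show "\<exists>d>0. \<forall>s\<in>{0..real k}. \<forall>t\<in>{0..real k}. dist s t < d \<longrightarrow> dist (f s i) (f t i) < \<epsilon> / 2"
      using \<epsilon> unfolding uniformly_continuous_on_def by (metis dist_commute half_gt_zero)
  qed
  then obtain d where d: "\<And>i. d i > 0"
    "\<And>i s t. s \<in> {0..real k} \<Longrightarrow> t \<in> {0..real k} \<Longrightarrow> dist s t < d i \<Longrightarrow> dist (f s i) (f t i) < \<epsilon> / 2"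
    by metis
  define d0 where "d0 = Min (d ` {..<N})"
  have d0: "d0 > 0" "\<And>i. i < N \<Longrightarrow> d0 \<le> d i"
    using N d(1) by (auto simp: d0_def lessThan_empty_iff)
  obtain n0 where n0: "(1 / 2) ^ n0 < d0" using real_arch_pow_inv[OF d0(1), of "1/2"] by auto
  have "path_dist N k f (step_path n f) \<le> \<epsilon> / 2" if n: "n \<ge> n0" for n
  proof (rule path_dist_least[OF N])
    fix t i assume t: "0 \<le> t" "t \<le> real k" and i: "i < N"
    have "(1 / 2 :: real) ^ n \<le> (1 / 2) ^ n0" using n by (intro power_decreasing) auto
    then have "dist t (real (dyadic_floor n t) / 2 ^ n) < d i"
      using dyadic_floor_bounds[OF t(1), of n] n0 d0(2)[OF i]
      by (simp add: dist_real_def add_divide_distrib power_divide)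
    then have "dist (f t i) (f (real (dyadic_floor n t) / 2 ^ n) i) < \<epsilon> / 2"
      using t dyadic_floor_bounds(1)[OF t(1), of n] by (intro d(2)) auto
    then show "min 1 \<bar>f t i - step_path n f t i\<bar> \<le> \<epsilon> / 2"
      unfolding step_path_def dist_real_def by (intro min.coboundedI2) simp
  qed
  then show "\<exists>no. \<forall>n\<ge>no. norm (path_dist N k f (step_path n f) - 0) < \<epsilon>"
    using path_dist_nonneg[OF N] \<epsilon> by (intro exI[of _ n0]) (fastforce simp: abs_of_nonneg)
qed

text \<open>On step functions the envelope is a continuous function of finitely many random variables; on continuous paths it is the
limit of its values on the step functions, since those converge uniformly on \<open>[0,k]\<close>.\<close>

lemma lip_env_measurable:
  assumes N: "N \<ge> 1" and F: "\<forall>g\<in>path_space N. \<bar>F g\<bar> \<le> B"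
    and Z: "\<forall>\<omega>\<in>space P. Z \<omega> \<in> path_space N"
    and meas: "\<forall>t\<ge>0. \<forall>i<N. (\<lambda>\<omega>. Z \<omega> t i) \<in> borel_measurable P"
  shows "(\<lambda>\<omega>. lip_env N F k (Z \<omega>)) \<in> borel_measurable P"
    "(\<lambda>\<omega>. lip_env N F k (step_path n (Z \<omega>))) \<in> borel_measurable P"
proof -
  show *: "(\<lambda>\<omega>. lip_env N F k (step_path n (Z \<omega>))) \<in> borel_measurable P" for n
  proof -
    define sp where "sp v = (\<lambda>t i. if i < N then v (dyadic_floor n t, i) else 0)" for v :: "nat \<times> nat \<Rightarrow> real"
    define I where "I = {..k * 2 ^ n} \<times> {..<N}"
    have "\<bar>lip_env N F k (sp v) - lip_env N F k (sp w)\<bar> \<le> real k * (\<Sum>i\<in>I. \<bar>v i - w i\<bar>)" for v w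
    proof -
      have "path_dist N k (sp v) (sp w) \<le> (\<Sum>i\<in>I. \<bar>v i - w i\<bar>)"
      proof (rule path_dist_least[OF N])
        fix t i assume "0 \<le> t" "t \<le> real k" "i < N"
        then have "(dyadic_floor n t, i) \<in> I" using dyadic_floor_le by (auto simp: I_def)
        then have "\<bar>v (dyadic_floor n t, i) - w (dyadic_floor n t, i)\<bar> \<le> (\<Sum>i\<in>I. \<bar>v i - w i\<bar>)"
          by (rule member_le_sum) (auto simp: I_def)
        then show "min 1 \<bar>sp v t i - sp w t i\<bar> \<le> (\<Sum>i\<in>I. \<bar>v i - w i\<bar>)"
          using \<open>i < N\<close> by (simp add: sp_def)
      qed
      then have "real k * path_dist N k (sp v) (sp w) \<le> real k * (\<Sum>i\<in>I. \<bar>v i - w i\<bar>)"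
        by (rule mult_left_mono) simp
      then show ?thesis using lip_env_Lipschitz[OF N F, of k "sp v" "sp w"] by linarith
    qed
    then have "continuous_on UNIV (\<lambda>v. lip_env N F k (sp v))"
      by (rule continuous_on_finitely_many_coordinates[of I, rotated]) (simp add: I_def)
    then have 1: "(\<lambda>v. lip_env N F k (sp v)) \<in> borel_measurable borel"
      by (rule borel_measurable_continuous_onI)
    have 2: "(\<lambda>\<omega> (l, i). if i < N then Z \<omega> (real l / 2 ^ n) i else 0) \<in> borel_measurable P"
    proof (rule measurable_coordinatewise_then_product)
      fix li :: "nat \<times> nat"
      show "(\<lambda>\<omega>. case li of (l, i) \<Rightarrow> if i < N then Z \<omega> (real l / 2 ^ n) i else 0) \<in> borel_measurable P"
        using meas by (cases li; cases "snd li < N") simp_all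
    qed
    have "lip_env N F k (step_path n (Z \<omega>)) = lip_env N F k (sp (\<lambda>(l, i). if i < N then Z \<omega> (real l / 2 ^ n) i else 0))"
      for \<omega>
    proof -
      have "path_dist N k (step_path n (Z \<omega>)) (sp (\<lambda>(l, i). if i < N then Z \<omega> (real l / 2 ^ n) i else 0)) = 0"
        using path_dist_nonneg[OF N] 
        by (intro antisym path_dist_least[OF N]) (auto simp: sp_def step_path_def)
      then show ?thesis
        using lip_env_Lipschitz[OF N F, of k "step_path n (Z \<omega>)" "sp (\<lambda>(l, i). if i < N then Z \<omega> (real l / 2 ^ n) i else 0)"]
        by simp
    qed
    then show ?thesis using measurable_compose[OF 2 1] by simp
  qed
  show "(\<lambda>\<omega>. lip_env N F k (Z \<omega>)) \<in> borel_measurable P"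
  proof (rule borel_measurable_LIMSEQ_real[OF _ *])
    fix \<omega> assume \<omega>: "\<omega> \<in> space P"
    have "(\<lambda>n. real k * path_dist N k (Z \<omega>) (step_path n (Z \<omega>))) \<longlonglongrightarrow> real k * 0"
      by (intro tendsto_intros step_path_uniform[OF N bspec[OF Z \<omega>]])
    then have lim: "(\<lambda>n. real k * path_dist N k (Z \<omega>) (step_path n (Z \<omega>))) \<longlonglongrightarrow> 0" by simp
    have "norm (lip_env N F k (step_path n (Z \<omega>)) - lip_env N F k (Z \<omega>)) \<le> real k * path_dist N k (Z \<omega>) (step_path n (Z \<omega>))" for n
      using lip_env_Lipschitz[OF N F, of k "Z \<omega>" "step_path n (Z \<omega>)"] unfolding real_norm_def
      by (subst abs_minus_commute)
    then have "(\<lambda>n. lip_env N F k (step_path n (Z \<omega>)) - lip_env N F k (Z \<omega>)) \<longlonglongrightarrow> 0"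
      by (intro Lim_null_comparison[OF always_eventually lim] allI)
    then show "(\<lambda>n. lip_env N F k (step_path n (Z \<omega>))) \<longlonglongrightarrow> lip_env N F k (Z \<omega>)"
      by (simp add: LIM_zero_iff)
  qed
qed

text \<open>An open set \<open>U\<close> has a lower semicontinuous indicator, so a path lies in \<open>U\<close> exactly if some envelope of the indicator is
positive there. In this way measurability of the coordinates yields measurability for the Borel \<open>\<sigma>\<close>-algebra of the path
topology.\<close>

lemma random_path_measurable:
  assumes N: "N \<ge> 1"
    and Z: "\<forall>\<omega>\<in>space P. Z \<omega> \<in> path_space N"
    and meas: "\<forall>t\<ge>0. \<forall>i<N. (\<lambda>\<omega>. Z \<omega> t i) \<in> borel_measurable P"
  shows "Z \<in> measurable P (borel_sigma (path_topology N))"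
  unfolding borel_sigma_def topspace_path_topology
proof (rule measurable_measure_of)
  show "{U. openin (path_topology N) U} \<subseteq> Pow (path_space N)"
    using openin_subset topspace_path_topology by blast
  show "Z \<in> space P \<rightarrow> path_space N" using Z by auto
  fix U assume "U \<in> {U. openin (path_topology N) U}"
  then have U: "openin (path_topology N) U" by simp
  define F where "F = (indicator U :: _ \<Rightarrow> real)"
  have F: "\<forall>g\<in>path_space N. \<bar>F g\<bar> \<le> 1" by (simp add: F_def indicator_def)
  have "Z -` U \<inter> space P = (\<Union>k. {\<omega> \<in> space P. lip_env N F k (Z \<omega>) > 0})"
  proof (intro equalityI subsetI)
    fix \<omega> assume "\<omega> \<in> Z -` U \<inter> space P"
    then have \<omega>: "Z \<omega> \<in> U" "\<omega> \<in> space P" by auto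
    have "(\<lambda>k. lip_env N F k (Z \<omega>)) \<longlonglongrightarrow> F (Z \<omega>)"
    proof (rule lip_env_tendsto[OF N F bspec[OF Z \<omega>(2)]])
      fix \<eta> :: real assume "\<eta> > 0"
      obtain K \<epsilon> where "compact K" "K \<subseteq> {0..}" "0 < \<epsilon>"
        "\<forall>g\<in>path_space N. (\<forall>t\<in>K. \<forall>i<N. \<bar>g t i - Z \<omega> t i\<bar> < \<epsilon>) \<longrightarrow> g \<in> U"
        using U \<omega>(1) unfolding openin_path_topology by meson
      then show "\<exists>K \<epsilon>. compact K \<and> K \<subseteq> {0..} \<and> 0 < \<epsilon> \<and>
        (\<forall>g\<in>path_space N. (\<forall>t\<in>K. \<forall>i<N. \<bar>g t i - Z \<omega> t i\<bar> < \<epsilon>) \<longrightarrow> F (Z \<omega>) - \<eta> \<le> F g)"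
        using \<open>\<eta> > 0\<close> by (intro exI[of _ K] exI[of _ \<epsilon>]) (auto simp: F_def indicator_def)
    qed
    moreover have "F (Z \<omega>) > 0" using \<omega> by (simp add: F_def)
    ultimately have "eventually (\<lambda>k. lip_env N F k (Z \<omega>) > 0) sequentially" by (rule order_tendstoD)
    then show "\<omega> \<in> (\<Union>k. {\<omega> \<in> space P. lip_env N F k (Z \<omega>) > 0})"
      using \<omega>(2) by (auto dest: eventually_happens)
  next
    fix \<omega> assume "\<omega> \<in> (\<Union>k. {\<omega> \<in> space P. lip_env N F k (Z \<omega>) > 0})"
    then obtain k where \<omega>: "\<omega> \<in> space P" "lip_env N F k (Z \<omega>) > 0" by auto
    then have "F (Z \<omega>) > 0" using lip_env_le[OF N F bspec[OF Z \<omega>(1)], of k] by linarith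
    then show "\<omega> \<in> Z -` U \<inter> space P" using \<omega>(1) by (auto simp: F_def indicator_def split: if_splits)
  qed
  also have "\<dots> \<in> sets P"
    using lip_env_measurable(1)[OF N F Z meas] by (intro sets.countable_UN) auto
  finally show "Z -` U \<inter> space P \<in> sets P" .
qed

lemma continuous_path_functional_lsc:
  assumes F: "continuous_map (path_topology N) euclideanreal F" and f: "f \<in> path_space N" and \<eta>: "\<eta> > 0"
  shows "\<exists>K \<epsilon>. compact K \<and> K \<subseteq> {0..} \<and> 0 < \<epsilon> \<and>
        (\<forall>g\<in>path_space N. (\<forall>t\<in>K. \<forall>i<N. \<bar>g t i - f t i\<bar> < \<epsilon>) \<longrightarrow> F f - \<eta> \<le> F g)"
proof -
  have "openin (path_topology N) {g \<in> topspace (path_topology N). F g \<in> {F f - \<eta><..}}"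
    by (rule openin_continuous_map_preimage[OF F]) auto
  moreover have "f \<in> {g \<in> topspace (path_topology N). F g \<in> {F f - \<eta><..}}"
    using f \<eta> by (simp add: topspace_path_topology)
  ultimately obtain K \<epsilon> where "compact K" "K \<subseteq> {0..}" "0 < \<epsilon>"
        "\<forall>g\<in>path_space N. (\<forall>t\<in>K. \<forall>i<N. \<bar>g t i - f t i\<bar> < \<epsilon>) \<longrightarrow> g \<in> {g \<in> topspace (path_topology N). F g \<in> {F f - \<eta><..}}"
    unfolding openin_path_topology by blast
  then show ?thesis by (intro exI[of _ K] exI[of _ \<epsilon>]) auto
qed

text \<open>A criterion that replaces tightness and Prokhorov's theorem: the hypothesis \<open>fd\<close> is convergence of finite-dimensional
distributions, and \<open>tightZ\<close>, \<open>tightW\<close> say that discretising in time costs little, uniformly in \<open>M\<close>.\<close>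

lemma converges_in_distribution_pathI:
  fixes P :: "nat \<Rightarrow> 'a measure" and Q :: "'b measure"
  assumes N: "N \<ge> 1"
    and P: "\<And>M. M \<ge> M0 \<Longrightarrow> prob_space (P M)" and Q: "prob_space Q"
    and Z: "\<And>M. M \<ge> M0 \<Longrightarrow> \<forall>\<omega>\<in>space (P M). Z M \<omega> \<in> path_space N"
    and W: "\<forall>\<omega>\<in>space Q. W \<omega> \<in> path_space N"
    and Zm: "\<And>M. M \<ge> M0 \<Longrightarrow> \<forall>t\<ge>0. \<forall>i<N. (\<lambda>\<omega>. Z M \<omega> t i) \<in> borel_measurable (P M)"
    and Wm: "\<forall>t\<ge>0. \<forall>i<N. (\<lambda>\<omega>. W \<omega> t i) \<in> borel_measurable Q"
    and fd: "\<And>F B k n. \<forall>g\<in>path_space N. \<bar>F g\<bar> \<le> B \<Longrightarrow>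
        (\<lambda>M. \<integral>\<omega>. lip_env N F k (step_path n (Z M \<omega>)) \<partial>P M) \<longlonglongrightarrow> (\<integral>\<omega>. lip_env N F k (step_path n (W \<omega>)) \<partial>Q)"
    and r: "\<And>k. r k \<longlonglongrightarrow> 0"
    and tightZ: "\<And>F B k n M. \<forall>g\<in>path_space N. \<bar>F g\<bar> \<le> B \<Longrightarrow> M \<ge> M0 \<Longrightarrow>
        \<bar>(\<integral>\<omega>. lip_env N F k (Z M \<omega>) \<partial>P M) - (\<integral>\<omega>. lip_env N F k (step_path n (Z M \<omega>)) \<partial>P M)\<bar> \<le> r k n"
    and tightW: "\<And>F B k n. \<forall>g\<in>path_space N. \<bar>F g\<bar> \<le> B \<Longrightarrow>
        \<bar>(\<integral>\<omega>. lip_env N F k (W \<omega>) \<partial>Q) - (\<integral>\<omega>. lip_env N F k (step_path n (W \<omega>)) \<partial>Q)\<bar> \<le> r k n"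
  shows "converges_in_distribution (path_topology N) P Z Q W"
proof -
  interpret Q: prob_space Q by fact
  have reZ: "random_element (P M) (path_topology N) (Z M)" if "M \<ge> M0" for M
    unfolding random_element_def using P[OF that] random_path_measurable[OF N Z[OF that] Zm[OF that]] by blast
  have reW: "random_element Q (path_topology N) W"
    unfolding random_element_def using Q random_path_measurable[OF N W Wm] by blast
  have env_lim: "(\<lambda>M. \<integral>\<omega>. lip_env N F k (Z M \<omega>) \<partial>P M) \<longlonglongrightarrow> (\<integral>\<omega>. lip_env N F k (W \<omega>) \<partial>Q)"
    if F: "\<forall>g\<in>path_space N. \<bar>F g\<bar> \<le> B" for F B k
  proof (rule LIMSEQ_I)
    fix e :: real assume e: "e > 0"
    obtain n where n: "r k n < e / 4" using order_tendstoD(2)[OF r[of k], of "e / 4"] e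
      by (auto dest: eventually_happens)
    obtain M1 where M1: "\<And>M. M \<ge> M1 \<Longrightarrow> norm ((\<integral>\<omega>. lip_env N F k (step_path n (Z M \<omega>)) \<partial>P M) - (\<integral>\<omega>. lip_env N F k (step_path n (W \<omega>)) \<partial>Q)) < e / 4"
      using LIMSEQ_D[OF fd[OF F, of k n], of "e / 4"] e by auto
    show "\<exists>no. \<forall>M\<ge>no. norm ((\<integral>\<omega>. lip_env N F k (Z M \<omega>) \<partial>P M) - (\<integral>\<omega>. lip_env N F k (W \<omega>) \<partial>Q)) < e"
    proof (intro exI allI impI)
      fix M assume M: "M \<ge> max M0 M1"
      have triangle: "\<bar>a - b\<bar> < e" if "\<bar>a - a'\<bar> \<le> r k n" "\<bar>b - b'\<bar> \<le> r k n" "\<bar>a' - b'\<bar> < e / 4" for a a' b b'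
        using that n by linarith
      show "norm ((\<integral>\<omega>. lip_env N F k (Z M \<omega>) \<partial>P M) - (\<integral>\<omega>. lip_env N F k (W \<omega>) \<partial>Q)) < e"
        unfolding real_norm_def
        by (rule triangle[OF tightZ[OF F] tightW[OF F]]) (use M M1[of M] in auto)
    qed
  qed
  have lower: "eventually (\<lambda>M. (\<integral>\<omega>. F (W \<omega>) \<partial>Q) - e < (\<integral>\<omega>. F (Z M \<omega>) \<partial>P M)) sequentially"
    if F: "continuous_map (path_topology N) euclideanreal F" and B: "\<forall>g\<in>path_space N. \<bar>F g\<bar> \<le> B" and e: "e > 0"
    for F B and e :: real
  proof -
    have Fm: "F \<in> borel_measurable (borel_sigma (path_topology N))"
    proof (rule borel_measurableI)
      fix S :: "real set" assume "open S"
      then have "openin (path_topology N) {g \<in> topspace (path_topology N). F g \<in> S}"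
        by (intro openin_continuous_map_preimage[OF F]) auto
      then have U: "openin (path_topology N) (F -` S \<inter> topspace (path_topology N))"
        by (rule back_subst[of "openin _"]) auto
      have sub: "{U. openin (path_topology N) U} \<subseteq> Pow (topspace (path_topology N))"
        by (auto dest: openin_subset)
      show "F -` S \<inter> space (borel_sigma (path_topology N)) \<in> sets (borel_sigma (path_topology N))"
        unfolding borel_sigma_def using U sub
        by (simp add: space_measure_of[OF sub] sets_measure_of[OF sub] sigma_sets.Basic)
    qed
    have FW: "(\<lambda>\<omega>. F (W \<omega>)) \<in> borel_measurable Q"
      using reW Fm by (auto simp: random_element_def intro: measurable_compose)
    have FZ: "(\<lambda>\<omega>. F (Z M \<omega>)) \<in> borel_measurable (P M)" if "M \<ge> M0" for M
      using reZ[OF that] Fm by (auto simp: random_element_def intro: measurable_compose)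
    have "(\<lambda>k. \<integral>\<omega>. lip_env N F k (W \<omega>) \<partial>Q) \<longlonglongrightarrow> (\<integral>\<omega>. F (W \<omega>) \<partial>Q)"
    proof (rule integral_dominated_convergence[where w = "\<lambda>_. B"])
      show "AE \<omega> in Q. (\<lambda>k. lip_env N F k (W \<omega>)) \<longlonglongrightarrow> F (W \<omega>)"
        using lip_env_tendsto[OF N B _ continuous_path_functional_lsc[OF F]] W by auto
      show "AE \<omega> in Q. norm (lip_env N F k (W \<omega>)) \<le> B" for k
      proof (rule AE_I2)
        fix \<omega> assume \<omega>: "\<omega> \<in> space Q"
        have "\<bar>lip_env N F 0 (W \<omega>)\<bar> \<le> B" using lip_env_abs[OF N B, of 0 "W \<omega>"] by simp
        then show "norm (lip_env N F k (W \<omega>)) \<le> B"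
          using lip_env_mono[OF N B, of 0 k "W \<omega>"] lip_env_le[OF N B bspec[OF W \<omega>], of k] bspec[OF B bspec[OF W \<omega>]] by auto
      qed
    qed (use FW lip_env_measurable(1)[OF N B W Wm] in auto)
    from order_tendstoD(1)[OF this, of "(\<integral>\<omega>. F (W \<omega>) \<partial>Q) - e / 2"] e
    obtain k where k: "(\<integral>\<omega>. F (W \<omega>) \<partial>Q) - e / 2 < (\<integral>\<omega>. lip_env N F k (W \<omega>) \<partial>Q)"
      by (auto dest: eventually_happens)
    have "eventually (\<lambda>M. (\<integral>\<omega>. lip_env N F k (W \<omega>) \<partial>Q) - e / 2 < (\<integral>\<omega>. lip_env N F k (Z M \<omega>) \<partial>P M)) sequentially"
      using e by (intro order_tendstoD(1)[OF env_lim[OF B]]) auto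
    then show ?thesis
      using eventually_ge_at_top[of M0]
    proof eventually_elim
      case (elim M)
      interpret P: prob_space "P M" using P elim by auto
      have "(\<integral>\<omega>. lip_env N F k (Z M \<omega>) \<partial>P M) \<le> (\<integral>\<omega>. F (Z M \<omega>) \<partial>P M)"
      proof (rule integral_mono)
        show "integrable (P M) (\<lambda>\<omega>. lip_env N F k (Z M \<omega>))"
          by (rule P.integrable_const_bound[where B = "B + real k"])
            (use elim lip_env_abs[OF N B] lip_env_measurable(1)[OF N B Z Zm] in auto)
        show "integrable (P M) (\<lambda>\<omega>. F (Z M \<omega>))"
          by (rule P.integrable_const_bound[where B = "B"]) (use elim B Z FZ in auto)
        show "lip_env N F k (Z M \<omega>) \<le> F (Z M \<omega>)" if "\<omega> \<in> space (P M)" for \<omega>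
          using lip_env_le[OF N B] Z[of M] elim that by auto
      qed
      then show ?case using elim k by linarith
    qed
  qed
  have "(\<lambda>M. \<integral>\<omega>. F (Z M \<omega>) \<partial>P M) \<longlonglongrightarrow> (\<integral>\<omega>. F (W \<omega>) \<partial>Q)"
    if F: "continuous_map (path_topology N) euclideanreal F" and bdd: "bounded (F ` topspace (path_topology N))" for F
  proof -
    obtain B where B: "\<forall>g\<in>path_space N. \<bar>F g\<bar> \<le> B"
      using bdd unfolding bounded_real topspace_path_topology by auto
    have F': "continuous_map (path_topology N) euclideanreal (\<lambda>g. - F g)"
      using F by (rule continuous_map_minus)
    have B': "\<forall>g\<in>path_space N. \<bar>- F g\<bar> \<le> B" using B by simp
    show ?thesis
    proof (rule tendstoI)
      fix e :: real assume e: "e > 0"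
      show "eventually (\<lambda>M. dist (\<integral>\<omega>. F (Z M \<omega>) \<partial>P M) (\<integral>\<omega>. F (W \<omega>) \<partial>Q) < e) sequentially"
        using lower[OF F B e] lower[OF F' B' e]
        by eventually_elim (simp add: dist_real_def abs_less_iff)
    qed
  qed
  then show ?thesis
    unfolding converges_in_distribution_def using reZ reW by (auto simp: eventually_sequentially)
qed

section \<open>Weak convergence from expectations of cosines\<close>

text \<open>Polynomials in \<open>sin (a x\<^sub>i)\<close> rather than general trigonometric polynomials: with \<open>a = \<pi> / (2L)\<close> such a function takes all its
values already on the cube \<open>[-L,L]\<^sup>I\<close>, so that an approximation on the cube is automatically bounded everywhere.\<close>

inductive_set sin_polynomials :: "real \<Rightarrow> 'i set \<Rightarrow> (('i \<Rightarrow> real) \<Rightarrow> real) set" for a I where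
  const: "(\<lambda>_. c) \<in> sin_polynomials a I"
| sin: "i \<in> I \<Longrightarrow> (\<lambda>x. sin (a * x i)) \<in> sin_polynomials a I"
| add: "f \<in> sin_polynomials a I \<Longrightarrow> g \<in> sin_polynomials a I \<Longrightarrow> (\<lambda>x. f x + g x) \<in> sin_polynomials a I"
| mult: "f \<in> sin_polynomials a I \<Longrightarrow> g \<in> sin_polynomials a I \<Longrightarrow> (\<lambda>x. f x * g x) \<in> sin_polynomials a I"

inductive_set cosine_sums :: "'i set \<Rightarrow> (('i \<Rightarrow> real) \<Rightarrow> real) set" for I where
  cos: "(\<lambda>x. c * cos ((\<Sum>i\<in>I. w i * x i) + \<theta>)) \<in> cosine_sums I"
| add: "f \<in> cosine_sums I \<Longrightarrow> g \<in> cosine_sums I \<Longrightarrow> (\<lambda>x. f x + g x) \<in> cosine_sums I"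

text \<open>By \<open>2 cos A cos B = cos (A - B) + cos (A + B)\<close>. This linearisation turns the algebra needed for the Stone-Weierstrass theorem
into functions whose expectations are characteristic functions.\<close>

lemma cosine_sums_mult:
  assumes "f \<in> cosine_sums I" "g \<in> cosine_sums I"
  shows "(\<lambda>x. f x * g x) \<in> cosine_sums I"
  using assms
proof induction
  case (cos c w \<theta>)
  from cos show ?case
  proof induction
    case (cos c' w' \<theta>')
    have "(\<lambda>x. c * cos ((\<Sum>i\<in>I. w i * x i) + \<theta>) * (c' * cos ((\<Sum>i\<in>I. w' i * x i) + \<theta>')))
      = (\<lambda>x. (c * c' / 2) * cos ((\<Sum>i\<in>I. (w i - w' i) * x i) + (\<theta> - \<theta>'))
           + (c * c' / 2) * cos ((\<Sum>i\<in>I. (w i + w' i) * x i) + (\<theta> + \<theta>')))"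
    proof
      fix x
      define A where "A = (\<Sum>i\<in>I. w i * x i) + \<theta>"
      define A' where "A' = (\<Sum>i\<in>I. w' i * x i) + \<theta>'"
      have eqs: "(\<Sum>i\<in>I. (w i - w' i) * x i) + (\<theta> - \<theta>') = A - A'" "(\<Sum>i\<in>I. (w i + w' i) * x i) + (\<theta> + \<theta>') = A + A'"
        by (simp_all add: A_def A'_def algebra_simps sum.distrib sum_subtractf)
      show "c * cos ((\<Sum>i\<in>I. w i * x i) + \<theta>) * (c' * cos ((\<Sum>i\<in>I. w' i * x i) + \<theta>'))
        = (c * c' / 2) * cos ((\<Sum>i\<in>I. (w i - w' i) * x i) + (\<theta> - \<theta>'))
           + (c * c' / 2) * cos ((\<Sum>i\<in>I. (w i + w' i) * x i) + (\<theta> + \<theta>'))"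
        unfolding eqs unfolding A_def[symmetric] A'_def[symmetric] using cos_times_cos[of A A'] by (simp add: field_simps)
    qed
    then show ?case by (simp only:) (intro cosine_sums.intros)
  next
    case (add f g)
    then show ?case by (simp add: distrib_left cosine_sums.add)
  qed
next
  case (add f1 f2)
  then show ?case by (simp add: distrib_right cosine_sums.add)
qed

lemma sin_polynomials_cosine_sums:
  assumes "finite I" "f \<in> sin_polynomials a I"
  shows "f \<in> cosine_sums I"
  using assms(2)
proof induction
  case (const c)
  show ?case using cosine_sums.cos[of c "\<lambda>_. 0" I 0] by simp
next
  case (sin i)
  have "(\<Sum>j\<in>I. (if j = i then a else 0) * x j) = a * x i" for x :: "_ \<Rightarrow> real"
    using assms(1) sin by (simp add: if_distrib[of "\<lambda>c. c * _"] cong: if_cong)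
  then have "(\<lambda>x. sin (a * x i)) = (\<lambda>x. 1 * cos ((\<Sum>j\<in>I. (if j = i then a else 0) * x j) + (- (pi / 2))))"
    by (simp add: cos_diff)
  then show ?case by (simp only:) (rule cosine_sums.cos)
qed (auto intro: cosine_sums.add cosine_sums_mult)

lemma sin_polynomials_continuous:
  "f \<in> sin_polynomials a I \<Longrightarrow> continuous_on S (f :: ('i::countable \<Rightarrow> real) \<Rightarrow> real)"
proof (induction rule: sin_polynomials.induct)
  case (sin i)
  have "continuous_on S (\<lambda>x. x i)"
    using continuous_on_product_coordinates[of i, where 'b = real] by (rule continuous_on_subset) simp
  then show ?case by (intro continuous_intros)
qed (auto intro!: continuous_intros)

lemma sin_polynomials_cong:
  assumes "f \<in> sin_polynomials a I" "\<And>i. i \<in> I \<Longrightarrow> sin (a * x i) = sin (a * y i)"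
  shows "f x = f y"
  using assms(1) by induction (auto simp: assms(2))

text \<open>Stone-Weierstrass on the cube, where the functions \<open>sin (a x\<^sub>i)\<close> separate points because \<open>sin\<close> is injective on
\<open>[-\<pi>/2, \<pi>/2]\<close>. The bound outside of the cube comes from folding: \<open>x\<^sub>i \<mapsto> arcsin (sin (a x\<^sub>i)) / a\<close> maps into the cube and does not
change the approximating function.\<close>

lemma approx_by_sin_polynomial:
  fixes \<psi> :: "('i::countable \<Rightarrow> real) \<Rightarrow> real"
  assumes I: "finite I" and \<psi>: "continuous_on UNIV \<psi>" and B: "\<And>v. \<bar>\<psi> v\<bar> \<le> B"
    and dep: "\<And>v w. (\<And>i. i \<in> I \<Longrightarrow> v i = w i) \<Longrightarrow> \<psi> v = \<psi> w"
    and L: "L > 0" and e: "e > 0"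
  obtains q where "q \<in> sin_polynomials (pi / (2 * L)) I" "\<And>v. \<bar>q v\<bar> \<le> B + e"
    "\<And>v. (\<And>i. i \<in> I \<Longrightarrow> \<bar>v i\<bar> \<le> L) \<Longrightarrow> \<bar>\<psi> v - q v\<bar> \<le> e"
proof -
  define a where "a = pi / (2 * L)"
  have a: "a > 0" "a * L = pi / 2" using L by (simp_all add: a_def)
  define S where "S = {v :: 'i \<Rightarrow> real. \<forall>i. v i \<in> (if i \<in> I then {-L..L} else {0})}"
  have "compactin (product_topology (\<lambda>i. euclidean) UNIV) (PiE UNIV (\<lambda>i. if i \<in> I then {-L..L} else {0::real}))"
    unfolding compactin_PiE by (simp add: compact_Icc)
  moreover have "PiE UNIV (\<lambda>i. if i \<in> I then {-L..L} else {0::real}) = S" by (auto simp: S_def PiE_def Pi_def)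
  ultimately have S: "compact S" by (simp add: euclidean_product_topology)
  have sin_inj: "s = t" if "\<bar>s\<bar> \<le> L" "\<bar>t\<bar> \<le> L" "sin (a * s) = sin (a * t)" for s t
  proof -
    have "\<bar>a * r\<bar> \<le> pi / 2" if "\<bar>r\<bar> \<le> L" for r
      using mult_left_mono[OF that, of a] a by (simp add: abs_mult)
    from this[OF that(1)] this[OF that(2)]
    have "- (pi / 2) \<le> a * s" "a * s \<le> pi / 2" "- (pi / 2) \<le> a * t" "a * t \<le> pi / 2" by linarith+
    then have "a * s = a * t" using that(3) by (rule sin_inj_pi)
    then show ?thesis using a by simp
  qed
  interpret function_ring_on "sin_polynomials a I" S
  proof
    show "\<exists>f\<in>sin_polynomials a I. f x \<noteq> f y" if xy: "x \<in> S" "y \<in> S" "x \<noteq> y" for x y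
    proof -
      obtain i where i: "x i \<noteq> y i" using xy(3) by auto
      have b: "x i \<in> (if i \<in> I then {-L..L} else {0})" "y i \<in> (if i \<in> I then {-L..L} else {0})"
        using xy(1,2) unfolding S_def by blast+
      then have iI: "i \<in> I" using i by (auto split: if_splits)
      then have "sin (a * x i) \<noteq> sin (a * y i)"
        using sin_inj[of "x i" "y i"] i b iI unfolding abs_le_iff by (metis atLeastAtMost_iff minus_le_iff)
      then show ?thesis by (intro bexI[of _ "\<lambda>x. sin (a * x i)"] sin_polynomials.sin[OF iI])
    qed
  qed (fact S, rule sin_polynomials_continuous, assumption,
      rule sin_polynomials.add, assumption+, rule sin_polynomials.mult, assumption+, rule sin_polynomials.const)
  obtain q where q: "q \<in> sin_polynomials a I" "\<And>v. v \<in> S \<Longrightarrow> \<bar>\<psi> v - q v\<bar> < e"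
    using Stone_Weierstrass_basic[of \<psi> e] \<psi> e continuous_on_subset by blast
  show thesis
  proof (rule that)
    show "q \<in> sin_polynomials (pi / (2 * L)) I" using q(1) by (simp add: a_def)
    show "\<bar>q v\<bar> \<le> B + e" for v
    proof -
      define u where "u i = (if i \<in> I then arcsin (sin (a * v i)) / a else 0)" for i
      have "\<bar>arcsin (sin (a * v i))\<bar> \<le> a * L" for i
        unfolding a(2) using arcsin_lbound[of "sin (a * v i)"] arcsin_ubound[of "sin (a * v i)"] by (simp add: abs_le_iff)
      then have "\<bar>arcsin (sin (a * v i)) / a\<bar> \<le> L" for i using a by (simp add: field_simps)
      then have "arcsin (sin (a * v i)) / a \<in> {-L..L}" for i unfolding abs_le_iff atLeastAtMost_iff
        by (metis minus_le_iff)
      then have "u \<in> S" by (simp add: S_def u_def)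
      then have "\<bar>\<psi> u - q u\<bar> < e" by (rule q(2))
      moreover have "q v = q u"
        using q(1) by (rule sin_polynomials_cong) (use a in \<open>simp add: u_def\<close>)
      ultimately show ?thesis using B[of u] by linarith
    qed
    show "\<bar>\<psi> v - q v\<bar> \<le> e" if "\<And>i. i \<in> I \<Longrightarrow> \<bar>v i\<bar> \<le> L" for v
    proof -
      define u where "u i = (if i \<in> I then v i else 0)" for i
      have "v i \<in> {-L..L}" if "i \<in> I" for i
        using \<open>\<And>i. i \<in> I \<Longrightarrow> \<bar>v i\<bar> \<le> L\<close>[OF that] unfolding abs_le_iff atLeastAtMost_iff by (metis minus_le_iff)
      then have "u \<in> S" by (simp add: S_def u_def)
      moreover have "\<psi> v = \<psi> u" by (rule dep) (simp add: u_def)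
      moreover have "q v = q u" using q(1) by (rule sin_polynomials_cong) (simp add: u_def)
      ultimately show ?thesis using q(2)[of u] by simp
    qed
  qed
qed

lemma cosine_sums_integrable:
  assumes "prob_space P" "f \<in> cosine_sums I" "\<And>i. (\<lambda>\<omega>. V \<omega> i) \<in> borel_measurable P"
  shows "integrable P (\<lambda>\<omega>. f (V \<omega>))"
  using assms(2)
proof induction
  case (cos c w \<theta>)
  interpret prob_space P by fact
  have "\<bar>c * cos y\<bar> \<le> \<bar>c\<bar>" for y using abs_cos_le_one[of y] by (simp add: abs_mult mult_left_le)
  then show ?case
    by (intro integrable_const_bound[of _ "\<bar>c\<bar>"]) (use assms(3) in auto)
qed auto

text \<open>A truncation argument carried out pointwise: outside of the cube \<open>\<Sum>\<^sub>i v\<^sub>i\<^sup>2 / L\<^sup>2\<close> is at least \<open>1\<close>, so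
\<open>\<bar>\<psi> - q\<bar> \<le> e + B \<Sum>\<^sub>i v\<^sub>i\<^sup>2 / L\<^sup>2\<close> everywhere.\<close>

lemma expectation_sin_polynomial_error:
  fixes \<psi> q :: "('i \<Rightarrow> real) \<Rightarrow> real"
  assumes P: "prob_space P" and I: "finite I" and L: "L > 0" and B: "B \<ge> 0"
    and near: "\<And>v. (\<And>i. i \<in> I \<Longrightarrow> \<bar>v i\<bar> \<le> L) \<Longrightarrow> \<bar>\<psi> v - q v\<bar> \<le> e" and far: "\<And>v. \<bar>\<psi> v - q v\<bar> \<le> B"
    and e: "e \<ge> 0"
    and int: "integrable P (\<lambda>\<omega>. \<psi> (V \<omega>))" "integrable P (\<lambda>\<omega>. q (V \<omega>))"
    and int2: "\<And>i. i \<in> I \<Longrightarrow> integrable P (\<lambda>\<omega>. (V \<omega> i)\<^sup>2)"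
    and K: "\<And>i. i \<in> I \<Longrightarrow> (\<integral>\<omega>. (V \<omega> i)\<^sup>2 \<partial>P) \<le> K"
  shows "\<bar>(\<integral>\<omega>. \<psi> (V \<omega>) \<partial>P) - (\<integral>\<omega>. q (V \<omega>) \<partial>P)\<bar> \<le> e + B * (real (card I) * K) / L\<^sup>2"
proof -
  interpret prob_space P by fact
  have pw: "\<bar>\<psi> v - q v\<bar> \<le> e + B / L\<^sup>2 * (\<Sum>i\<in>I. (v i)\<^sup>2)" for v
  proof (cases "\<forall>i\<in>I. \<bar>v i\<bar> \<le> L")
    case True
    have "0 \<le> B / L\<^sup>2 * (\<Sum>i\<in>I. (v i)\<^sup>2)"
      using B by (intro mult_nonneg_nonneg sum_nonneg divide_nonneg_nonneg) auto
    moreover have "\<bar>\<psi> v - q v\<bar> \<le> e" using near True by blast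
    ultimately show ?thesis by linarith
  next
    case False
    then obtain i where i: "i \<in> I" "L < \<bar>v i\<bar>" by auto
    have "L\<^sup>2 \<le> \<bar>v i\<bar>\<^sup>2" using i L by (intro power_mono) auto
    also have "\<dots> \<le> (\<Sum>i\<in>I. (v i)\<^sup>2)" using i I member_le_sum[of i I "\<lambda>i. (v i)\<^sup>2"] by simp
    finally have "B / L\<^sup>2 * L\<^sup>2 \<le> B / L\<^sup>2 * (\<Sum>i\<in>I. (v i)\<^sup>2)" using B by (intro mult_left_mono) auto
    then show ?thesis using far[of v] e L by simp
  qed
  have "\<bar>(\<integral>\<omega>. \<psi> (V \<omega>) \<partial>P) - (\<integral>\<omega>. q (V \<omega>) \<partial>P)\<bar> = \<bar>\<integral>\<omega>. \<psi> (V \<omega>) - q (V \<omega>) \<partial>P\<bar>"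
    using int by simp
  also have "\<dots> \<le> (\<integral>\<omega>. \<bar>\<psi> (V \<omega>) - q (V \<omega>)\<bar> \<partial>P)" by (rule integral_abs_bound)
  also have "\<dots> \<le> (\<integral>\<omega>. e + B / L\<^sup>2 * (\<Sum>i\<in>I. (V \<omega> i)\<^sup>2) \<partial>P)"
    using int int2 pw by (intro integral_mono) auto
  also have "\<dots> = e + B / L\<^sup>2 * (\<Sum>i\<in>I. \<integral>\<omega>. (V \<omega> i)\<^sup>2 \<partial>P)"
    using int2 by (simp add: prob_space)
  also have "\<dots> \<le> e + B / L\<^sup>2 * (\<Sum>i\<in>I. K)"
    using B K by (intro add_left_mono mult_left_mono sum_mono) auto
  finally show ?thesis by simp
qed

text \<open>A multivariate version of Levy's continuity theorem. The bound \<open>K\<close> on the second moments gives tightness.\<close>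

theorem convergence_from_cosines:
  fixes V :: "nat \<Rightarrow> 'a \<Rightarrow> ('i::countable \<Rightarrow> real)" and W :: "'b \<Rightarrow> ('i \<Rightarrow> real)"
    and \<psi> :: "('i \<Rightarrow> real) \<Rightarrow> real"
  assumes I: "finite I" and \<psi>: "continuous_on UNIV \<psi>" and B: "\<And>v. \<bar>\<psi> v\<bar> \<le> B"
    and dep: "\<And>v w. (\<And>i. i \<in> I \<Longrightarrow> v i = w i) \<Longrightarrow> \<psi> v = \<psi> w"
    and P: "\<And>M. M \<ge> M0 \<Longrightarrow> prob_space (P M)" and Q: "prob_space Q"
    and V: "\<And>M i. M \<ge> M0 \<Longrightarrow> (\<lambda>\<omega>. V M \<omega> i) \<in> borel_measurable (P M)"
    and W: "\<And>i. (\<lambda>\<omega>. W \<omega> i) \<in> borel_measurable Q"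
    and V2: "\<And>M i. M \<ge> M0 \<Longrightarrow> i \<in> I \<Longrightarrow> integrable (P M) (\<lambda>\<omega>. (V M \<omega> i)\<^sup>2) \<and> (\<integral>\<omega>. (V M \<omega> i)\<^sup>2 \<partial>P M) \<le> K"
    and W2: "\<And>i. i \<in> I \<Longrightarrow> integrable Q (\<lambda>\<omega>. (W \<omega> i)\<^sup>2) \<and> (\<integral>\<omega>. (W \<omega> i)\<^sup>2 \<partial>Q) \<le> K"
    and cos: "\<And>w \<theta>. (\<lambda>M. \<integral>\<omega>. cos ((\<Sum>i\<in>I. w i * V M \<omega> i) + \<theta>) \<partial>P M) \<longlonglongrightarrow> (\<integral>\<omega>. cos ((\<Sum>i\<in>I. w i * W \<omega> i) + \<theta>) \<partial>Q)"
  shows "(\<lambda>M. \<integral>\<omega>. \<psi> (V M \<omega>) \<partial>P M) \<longlonglongrightarrow> (\<integral>\<omega>. \<psi> (W \<omega>) \<partial>Q)"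
proof (rule LIMSEQ_I)
  fix r :: real assume r: "r > 0"
  define e where "e = min 1 (r / 8)"
  have e: "e > 0" "e \<le> 1" "e \<le> r / 8" using r by (auto simp: e_def)
  have B0: "B \<ge> 0" using order_trans[OF abs_ge_zero B] .
  define C where "C = (2 * B + 1) * (real (card I) * max K 0)"
  have C0: "C \<ge> 0" using B0 by (auto simp: C_def)
  \<comment> \<open>\<open>C\<close> is the constant in the truncation error \<open>C / L\<^sup>2\<close>; \<open>L\<close> makes that error at most \<open>e\<close>, and is positive even if \<open>C = 0\<close>.\<close>
  define L where "L = sqrt (C / e) + 1"
  have "L \<ge> sqrt (C / e)" by (simp add: L_def)
  moreover have L: "L > 0" using C0 e by (simp add: L_def add_nonneg_pos)
  ultimately have "C / e \<le> L\<^sup>2" using C0 e real_le_lsqrt sqrt_le_D by blast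
  then have CL: "C / L\<^sup>2 \<le> e" using e L by (simp add: field_simps)
  obtain q where q: "q \<in> sin_polynomials (pi / (2 * L)) I" "\<And>v. \<bar>q v\<bar> \<le> B + e"
    "\<And>v. (\<And>i. i \<in> I \<Longrightarrow> \<bar>v i\<bar> \<le> L) \<Longrightarrow> \<bar>\<psi> v - q v\<bar> \<le> e"
    using approx_by_sin_polynomial[OF I \<psi> B dep L e(1)] by blast
  have qc: "q \<in> cosine_sums I" by (rule sin_polynomials_cosine_sums[OF I q(1)])
  have \<psi>m: "\<psi> \<in> borel_measurable borel" using \<psi> by (rule borel_measurable_continuous_onI)
  have err: "\<bar>(\<integral>\<omega>. \<psi> (X \<omega>) \<partial>R) - (\<integral>\<omega>. q (X \<omega>) \<partial>R)\<bar> \<le> 2 * e"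
    if R: "prob_space R" and X: "\<And>i. (\<lambda>\<omega>. X \<omega> i) \<in> borel_measurable R"
     and X2: "\<And>i. i \<in> I \<Longrightarrow> integrable R (\<lambda>\<omega>. (X \<omega> i)\<^sup>2) \<and> (\<integral>\<omega>. (X \<omega> i)\<^sup>2 \<partial>R) \<le> K" for R :: "'c measure" and X
  proof -
    interpret R: prob_space R by fact
    have Xm: "X \<in> borel_measurable R" using X by (intro measurable_coordinatewise_then_product)
    have "\<bar>(\<integral>\<omega>. \<psi> (X \<omega>) \<partial>R) - (\<integral>\<omega>. q (X \<omega>) \<partial>R)\<bar> \<le> e + (2 * B + 1) * (real (card I) * max K 0) / L\<^sup>2"
    proof (rule expectation_sin_polynomial_error[OF R I L _ q(3)])
      show "\<bar>\<psi> v - q v\<bar> \<le> 2 * B + 1" for v using B[of v] q(2)[of v] e by linarith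
      show "integrable R (\<lambda>\<omega>. \<psi> (X \<omega>))"
        using B measurable_compose[OF Xm \<psi>m] by (intro R.integrable_const_bound[of _ B]) auto
      show "integrable R (\<lambda>\<omega>. q (X \<omega>))" by (rule cosine_sums_integrable[OF R qc X])
    qed (use X2 e B0 in \<open>auto simp: le_max_iff_disj\<close>)
    then show ?thesis using CL by (simp add: C_def)
  qed
  have "(\<lambda>M. \<integral>\<omega>. q (V M \<omega>) \<partial>P M) \<longlonglongrightarrow> (\<integral>\<omega>. q (W \<omega>) \<partial>Q)"
    using qc
  proof induction
    case (cos c w \<theta>)
    show ?case using tendsto_mult_left[OF assms(11), of c w \<theta>] by simp
  next
    case (add f g)
    have "(\<lambda>M. (\<integral>\<omega>. f (V M \<omega>) \<partial>P M) + (\<integral>\<omega>. g (V M \<omega>) \<partial>P M)) \<longlonglongrightarrow> (\<integral>\<omega>. f (W \<omega>) \<partial>Q) + (\<integral>\<omega>. g (W \<omega>) \<partial>Q)"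
      using add by (intro tendsto_add)
    also have "(\<integral>\<omega>. f (W \<omega>) \<partial>Q) + (\<integral>\<omega>. g (W \<omega>) \<partial>Q) = (\<integral>\<omega>. f (W \<omega>) + g (W \<omega>) \<partial>Q)"
      using add(1,2) by (intro Bochner_Integration.integral_add[symmetric] cosine_sums_integrable[OF Q] W)
    finally show ?case
    proof (rule Lim_transform_eventually)
      show "\<forall>\<^sub>F M in sequentially. (\<integral>\<omega>. f (V M \<omega>) \<partial>P M) + (\<integral>\<omega>. g (V M \<omega>) \<partial>P M) = (\<integral>\<omega>. f (V M \<omega>) + g (V M \<omega>) \<partial>P M)"
        using eventually_ge_at_top[of M0]
        by eventually_elim (use add(1,2) in \<open>intro Bochner_Integration.integral_add[symmetric] cosine_sums_integrable P V\<close>)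
    qed
  qed
  from LIMSEQ_D[OF this, of "r / 4"] r obtain M1 where
    M1: "\<And>M. M \<ge> M1 \<Longrightarrow> norm ((\<integral>\<omega>. q (V M \<omega>) \<partial>P M) - (\<integral>\<omega>. q (W \<omega>) \<partial>Q)) < r / 4" by auto
  show "\<exists>no. \<forall>M\<ge>no. norm ((\<integral>\<omega>. \<psi> (V M \<omega>) \<partial>P M) - (\<integral>\<omega>. \<psi> (W \<omega>) \<partial>Q)) < r"
  proof (intro exI allI impI)
    fix M assume M: "M \<ge> max M0 M1"
    have "\<bar>a - b\<bar> < r" if "\<bar>a - a'\<bar> \<le> 2 * e" "\<bar>b - b'\<bar> \<le> 2 * e" "\<bar>a' - b'\<bar> < r / 4" for a a' b b'
      using that e r by linarith
    note triangle = this
    show "norm ((\<integral>\<omega>. \<psi> (V M \<omega>) \<partial>P M) - (\<integral>\<omega>. \<psi> (W \<omega>) \<partial>Q)) < r"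
      unfolding real_norm_def
      by (rule triangle[OF err err]) (use M M1[of M] P Q V W V2 W2 in auto)
  qed
qed

section \<open>Independence, Gaussian moments and the central limit theorem\<close>

lemma (in prob_space) indep_vars_reindex:
  assumes X: "indep_vars M' X I" and h: "inj_on h J" "h ` J \<subseteq> I"
  shows "indep_vars (\<lambda>j. M' (h j)) (\<lambda>j. X (h j)) J"
  unfolding indep_vars_def2
proof (intro conjI ballI indep_setsI)
  have rv: "X i \<in> measurable M (M' i)" if "i \<in> I" for i using X that by (auto simp: indep_vars_def2)
  show rvh: "X (h j) \<in> measurable M (M' (h j))" if "j \<in> J" for j using rv h that by blast
  show "{X (h j) -` A \<inter> space M |A. A \<in> sets (M' (h j))} \<subseteq> events" if "j \<in> J" for j
    using measurable_sets[OF rvh[OF that]] by auto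
  fix A K assume K: "K \<noteq> {}" "K \<subseteq> J" "finite K" and A: "\<forall>j\<in>K. A j \<in> {X (h j) -` A \<inter> space M |A. A \<in> sets (M' (h j))}"
  then have "\<forall>j\<in>K. \<exists>E. A j = X (h j) -` E \<inter> space M \<and> E \<in> sets (M' (h j))" by blast
  from bchoice[OF this] obtain E where E: "\<And>j. j \<in> K \<Longrightarrow> A j = X (h j) -` E j \<inter> space M"
    "\<And>j. j \<in> K \<Longrightarrow> E j \<in> sets (M' (h j))" by blast
  have inj: "inj_on h K" using h(1) K(2) by (rule inj_on_subset)
  define E' where "E' i = E (the_inv_into K h i)" for i
  have E': "E' (h j) = E j" if "j \<in> K" for j using the_inv_into_f_f[OF inj that] by (simp add: E'_def)
  have "prob (\<Inter>i\<in>h ` K. X i -` E' i \<inter> space M) = (\<Prod>i\<in>h ` K. prob (X i -` E' i \<inter> space M))"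
    by (rule indep_varsD[OF X]) (use K h E E' in auto)
  moreover have "(\<Inter>i\<in>h ` K. X i -` E' i \<inter> space M) = (\<Inter>j\<in>K. A j)" using E(1) E' by auto
  moreover have "(\<Prod>i\<in>h ` K. prob (X i -` E' i \<inter> space M)) = (\<Prod>j\<in>K. prob (A j))"
    using E(1) E' by (subst prod.reindex[OF inj]) (auto intro!: prod.cong)
  ultimately show "prob (\<Inter>j\<in>K. A j) = (\<Prod>j\<in>K. prob (A j))" by simp
qed

lemma (in prob_space) indep_vars_cong_space:
  assumes X: "indep_vars N X I" and eq: "\<And>i \<omega>. i \<in> I \<Longrightarrow> \<omega> \<in> space M \<Longrightarrow> Y i \<omega> = X i \<omega>"
  shows "indep_vars N Y I"
proof -
  have "Y i -` A \<inter> space M = X i -` A \<inter> space M" if "i \<in> I" for i A using eq[OF that] by auto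
  then have "indep_sets (\<lambda>i. {Y i -` A \<inter> space M |A. A \<in> sets (N i)}) I \<longleftrightarrow> indep_sets (\<lambda>i. {X i -` A \<inter> space M |A. A \<in> sets (N i)}) I"
    by (intro indep_sets_cong) auto
  moreover have "Y i \<in> measurable M (N i)" if "i \<in> I" for i
    using X eq[OF that] that by (subst measurable_cong[where g = "X i"]) (auto simp: indep_vars_def2)
  ultimately show ?thesis using X by (simp add: indep_vars_def2)
qed

lemma (in prob_space) indep_vars_singleton:
  assumes "X i \<in> measurable M (N i)"
  shows "indep_vars N X {i}"
  unfolding indep_vars_def2
proof (intro conjI ballI indep_setsI)
  fix A J assume "J \<noteq> {}" "J \<subseteq> {i}"
  then have "J = {i}" by auto
  then show "prob (\<Inter>j\<in>J. A j) = (\<Prod>j\<in>J. prob (A j))" by simp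
qed (use assms in \<open>auto intro: measurable_sets\<close>)

text \<open>Independence can be checked in two stages: first between the groups \<open>X i\<close>, then within each group.\<close>

lemma (in prob_space) indep_vars_Sigma:
  assumes outer: "indep_vars M' X I"
    and meas: "\<And>i c. i \<in> I \<Longrightarrow> c \<in> C i \<Longrightarrow> g i c \<in> measurable (M' i) (N i c)"
    and inner: "\<And>i. i \<in> I \<Longrightarrow> indep_vars (N i) (\<lambda>c \<omega>. g i c (X i \<omega>)) (C i)"
  shows "indep_vars (\<lambda>(i, c). N i c) (\<lambda>(i, c) \<omega>. g i c (X i \<omega>)) (SIGMA i:I. C i)"
  unfolding indep_vars_def2
proof (intro conjI ballI indep_setsI)
  have Xm: "i \<in> I \<Longrightarrow> X i \<in> measurable M (M' i)" for i using outer by (auto simp: indep_vars_def2)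
  show rv: "(case ic of (i, c) \<Rightarrow> \<lambda>\<omega>. g i c (X i \<omega>)) \<in> measurable M (case ic of (i, c) \<Rightarrow> N i c)"
    if "ic \<in> (SIGMA i:I. C i)" for ic
    using that measurable_compose[OF Xm meas] by auto
  show "{(case ic of (i, c) \<Rightarrow> \<lambda>\<omega>. g i c (X i \<omega>)) -` A \<inter> space M |A. A \<in> sets (case ic of (i, c) \<Rightarrow> N i c)} \<subseteq> events"
    if "ic \<in> (SIGMA i:I. C i)" for ic
    using measurable_sets[OF rv[OF that]] by (auto simp only: subset_iff mem_Collect_eq)
  fix A J assume J: "J \<noteq> {}" "J \<subseteq> (SIGMA i:I. C i)" "finite J"
    and A: "\<forall>j\<in>J. A j \<in> {(case j of (i, c) \<Rightarrow> \<lambda>\<omega>. g i c (X i \<omega>)) -` A \<inter> space M |A. A \<in> sets (case j of (i, c) \<Rightarrow> N i c)}"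
  then have "\<forall>j\<in>J. \<exists>E. A j = (case j of (i, c) \<Rightarrow> \<lambda>\<omega>. g i c (X i \<omega>)) -` E \<inter> space M \<and> E \<in> sets (case j of (i, c) \<Rightarrow> N i c)"
    by blast
  from bchoice[OF this] obtain E where E: "\<And>j. j \<in> J \<Longrightarrow> A j = (case j of (i, c) \<Rightarrow> \<lambda>\<omega>. g i c (X i \<omega>)) -` E j \<inter> space M"
     "\<And>j. j \<in> J \<Longrightarrow> E j \<in> sets (case j of (i, c) \<Rightarrow> N i c)"
    by blast
  define Jc where "Jc i = {c. (i, c) \<in> J}" for i
  have fin: "finite (Jc i)" for i
  proof -
    have "Jc i \<subseteq> snd ` J" by (auto simp: Jc_def intro: image_eqI[of _ snd "(i, _)"])
    then show ?thesis using J(3) finite_subset by blast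
  qed
  have JS: "J = (SIGMA i:fst ` J. Jc i)" by (auto simp: Jc_def intro: rev_image_eqI)
  have sub: "Jc i \<noteq> {}" "Jc i \<subseteq> C i" "i \<in> I" if i: "i \<in> fst ` J" for i
  proof -
    obtain c where c: "(i, c) \<in> J" using i by auto
    then show "Jc i \<noteq> {}" by (auto simp: Jc_def)
    show "i \<in> I" using c J(2) by (meson mem_Sigma_iff subsetD)
    show "Jc i \<subseteq> C i"
    proof
      fix c assume "c \<in> Jc i"
      then have "(i, c) \<in> J" by (simp add: Jc_def)
      then show "c \<in> C i" using J(2) by (meson mem_Sigma_iff subsetD)
    qed
  qed
  define B where "B i = (\<Inter>c\<in>Jc i. g i c -` E (i, c) \<inter> space (M' i))" for i
  have B: "B i \<in> sets (M' i)" if "i \<in> fst ` J" for i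
    unfolding B_def
  proof (rule sets.finite_INT[OF fin sub(1)[OF that]])
    fix c assume c: "c \<in> Jc i"
    have "E (i, c) \<in> sets (N i c)" using E(2)[of "(i, c)"] c by (simp add: Jc_def)
    then show "g i c -` E (i, c) \<inter> space (M' i) \<in> sets (M' i)"
      using meas[of i c] sub[OF that] c by (auto intro: measurable_sets)
  qed
  have pre: "X i -` B i \<inter> space M = (\<Inter>c\<in>Jc i. (\<lambda>\<omega>. g i c (X i \<omega>)) -` E (i, c) \<inter> space M)" if "i \<in> fst ` J" for i
    using sub[OF that] measurable_space[OF Xm] unfolding B_def by auto
  have "(\<Inter>j\<in>J. A j) = (\<Inter>i\<in>fst ` J. X i -` B i \<inter> space M)"
  proof -
    have "(\<Inter>j\<in>J. A j) = (\<Inter>i\<in>fst ` J. \<Inter>c\<in>Jc i. A (i, c))"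
      by (subst JS) auto
    also have "\<dots> = (\<Inter>i\<in>fst ` J. X i -` B i \<inter> space M)"
    proof (rule INF_cong[OF refl])
      fix i assume i: "i \<in> fst ` J"
      show "(\<Inter>c\<in>Jc i. A (i, c)) = X i -` B i \<inter> space M"
        unfolding pre[OF i] by (rule INF_cong[OF refl]) (simp add: E(1) Jc_def)
    qed
    finally show ?thesis .
  qed
  then have "prob (\<Inter>j\<in>J. A j) = (\<Prod>i\<in>fst ` J. prob (X i -` B i \<inter> space M))"
    using indep_varsD[OF outer, of "fst ` J" B] J(1,3) image_subsetI[of J fst I] sub(3) B by auto
  also have "\<dots> = (\<Prod>i\<in>fst ` J. \<Prod>c\<in>Jc i. prob (A (i, c)))"
  proof (rule prod.cong[OF refl])
    fix i assume i: "i \<in> fst ` J"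
    have "prob (X i -` B i \<inter> space M) = (\<Prod>c\<in>Jc i. prob ((\<lambda>\<omega>. g i c (X i \<omega>)) -` E (i, c) \<inter> space M))"
      unfolding pre[OF i]
    proof (rule indep_varsD[OF inner[OF sub(3)[OF i]] sub(1)[OF i] fin sub(2)[OF i]])
      show "E (i, c) \<in> sets (N i c)" if "c \<in> Jc i" for c using E(2)[of "(i, c)"] that by (simp add: Jc_def)
    qed
    also have "\<dots> = (\<Prod>c\<in>Jc i. prob (A (i, c)))"
      by (rule prod.cong[OF refl]) (simp add: E(1) Jc_def)
    finally show "prob (X i -` B i \<inter> space M) = (\<Prod>c\<in>Jc i. prob (A (i, c)))" .
  qed
  also have "\<dots> = (\<Prod>(i, c)\<in>(SIGMA i:fst ` J. Jc i). prob (A (i, c)))"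
    using J(3) fin by (intro prod.Sigma) auto
  also have "\<dots> = (\<Prod>j\<in>J. prob (A j))" using JS by (simp add: case_prod_beta')
  finally show "prob (\<Inter>j\<in>J. A j) = (\<Prod>j\<in>J. prob (A j))" .
qed


lemma (in prob_space) normal_moments:
  assumes g: "distributed M lborel g (normal_density 0 \<sigma>)" and \<sigma>: "\<sigma> > 0"
  shows "integrable M (\<lambda>\<omega>. g \<omega> ^ k)"
    "(\<integral>\<omega>. g \<omega> ^ (2 * j) \<partial>M) = fact (2 * j) / ((2 / \<sigma>\<^sup>2) ^ j * fact j)"
    "(\<integral>\<omega>. g \<omega> ^ (2 * j + 1) \<partial>M) = 0"
    "g \<in> borel_measurable M"
proof -
  show "integrable M (\<lambda>\<omega>. g \<omega> ^ k)"
    using distributed_integrable[OF g, of "\<lambda>x. x ^ k"] integrable_normal_moment[OF \<sigma>, of 0 k] by simp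
  show "(\<integral>\<omega>. g \<omega> ^ (2 * j) \<partial>M) = fact (2 * j) / ((2 / \<sigma>\<^sup>2) ^ j * fact j)"
    using distributed_integral[OF g, of "\<lambda>x. x ^ (2 * j)"] integral_normal_moment_even[OF \<sigma>, of 0 j] by simp
  show "(\<integral>\<omega>. g \<omega> ^ (2 * j + 1) \<partial>M) = 0"
    using distributed_integral[OF g, of "\<lambda>x. x ^ (2 * j + 1)"] integral_normal_moment_odd[OF \<sigma>, of 0 j] by simp
  show "g \<in> borel_measurable M" using distributed_measurable[OF g] by simp
qed

text \<open>The \<open>k\<close>-th moment of the centred normal distribution with variance \<open>v\<close>; for even \<open>k\<close> the quotient of factorials is the
double factorial of \<open>k - 1\<close>.\<close>

definition gaussian_moment :: "real \<Rightarrow> nat \<Rightarrow> real" where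
  "gaussian_moment v k = (if odd k then 0 else fact k * v ^ (k div 2) / (2 ^ (k div 2) * fact (k div 2)))"

lemma gaussian_moment_simps: "gaussian_moment v 0 = 1" "gaussian_moment v 1 = 0" "gaussian_moment v (Suc 0) = 0" "gaussian_moment v 2 = v" "gaussian_moment v 3 = 0"
  "gaussian_moment v 4 = 3 * v\<^sup>2" "gaussian_moment v 8 = 105 * v ^ 4"
  "gaussian_moment v (Suc (Suc 0)) = v" "gaussian_moment v (Suc (Suc (Suc 0))) = 0" "gaussian_moment v (Suc (Suc (Suc (Suc 0)))) = 3 * v\<^sup>2"
  by (simp_all add: gaussian_moment_def fact_numeral power2_eq_square)

lemma (in prob_space) normal_power_moment:
  assumes "distributed M lborel g (normal_density 0 (sqrt v))" "v > 0"
  shows "(\<integral>\<omega>. g \<omega> ^ k \<partial>M) = gaussian_moment v k"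
proof (cases "even k")
  case True
  then obtain j where "k = 2 * j" by (rule evenE)
  then show ?thesis using normal_moments(2)[OF assms(1), of j] assms(2) by (simp add: gaussian_moment_def power_divide)
next
  case False
  then obtain j where "k = 2 * j + 1" by (rule oddE)
  then show ?thesis using normal_moments(3)[OF assms(1), of j] assms(2) by (simp add: gaussian_moment_def)
qed

lemma (in prob_space) normal_char:
  assumes g: "distributed M lborel g (normal_density 0 \<sigma>)" and \<sigma>: "\<sigma> > 0"
  shows "char (distr M borel g) u = exp (- (u\<^sup>2 * \<sigma>\<^sup>2) / 2)"
proof -
  have "distributed M lborel (\<lambda>x. (g x - 0) / \<sigma>) std_normal_density"
    using g normal_standard_normal_convert[OF \<sigma>, of g 0] by simp
  then have d: "distr M lborel (\<lambda>x. g x / \<sigma>) = std_normal_distribution"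
    by (simp add: distributed_distr_eq_density)
  have gm: "g \<in> borel_measurable M" by (rule normal_moments(4)[OF g \<sigma>])
  have "distr M borel (\<lambda>x. g x / \<sigma>) = std_normal_distribution"
    unfolding d[symmetric] by (rule distr_cong) auto
  then have "char (distr M borel (\<lambda>x. g x / \<sigma>)) (u * \<sigma>) = exp (- ((u * \<sigma>)\<^sup>2) / 2)"
    by (simp add: char_std_normal_distribution)
  moreover have "char (distr M borel (\<lambda>x. g x / \<sigma>)) (u * \<sigma>) = char (distr M borel g) u"
    unfolding char_def using gm \<sigma> by (subst (1 2) integral_distr) auto
  ultimately show ?thesis by (simp add: power_mult_distrib)
qed

lemma (in prob_space) expectation_cos_char:
  assumes [measurable]: "X \<in> borel_measurable M"
  shows "(\<integral>\<omega>. cos (X \<omega> + \<theta>) \<partial>M) = Re (cis \<theta> * char (distr M borel X) 1)"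
proof -
  have i: "integrable M (\<lambda>\<omega>. iexp (X \<omega>))" by (rule integrable_iexp) auto
  have "Re (cis \<theta> * char (distr M borel X) 1) = Re (\<integral>\<omega>. cis \<theta> * iexp (X \<omega>) \<partial>M)"
    unfolding char_def by (subst integral_distr) auto
  also have "\<dots> = (\<integral>\<omega>. Re (cis \<theta> * iexp (X \<omega>)) \<partial>M)"
    using i by (subst integral_Re) auto
  also have "\<dots> = (\<integral>\<omega>. cos (X \<omega> + \<theta>) \<partial>M)"
    by (intro Bochner_Integration.integral_cong) (auto simp flip: cis_conv_exp simp: cis_mult add.commute)
  finally show ?thesis by simp
qed

lemma (in prob_space) gaussian_family_cos:
  assumes ind: "indep_vars (\<lambda>_. borel) g A" and A: "finite A"
    and g: "\<And>a. a \<in> A \<Longrightarrow> distributed M lborel (g a) (normal_density 0 (sqrt (v a)))" and v: "\<And>a. a \<in> A \<Longrightarrow> v a > 0"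
  shows "(\<integral>\<omega>. cos ((\<Sum>a\<in>A. u a * g a \<omega>) + \<theta>) \<partial>M) = exp (- (\<Sum>a\<in>A. (u a)\<^sup>2 * v a) / 2) * cos \<theta>"
proof -
  have gm: "g a \<in> borel_measurable M" if "a \<in> A" for a using normal_moments(4)[OF g] v that by simp
  have ind': "indep_vars (\<lambda>_. borel) (\<lambda>a \<omega>. u a * g a \<omega>) A"
    by (rule indep_vars_compose2[OF ind, of "\<lambda>a x. u a * x"]) simp
  have "char (distr M borel (\<lambda>\<omega>. \<Sum>a\<in>A. u a * g a \<omega>)) 1 = (\<Prod>a\<in>A. char (distr M borel (\<lambda>\<omega>. u a * g a \<omega>)) 1)"
    by (rule char_distr_sum[OF ind'])
  also have "\<dots> = (\<Prod>a\<in>A. exp (of_real (- ((u a)\<^sup>2 * v a / 2))))"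
  proof (rule prod.cong[OF refl])
    fix a assume a: "a \<in> A"
    have "char (distr M borel (\<lambda>\<omega>. u a * g a \<omega>)) 1 = char (distr M borel (g a)) (u a)"
      unfolding char_def using gm[OF a] by (subst (1 2) integral_distr) auto
    also have "\<dots> = exp (of_real (- ((u a)\<^sup>2 * v a / 2)))"
      using normal_char[OF g[OF a]] v[OF a] by (simp flip: exp_of_real)
    finally show "char (distr M borel (\<lambda>\<omega>. u a * g a \<omega>)) 1 = exp (of_real (- ((u a)\<^sup>2 * v a / 2)))" .
  qed
  also have "\<dots> = of_real (exp (- (\<Sum>a\<in>A. (u a)\<^sup>2 * v a) / 2))"
    by (simp add: exp_sum[OF A, symmetric] sum_negf sum_divide_distrib flip: exp_of_real)
  finally have c: "char (distr M borel (\<lambda>\<omega>. \<Sum>a\<in>A. u a * g a \<omega>)) 1 = of_real (exp (- (\<Sum>a\<in>A. (u a)\<^sup>2 * v a) / 2))" .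
  have "(\<lambda>\<omega>. \<Sum>a\<in>A. u a * g a \<omega>) \<in> borel_measurable M" using gm by (intro borel_measurable_sum) auto
  from expectation_cos_char[OF this, of \<theta>] show ?thesis unfolding c by simp
qed

lemma (in prob_space) gaussian_product_moment:
  assumes ind: "indep_vars (\<lambda>_. borel) g A" and A: "finite A"
    and g: "\<And>a. a \<in> A \<Longrightarrow> distributed M lborel (g a) (normal_density 0 (sqrt v))" and v: "v > 0"
  shows "integrable M (\<lambda>\<omega>. \<Prod>a\<in>A. g a \<omega> ^ n a)" "(\<integral>\<omega>. (\<Prod>a\<in>A. g a \<omega> ^ n a) \<partial>M) = (\<Prod>a\<in>A. gaussian_moment v (n a))"
proof -
  have ind': "indep_vars (\<lambda>_. borel) (\<lambda>a \<omega>. g a \<omega> ^ n a) A"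
    by (rule indep_vars_compose2[OF ind, of "\<lambda>a x. x ^ n a"]) simp
  have int: "integrable M (\<lambda>\<omega>. g a \<omega> ^ n a)" if "a \<in> A" for a
    using normal_moments(1)[OF g[OF that]] v by simp
  show "integrable M (\<lambda>\<omega>. \<Prod>a\<in>A. g a \<omega> ^ n a)" by (rule indep_vars_integrable[OF A ind' int])
  have "(\<integral>\<omega>. (\<Prod>a\<in>A. g a \<omega> ^ n a) \<partial>M) = (\<Prod>a\<in>A. \<integral>\<omega>. g a \<omega> ^ n a \<partial>M)"
    by (rule indep_vars_lebesgue_integral[OF A ind' int])
  also have "\<dots> = (\<Prod>a\<in>A. gaussian_moment v (n a))"
    using normal_power_moment[OF g v] by (intro prod.cong) auto
  finally show "(\<integral>\<omega>. (\<Prod>a\<in>A. g a \<omega> ^ n a) \<partial>M) = (\<Prod>a\<in>A. gaussian_moment v (n a))" .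
qed

text \<open>A product of the variables is a product of powers with exponents \<open>n2\<close>, \<open>n4\<close>; the expectation then factorises, and odd
moments vanish.\<close>

lemma (in prob_space) isserlis:
  assumes ind: "indep_vars (\<lambda>_. borel) g A" and A: "finite A"
    and g: "\<And>a. a \<in> A \<Longrightarrow> distributed M lborel (g a) (normal_density 0 (sqrt v))" and v: "v > 0"
    and abcd: "a \<in> A" "b \<in> A" "c \<in> A" "d \<in> A"
  shows "integrable M (\<lambda>\<omega>. g a \<omega> * g b \<omega>)" "(\<integral>\<omega>. g a \<omega> * g b \<omega> \<partial>M) = (if a = b then v else 0)"
    "integrable M (\<lambda>\<omega>. g a \<omega> * g b \<omega> * (g c \<omega> * g d \<omega>))"
    "(\<integral>\<omega>. g a \<omega> * g b \<omega> * (g c \<omega> * g d \<omega>) \<partial>M) =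
      v\<^sup>2 * (of_bool (a = b \<and> c = d) + of_bool (a = c \<and> b = d) + of_bool (a = d \<and> b = c))"
proof -
  define n2 where "n2 i = (if i = a then 1 else 0) + (if i = b then 1 else (0::nat))" for i
  define n4 where "n4 i = (if i = a then 1 else 0) + (if i = b then 1 else 0) + (if i = c then 1 else 0) + (if i = d then 1 else (0::nat))" for i
  have pow: "(\<Prod>i\<in>A. g i \<omega> ^ (if i = e then 1 else 0)) = g e \<omega>" if "e \<in> A" for e \<omega>
  proof -
    have "(\<Prod>i\<in>A. g i \<omega> ^ (if i = e then 1 else 0)) = (\<Prod>i\<in>A. if i = e then g i \<omega> else 1)"
      by (rule prod.cong) auto
    then show ?thesis using that A by simp
  qed
  have p2: "(\<Prod>i\<in>A. g i \<omega> ^ n2 i) = g a \<omega> * g b \<omega>" for \<omega>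
    unfolding n2_def power_add prod.distrib using pow abcd by simp
  have p4: "(\<Prod>i\<in>A. g i \<omega> ^ n4 i) = g a \<omega> * g b \<omega> * (g c \<omega> * g d \<omega>)" for \<omega>
    unfolding n4_def power_add prod.distrib using pow abcd by simp
  have m: "integrable M (\<lambda>\<omega>. \<Prod>a\<in>A. g a \<omega> ^ n a)" "(\<integral>\<omega>. (\<Prod>a\<in>A. g a \<omega> ^ n a) \<partial>M) = (\<Prod>a\<in>A. gaussian_moment v (n a))" for n
    using gaussian_product_moment[OF ind A _ v] g by blast+
  show "integrable M (\<lambda>\<omega>. g a \<omega> * g b \<omega>)" using m(1)[of n2] by (simp add: p2)
  show "integrable M (\<lambda>\<omega>. g a \<omega> * g b \<omega> * (g c \<omega> * g d \<omega>))" using m(1)[of n4] by (simp add: p4)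
  have "(\<Prod>i\<in>A. gaussian_moment v (n2 i)) = (\<Prod>i\<in>{a, b}. gaussian_moment v (n2 i))"
    using abcd A by (intro prod.mono_neutral_right) (auto simp: n2_def gaussian_moment_simps)
  also have "\<dots> = (if a = b then v else 0)"
    by (cases "a = b") (simp_all add: n2_def gaussian_moment_simps)
  finally show "(\<integral>\<omega>. g a \<omega> * g b \<omega> \<partial>M) = (if a = b then v else 0)"
    using m(2)[of n2] by (simp add: p2)
  have "(\<Prod>i\<in>A. gaussian_moment v (n4 i)) = (\<Prod>i\<in>{a, b, c, d}. gaussian_moment v (n4 i))"
    using abcd A by (intro prod.mono_neutral_right) (auto simp: n4_def gaussian_moment_simps)
  also have "\<dots> = v\<^sup>2 * (of_bool (a = b \<and> c = d) + of_bool (a = c \<and> b = d) + of_bool (a = d \<and> b = c))"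
    by (cases "a = b"; cases "a = c"; cases "a = d"; cases "b = c"; cases "b = d"; cases "c = d")
      (simp_all add: n4_def gaussian_moment_simps power2_eq_square insert_commute)
  finally show "(\<integral>\<omega>. g a \<omega> * g b \<omega> * (g c \<omega> * g d \<omega>) \<partial>M) =
      v\<^sup>2 * (of_bool (a = b \<and> c = d) + of_bool (a = c \<and> b = d) + of_bool (a = d \<and> b = c))"
    using m(2)[of n4] by (simp add: p4)
qed

lemma sum_power4_le:
  fixes x :: "'i \<Rightarrow> real"
  assumes "finite I"
  shows "(\<Sum>i\<in>I. x i) ^ 4 \<le> real (card I) ^ 3 * (\<Sum>i\<in>I. x i ^ 4)"
proof -
  have "(\<Sum>i\<in>I. x i) ^ 4 = ((\<Sum>i\<in>I. x i)\<^sup>2)\<^sup>2" by simp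
  also have "\<dots> \<le> ((\<Sum>i\<in>I. (x i)\<^sup>2) * real (card I))\<^sup>2"
    by (intro power_mono sum_squared_le_sum_of_squares assms) auto
  also have "\<dots> = (\<Sum>i\<in>I. (x i)\<^sup>2)\<^sup>2 * (real (card I))\<^sup>2" by (simp add: power_mult_distrib)
  also have "\<dots> \<le> ((\<Sum>i\<in>I. ((x i)\<^sup>2)\<^sup>2) * real (card I)) * (real (card I))\<^sup>2"
    by (intro mult_right_mono sum_squared_le_sum_of_squares assms) auto
  finally show ?thesis by (simp add: power2_eq_square power3_eq_cube power4_eq_xxxx mult_ac)
qed

text \<open>The bound on the fourth moment is crude; what matters is that it depends only on the coefficients, so that it is uniform in the
columns. The constant is \<open>8 (105 + 105 + 1) = 1688\<close>, from \<open>(x y - w)\<^sup>4 \<le> 8 (x\<^sup>8 + y\<^sup>8 + w\<^sup>4)\<close>, \<open>w \<le> v\<close> and the eighth moment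
\<open>105 v\<^sup>4\<close>.\<close>

lemma (in prob_space) gaussian_quadratic_form:
  fixes C :: "'i \<Rightarrow> 'i \<Rightarrow> real"
  assumes ind: "indep_vars (\<lambda>_. borel) g A" and A: "finite A"
    and g: "\<And>a. a \<in> A \<Longrightarrow> distributed M lborel (g a) (normal_density 0 (sqrt v))" and v: "v > 0"
    and sym: "\<And>a b. C a b = C b a"
  defines "T \<equiv> \<lambda>\<omega>. \<Sum>a\<in>A. \<Sum>b\<in>A. C a b * (g a \<omega> * g b \<omega> - (if a = b then v else 0))"
  shows "T \<in> borel_measurable M" "(\<integral>\<omega>. T \<omega> \<partial>M) = 0" "(\<integral>\<omega>. (T \<omega>)\<^sup>2 \<partial>M) = 2 * v\<^sup>2 * (\<Sum>a\<in>A. \<Sum>b\<in>A. (C a b)\<^sup>2)"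
    "integrable M (\<lambda>\<omega>. T \<omega> ^ 4)"
    "(\<integral>\<omega>. T \<omega> ^ 4 \<partial>M) \<le> real (card (A \<times> A)) ^ 3 * (\<Sum>(a, b)\<in>A \<times> A. C a b ^ 4) * (1688 * v ^ 4)"
proof -
  have iss: "integrable M (\<lambda>\<omega>. g a \<omega> * g b \<omega>)" "(\<integral>\<omega>. g a \<omega> * g b \<omega> \<partial>M) = (if a = b then v else 0)"
    "integrable M (\<lambda>\<omega>. g a \<omega> * g b \<omega> * (g c \<omega> * g d \<omega>))"
    "(\<integral>\<omega>. g a \<omega> * g b \<omega> * (g c \<omega> * g d \<omega>) \<partial>M) =
      v\<^sup>2 * (of_bool (a = b \<and> c = d) + of_bool (a = c \<and> b = d) + of_bool (a = d \<and> b = c))"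
    if "a \<in> A" "b \<in> A" "c \<in> A" "d \<in> A" for a b c d
    using isserlis[OF ind A _ v that] g by blast+
  have gm: "g a \<in> borel_measurable M" if "a \<in> A" for a using normal_moments(4)[OF g] v that by simp
  show Tm[measurable]: "T \<in> borel_measurable M"
    unfolding T_def using gm by (intro borel_measurable_sum borel_measurable_times borel_measurable_diff) auto
  define q where "q ab \<omega> = g (fst ab) \<omega> * g (snd ab) \<omega> - (if fst ab = snd ab then v else 0)" for ab \<omega>
  have Tq: "T \<omega> = (\<Sum>ab\<in>A \<times> A. C (fst ab) (snd ab) * q ab \<omega>)" for \<omega>
    unfolding T_def q_def by (simp add: sum.cartesian_product case_prod_beta')
  have qi: "integrable M (q ab)" and qe: "(\<integral>\<omega>. q ab \<omega> \<partial>M) = 0" if "ab \<in> A \<times> A" for ab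
    using that iss(1,2)[of "fst ab" "snd ab" "fst ab" "snd ab"] unfolding q_def by (auto simp: prob_space)
  show "(\<integral>\<omega>. T \<omega> \<partial>M) = 0" unfolding Tq using qi qe by (subst Bochner_Integration.integral_sum) auto
  have qq: "integrable M (\<lambda>\<omega>. q ab \<omega> * q cd \<omega>)"
     "(\<integral>\<omega>. q ab \<omega> * q cd \<omega> \<partial>M) = v\<^sup>2 * (of_bool (cd = ab) + of_bool (cd = (snd ab, fst ab)))"
    if "ab \<in> A \<times> A" "cd \<in> A \<times> A" for ab cd
  proof -
    obtain a b c d where ab: "ab = (a, b)" "cd = (c, d)" by (metis surj_pair)
    then have m: "a \<in> A" "b \<in> A" "c \<in> A" "d \<in> A" using that by auto
    define \<alpha> where "\<alpha> = (if a = b then v else 0)"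
    define \<beta> where "\<beta> = (if c = d then v else 0)"
    have eq: "q ab \<omega> * q cd \<omega> = g a \<omega> * g b \<omega> * (g c \<omega> * g d \<omega>) - \<beta> * (g a \<omega> * g b \<omega>)
       - \<alpha> * (g c \<omega> * g d \<omega>) + \<alpha> * \<beta>" for \<omega>
      by (simp add: q_def ab \<alpha>_def[symmetric] \<beta>_def[symmetric] algebra_simps)
    note int = iss(1)[OF m] iss(1)[OF m(3,4,1,2)] iss(3)[OF m]
    show "integrable M (\<lambda>\<omega>. q ab \<omega> * q cd \<omega>)"
      unfolding eq using int by simp
    have "(\<integral>\<omega>. q ab \<omega> * q cd \<omega> \<partial>M) = (\<integral>\<omega>. g a \<omega> * g b \<omega> * (g c \<omega> * g d \<omega>) \<partial>M)
        - \<beta> * (\<integral>\<omega>. g a \<omega> * g b \<omega> \<partial>M) - \<alpha> * (\<integral>\<omega>. g c \<omega> * g d \<omega> \<partial>M) + \<alpha> * \<beta>"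
      unfolding eq using int by (simp add: prob_space)
    also have "(\<integral>\<omega>. g a \<omega> * g b \<omega> \<partial>M) = \<alpha>" using iss(2)[OF m] by (simp add: \<alpha>_def)
    also have "(\<integral>\<omega>. g c \<omega> * g d \<omega> \<partial>M) = \<beta>" using iss(2)[OF m(3,4,1,2)] by (simp add: \<beta>_def)
    finally have E: "(\<integral>\<omega>. q ab \<omega> * q cd \<omega> \<partial>M) =
        v\<^sup>2 * (of_bool (a = b \<and> c = d) + of_bool (a = c \<and> b = d) + of_bool (a = d \<and> b = c)) - \<alpha> * \<beta>"
      unfolding iss(4)[OF m] by simp
    have "\<alpha> * \<beta> = v\<^sup>2 * of_bool (a = b \<and> c = d)" by (simp add: \<alpha>_def \<beta>_def power2_eq_square)
    moreover have "(cd = ab) = (a = c \<and> b = d)" "(cd = (snd ab, fst ab)) = (a = d \<and> b = c)"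
      by (auto simp: ab)
    ultimately show "(\<integral>\<omega>. q ab \<omega> * q cd \<omega> \<partial>M) = v\<^sup>2 * (of_bool (cd = ab) + of_bool (cd = (snd ab, fst ab)))"
      unfolding E by (simp add: distrib_left)
  qed
  have T2: "(T \<omega>)\<^sup>2 = (\<Sum>ab\<in>A \<times> A. \<Sum>cd\<in>A \<times> A. C (fst ab) (snd ab) * C (fst cd) (snd cd) * (q ab \<omega> * q cd \<omega>))" for \<omega>
    unfolding Tq power2_eq_square sum_product by (simp add: mult_ac)
  have "(\<integral>\<omega>. (T \<omega>)\<^sup>2 \<partial>M) = (\<Sum>ab\<in>A \<times> A. \<Sum>cd\<in>A \<times> A. C (fst ab) (snd ab) * C (fst cd) (snd cd) *
       (v\<^sup>2 * (of_bool (cd = ab) + of_bool (cd = (snd ab, fst ab)))))"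
  proof -
    have "(\<integral>\<omega>. (T \<omega>)\<^sup>2 \<partial>M) = (\<Sum>ab\<in>A \<times> A. \<integral>\<omega>. (\<Sum>cd\<in>A \<times> A. C (fst ab) (snd ab) * C (fst cd) (snd cd) * (q ab \<omega> * q cd \<omega>)) \<partial>M)"
      unfolding T2 using qq(1)
      by (intro Bochner_Integration.integral_sum Bochner_Integration.integrable_sum integrable_mult_right) assumption
    also have "\<dots> = (\<Sum>ab\<in>A \<times> A. \<Sum>cd\<in>A \<times> A. \<integral>\<omega>. C (fst ab) (snd ab) * C (fst cd) (snd cd) * (q ab \<omega> * q cd \<omega>) \<partial>M)"
      using qq(1)
      by (intro sum.cong refl Bochner_Integration.integral_sum integrable_mult_right) assumption
    also have "\<dots> = (\<Sum>ab\<in>A \<times> A. \<Sum>cd\<in>A \<times> A. C (fst ab) (snd ab) * C (fst cd) (snd cd) *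
       (v\<^sup>2 * (of_bool (cd = ab) + of_bool (cd = (snd ab, fst ab)))))"
      using qq by (intro sum.cong refl) (simp only: integral_mult_right_zero)
    finally show ?thesis .
  qed
  also have "\<dots> = (\<Sum>ab\<in>A \<times> A. 2 * v\<^sup>2 * (C (fst ab) (snd ab))\<^sup>2)"
  proof (rule sum.cong[OF refl])
    fix ab assume ab: "ab \<in> A \<times> A"
    have "(\<Sum>cd\<in>A \<times> A. C (fst ab) (snd ab) * C (fst cd) (snd cd) * (v\<^sup>2 * (of_bool (cd = ab) + of_bool (cd = (snd ab, fst ab)))))
      = (\<Sum>cd\<in>A \<times> A. if cd = ab then C (fst ab) (snd ab) * C (fst ab) (snd ab) * v\<^sup>2 else 0) +
        (\<Sum>cd\<in>A \<times> A. if cd = (snd ab, fst ab) then C (fst ab) (snd ab) * C (snd ab) (fst ab) * v\<^sup>2 else 0)"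
      unfolding sum.distrib[symmetric] by (intro sum.cong) (auto simp: algebra_simps)
    also have "\<dots> = C (fst ab) (snd ab) * C (fst ab) (snd ab) * v\<^sup>2 + C (fst ab) (snd ab) * C (snd ab) (fst ab) * v\<^sup>2"
      using ab A by (subst (1 2) sum.delta) auto
    also have "\<dots> = 2 * v\<^sup>2 * (C (fst ab) (snd ab))\<^sup>2"
      using sym[of "snd ab" "fst ab"] by (simp add: power2_eq_square)
    finally show "(\<Sum>cd\<in>A \<times> A. C (fst ab) (snd ab) * C (fst cd) (snd cd) * (v\<^sup>2 * (of_bool (cd = ab) + of_bool (cd = (snd ab, fst ab)))))
       = 2 * v\<^sup>2 * (C (fst ab) (snd ab))\<^sup>2" .
  qed
  also have "\<dots> = 2 * v\<^sup>2 * (\<Sum>a\<in>A. \<Sum>b\<in>A. (C a b)\<^sup>2)"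
    by (simp add: sum.cartesian_product case_prod_beta' sum_distrib_left)
  finally show "(\<integral>\<omega>. (T \<omega>)\<^sup>2 \<partial>M) = 2 * v\<^sup>2 * (\<Sum>a\<in>A. \<Sum>b\<in>A. (C a b)\<^sup>2)" .
  define K where "K = real (card (A \<times> A)) ^ 3"
  define h where "h ab \<omega> = 8 * (g (fst ab) \<omega> ^ 8 + g (snd ab) \<omega> ^ 8 + v ^ 4)" for ab \<omega>
  have qh: "q ab \<omega> ^ 4 \<le> h ab \<omega>" for ab \<omega>
  proof -
    define x where "x = g (fst ab) \<omega>"
    define y where "y = g (snd ab) \<omega>"
    define w where "w = (if fst ab = snd ab then v else 0)"
    have "(x * y - w) ^ 4 \<le> 8 * ((x * y) ^ 4 + w ^ 4)"
      using sum_power4_le[of "{False, True}" "\<lambda>b. if b then x * y else - w"] by simp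
    moreover have "(x * y) ^ 4 \<le> x ^ 8 + y ^ 8"
    proof -
      have "2 * (x * y) ^ 4 \<le> x ^ 8 + y ^ 8"
        using sum_squares_bound[of "x ^ 4" "y ^ 4"] by (simp add: power_mult_distrib flip: power_mult)
      moreover have "0 \<le> (x * y) ^ 4" by simp
      ultimately show ?thesis by linarith
    qed
    moreover have "w ^ 4 \<le> v ^ 4" by (simp add: w_def)
    ultimately have "(x * y - w) ^ 4 \<le> 8 * (x ^ 8 + y ^ 8 + v ^ 4)"
      by (meson add_mono mult_left_mono order_trans zero_le_numeral)
    then show ?thesis by (simp add: q_def h_def x_def y_def w_def)
  qed
  have hi: "integrable M (h ab)" and he: "(\<integral>\<omega>. h ab \<omega> \<partial>M) = 1688 * v ^ 4" if "ab \<in> A \<times> A" for ab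
    using that normal_moments(1)[OF g, of _ 8] normal_power_moment[OF g v, of _ 8] v
    by (auto simp: h_def[abs_def] prob_space gaussian_moment_simps)
  define H where "H \<omega> = K * (\<Sum>ab\<in>A \<times> A. C (fst ab) (snd ab) ^ 4 * h ab \<omega>)" for \<omega>
  have TH: "T \<omega> ^ 4 \<le> H \<omega>" for \<omega>
  proof -
    have "T \<omega> ^ 4 \<le> K * (\<Sum>ab\<in>A \<times> A. (C (fst ab) (snd ab) * q ab \<omega>) ^ 4)"
      unfolding Tq K_def by (rule sum_power4_le) (use A in auto)
    also have "\<dots> \<le> H \<omega>"
      unfolding H_def power_mult_distrib using qh by (intro mult_left_mono sum_mono) (auto simp: K_def)
    finally show ?thesis .
  qed
  have Hi: "integrable M H" unfolding H_def using hi by auto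
  show Ti: "integrable M (\<lambda>\<omega>. T \<omega> ^ 4)"
    by (rule Bochner_Integration.integrable_bound[OF Hi]) (use TH in \<open>auto intro: order_trans[OF _ abs_ge_self]\<close>)
  have "(\<integral>\<omega>. T \<omega> ^ 4 \<partial>M) \<le> (\<integral>\<omega>. H \<omega> \<partial>M)" by (rule integral_mono[OF Ti Hi TH])
  also have "\<dots> = K * (\<Sum>ab\<in>A \<times> A. C (fst ab) (snd ab) ^ 4 * (1688 * v ^ 4))"
    unfolding H_def using hi he by (simp add: Bochner_Integration.integral_sum)
  also have "\<dots> = K * (\<Sum>(a, b)\<in>A \<times> A. C a b ^ 4) * (1688 * v ^ 4)"
    by (simp add: sum_distrib_right case_prod_beta')
  finally show "(\<integral>\<omega>. T \<omega> ^ 4 \<partial>M) \<le> real (card (A \<times> A)) ^ 3 * (\<Sum>(a, b)\<in>A \<times> A. C a b ^ 4) * (1688 * v ^ 4)"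
    by (simp add: K_def)
qed



lemma (in prob_space) integrable_power_le4:
  fixes X :: "'a \<Rightarrow> real"
  assumes [measurable]: "X \<in> borel_measurable M" and X4: "integrable M (\<lambda>\<omega>. X \<omega> ^ 4)" and j: "j \<le> 4"
  shows "integrable M (\<lambda>\<omega>. X \<omega> ^ j)" "integrable M (\<lambda>\<omega>. \<bar>X \<omega>\<bar> ^ j)"
    "(\<integral>\<omega>. \<bar>X \<omega>\<bar> ^ j \<partial>M) \<le> 1 + (\<integral>\<omega>. X \<omega> ^ 4 \<partial>M)"
proof -
  have b: "\<bar>x\<bar> ^ j \<le> 1 + x ^ 4" for x :: real
  proof (cases "\<bar>x\<bar> \<le> 1")
    case True
    then have "\<bar>x\<bar> ^ j \<le> 1" by (intro power_le_one) auto
    moreover have "0 \<le> x ^ 4" by simp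
    ultimately show ?thesis by linarith
  next
    case False
    then have "\<bar>x\<bar> ^ j \<le> \<bar>x\<bar> ^ 4" using j by (intro power_increasing) auto
    then show ?thesis by simp
  qed
  have i: "integrable M (\<lambda>\<omega>. 1 + X \<omega> ^ 4)" using X4 by simp
  show *: "integrable M (\<lambda>\<omega>. \<bar>X \<omega>\<bar> ^ j)"
    by (rule Bochner_Integration.integrable_bound[OF i])
      (use b in \<open>auto simp: power_abs intro: order_trans[OF _ abs_ge_self]\<close>)
  show "integrable M (\<lambda>\<omega>. X \<omega> ^ j)"
    by (rule Bochner_Integration.integrable_bound[OF *]) (auto simp: power_abs)
  have "(\<integral>\<omega>. \<bar>X \<omega>\<bar> ^ j \<partial>M) \<le> (\<integral>\<omega>. 1 + X \<omega> ^ 4 \<partial>M)"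
    by (rule integral_mono[OF * i b])
  then show "(\<integral>\<omega>. \<bar>X \<omega>\<bar> ^ j \<partial>M) \<le> 1 + (\<integral>\<omega>. X \<omega> ^ 4 \<partial>M)" using X4 by (simp add: prob_space)
qed

lemma (in prob_space) second_moment_le:
  fixes X :: "'a \<Rightarrow> real"
  assumes X: "X \<in> borel_measurable M" "integrable M (\<lambda>\<omega>. X \<omega> ^ 4)" "(\<integral>\<omega>. X \<omega> ^ 4 \<partial>M) \<le> s\<^sup>2" and s: "s > 0"
  shows "(\<integral>\<omega>. (X \<omega>)\<^sup>2 \<partial>M) \<le> s"
proof -
  have "(\<integral>\<omega>. (X \<omega>)\<^sup>2 \<partial>M) \<le> (\<integral>\<omega>. (X \<omega> ^ 4 / s + s) / 2 \<partial>M)"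
  proof (rule integral_mono)
    show "integrable M (\<lambda>\<omega>. (X \<omega>)\<^sup>2)" using integrable_power_le4(1)[OF X(1,2)] by simp
    show "(X \<omega>)\<^sup>2 \<le> (X \<omega> ^ 4 / s + s) / 2" for \<omega>
    proof -
      have "2 * (X \<omega>)\<^sup>2 * s \<le> ((X \<omega>)\<^sup>2)\<^sup>2 + s\<^sup>2" by (rule sum_squares_bound)
      then show ?thesis using s by (simp add: field_simps power2_eq_square power4_eq_xxxx)
    qed
  qed (use X in simp)
  also have "\<dots> = ((\<integral>\<omega>. X \<omega> ^ 4 \<partial>M) / s + s) / 2" using X(2) by (simp add: prob_space)
  also have "\<dots> \<le> (s\<^sup>2 / s + s) / 2" using X(3) s by (intro divide_right_mono add_right_mono) auto
  also have "\<dots> = s" using s by (simp add: power2_eq_square)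
  finally show ?thesis .
qed

text \<open>By independence and centring only even mixed moments survive:
\<open>E (S + x)\<^sup>4 = E S\<^sup>4 + 6 E S\<^sup>2 E x\<^sup>2 + E x\<^sup>4\<close>. The order \<open>n\<^sup>2\<close> of the bound, instead of \<open>n\<^sup>4\<close>, is what makes the
fourth moments of the normalised sums bounded.\<close>

lemma (in prob_space) sum_fourth_moment:
  fixes \<eta> :: "nat \<Rightarrow> 'a \<Rightarrow> real"
  assumes "indep_vars (\<lambda>_. borel) \<eta> {..<n}"
    and "\<And>k. k < n \<Longrightarrow> integrable M (\<lambda>\<omega>. \<eta> k \<omega> ^ 4)" "\<And>k. k < n \<Longrightarrow> (\<integral>\<omega>. \<eta> k \<omega> \<partial>M) = 0"
    and "\<And>k. k < n \<Longrightarrow> (\<integral>\<omega>. \<eta> k \<omega> ^ 4 \<partial>M) \<le> s\<^sup>2" and s: "s > 0"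
  shows "(\<lambda>\<omega>. \<Sum>k<n. \<eta> k \<omega>) \<in> borel_measurable M \<and> integrable M (\<lambda>\<omega>. (\<Sum>k<n. \<eta> k \<omega>) ^ 4) \<and>
    (\<integral>\<omega>. (\<Sum>k<n. \<eta> k \<omega>) \<partial>M) = 0 \<and> (\<integral>\<omega>. (\<Sum>k<n. \<eta> k \<omega>)\<^sup>2 \<partial>M) \<le> real n * s \<and>
    (\<integral>\<omega>. (\<Sum>k<n. \<eta> k \<omega>) ^ 4 \<partial>M) \<le> 3 * (real n)\<^sup>2 * s\<^sup>2"
  using assms(1-4)
proof (induction n)
  case 0
  then show ?case by simp
next
  case (Suc n)
  define S where "S \<omega> = (\<Sum>k<n. \<eta> k \<omega>)" for \<omega>
  define x where "x = \<eta> n"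
  have ind: "indep_vars (\<lambda>_. borel) \<eta> {..<n}" by (rule indep_vars_subset[OF Suc.prems(1)]) auto
  from Suc.IH[OF ind Suc.prems(2,3,4)] have
    S: "S \<in> borel_measurable M" "integrable M (\<lambda>\<omega>. S \<omega> ^ 4)" "(\<integral>\<omega>. S \<omega> \<partial>M) = 0" "(\<integral>\<omega>. (S \<omega>)\<^sup>2 \<partial>M) \<le> real n * s"
      "(\<integral>\<omega>. S \<omega> ^ 4 \<partial>M) \<le> 3 * (real n)\<^sup>2 * s\<^sup>2"
    by (auto simp: S_def[abs_def])
  have x: "x \<in> borel_measurable M" "integrable M (\<lambda>\<omega>. x \<omega> ^ 4)" "(\<integral>\<omega>. x \<omega> \<partial>M) = 0" "(\<integral>\<omega>. x \<omega> ^ 4 \<partial>M) \<le> s\<^sup>2"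
    using Suc.prems by (auto simp: x_def indep_vars_def2)
  have xS: "indep_var borel x borel S"
    unfolding x_def S_def[abs_def]
    by (rule indep_vars_sum) (use Suc.prems(1) in \<open>simp_all flip: lessThan_Suc\<close>)
  have cinner: "indep_var borel (\<lambda>\<omega>. x \<omega> ^ i) borel (\<lambda>\<omega>. S \<omega> ^ j)" for i j
    using indep_var_compose[OF xS, of "\<lambda>y. y ^ i" borel "\<lambda>y. y ^ j" borel] by (simp add: o_def)
  note xi = integrable_power_le4(1)[OF x(1,2)] and Si = integrable_power_le4(1)[OF S(1,2)]
  have ii: "integrable M (\<lambda>\<omega>. x \<omega> ^ i * S \<omega> ^ j)" "(\<integral>\<omega>. x \<omega> ^ i * S \<omega> ^ j \<partial>M) = (\<integral>\<omega>. x \<omega> ^ i \<partial>M) * (\<integral>\<omega>. S \<omega> ^ j \<partial>M)"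
    if "i \<le> 4" "j \<le> 4" for i j
    using indep_var_integrable[OF cinner xi[OF that(1)] Si[OF that(2)]]
      indep_var_lebesgue_integral[OF cinner xi[OF that(1)] Si[OF that(2)]] by auto
  have x2: "(\<integral>\<omega>. (x \<omega>)\<^sup>2 \<partial>M) \<le> s" using second_moment_le[OF x(1,2,4) s] .
  have sum: "(\<Sum>k<Suc n. \<eta> k \<omega>) = S \<omega> + x \<omega>" for \<omega> by (simp add: S_def x_def)
  have e2: "(S \<omega> + x \<omega>)\<^sup>2 = S \<omega> ^ 2 + 2 * (x \<omega> ^ 1 * S \<omega> ^ 1) + x \<omega> ^ 2" for \<omega> by (simp add: power2_sum)
  have e4: "(S \<omega> + x \<omega>) ^ 4 = S \<omega> ^ 4 + 4 * (x \<omega> ^ 1 * S \<omega> ^ 3) + 6 * (x \<omega> ^ 2 * S \<omega> ^ 2) + 4 * (x \<omega> ^ 3 * S \<omega> ^ 1) + x \<omega> ^ 4" for \<omega>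
    by (simp add: power2_eq_square power3_eq_cube power4_eq_xxxx algebra_simps)
  have 1: "(\<integral>\<omega>. S \<omega> + x \<omega> \<partial>M) = 0" using xi[of 1] Si[of 1] x(3) S(3) by simp
  have 2: "(\<integral>\<omega>. (S \<omega> + x \<omega>)\<^sup>2 \<partial>M) \<le> real (Suc n) * s"
  proof -
    have "(\<integral>\<omega>. (S \<omega> + x \<omega>)\<^sup>2 \<partial>M) = (\<integral>\<omega>. S \<omega> ^ 2 \<partial>M) + 2 * (\<integral>\<omega>. x \<omega> ^ 1 * S \<omega> ^ 1 \<partial>M) + (\<integral>\<omega>. x \<omega> ^ 2 \<partial>M)"
      unfolding e2 using ii(1)[of 1 1] xi[of 2] Si[of 2]
      by (subst Bochner_Integration.integral_add) (auto simp del: power_one_right)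
    then show ?thesis using x2 S(4) x(3) S(3) ii(2)[of 1 1] by (simp add: algebra_simps)
  qed
  have 3: "integrable M (\<lambda>\<omega>. (S \<omega> + x \<omega>) ^ 4)"
    unfolding e4 using ii(1)[of 1 3] ii(1)[of 2 2] ii(1)[of 3 1] S(2) x(2)
    by (intro Bochner_Integration.integrable_add integrable_mult_right) auto
  have 4: "(\<integral>\<omega>. (S \<omega> + x \<omega>) ^ 4 \<partial>M) \<le> 3 * (real (Suc n))\<^sup>2 * s\<^sup>2"
  proof -
    have "(\<integral>\<omega>. (S \<omega> + x \<omega>) ^ 4 \<partial>M) = (\<integral>\<omega>. S \<omega> ^ 4 \<partial>M) + 4 * (\<integral>\<omega>. x \<omega> ^ 1 * S \<omega> ^ 3 \<partial>M)
       + 6 * (\<integral>\<omega>. x \<omega> ^ 2 * S \<omega> ^ 2 \<partial>M) + 4 * (\<integral>\<omega>. x \<omega> ^ 3 * S \<omega> ^ 1 \<partial>M) + (\<integral>\<omega>. x \<omega> ^ 4 \<partial>M)"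
    proof -
      have "4 \<noteq> (0::real)" by simp
      then show ?thesis
        unfolding e4 using ii(1)[of 1 3] ii(1)[of 2 2] ii(1)[of 3 1] S(2) x(2)
        by (simp del: power_one_right)
    qed
    also have "\<dots> = (\<integral>\<omega>. S \<omega> ^ 4 \<partial>M) + 6 * ((\<integral>\<omega>. x \<omega> ^ 2 \<partial>M) * (\<integral>\<omega>. S \<omega> ^ 2 \<partial>M)) + (\<integral>\<omega>. x \<omega> ^ 4 \<partial>M)"
      using ii(2)[of 1 3] ii(2)[of 2 2] ii(2)[of 3 1] x(3) S(3) by simp
    also have "\<dots> \<le> 3 * (real n)\<^sup>2 * s\<^sup>2 + 6 * (s * (real n * s)) + s\<^sup>2"
    proof (intro add_mono mult_left_mono S(5) x(4))
      show "(\<integral>\<omega>. x \<omega> ^ 2 \<partial>M) * (\<integral>\<omega>. S \<omega> ^ 2 \<partial>M) \<le> s * (real n * s)"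
        using x2 S(4) s by (intro mult_mono) (auto intro: integral_nonneg)
    qed auto
    also have "\<dots> = (3 * (real n)\<^sup>2 + 6 * real n + 1) * s\<^sup>2" by (simp add: algebra_simps power2_eq_square)
    also have "\<dots> \<le> 3 * (real (Suc n))\<^sup>2 * s\<^sup>2" by (intro mult_right_mono) (auto simp: power2_eq_square algebra_simps)
    finally show ?thesis .
  qed
  show ?case unfolding sum using 1 2 3 4 S(1) x(1) by auto
qed


text \<open>Each of the \<open>n\<close> factors of the characteristic function differs from \<open>1 - \<sigma>\<^sup>2/(2n)\<close> by at most a sixth of the third
absolute moment of a normalised summand, which is of order \<open>n\<close> to the power \<open>-3/2\<close>.\<close>

lemma (in prob_space) char_normalised_sum:
  fixes \<eta> :: "nat \<Rightarrow> 'a \<Rightarrow> real"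
  assumes ind: "indep_vars (\<lambda>_. borel) \<eta> {..<n}" and n: "n > 0"
    and \<eta>4: "\<And>k. k < n \<Longrightarrow> integrable M (\<lambda>\<omega>. \<eta> k \<omega> ^ 4)" "\<And>k. k < n \<Longrightarrow> (\<integral>\<omega>. \<eta> k \<omega> ^ 4 \<partial>M) \<le> K"
    and \<eta>1: "\<And>k. k < n \<Longrightarrow> (\<integral>\<omega>. \<eta> k \<omega> \<partial>M) = 0" and \<eta>2: "\<And>k. k < n \<Longrightarrow> (\<integral>\<omega>. (\<eta> k \<omega>)\<^sup>2 \<partial>M) = \<sigma>2"
    and \<sigma>2: "0 \<le> \<sigma>2" "\<sigma>2 \<le> 2 * real n"
  shows "cmod (char (distr M borel (\<lambda>\<omega>. (\<Sum>k<n. \<eta> k \<omega>) / sqrt (real n))) 1 - of_real ((1 - \<sigma>2 / 2 / real n) ^ n))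
     \<le> (1 + K) / (6 * sqrt (real n))"
proof -
  define \<phi> where "\<phi> k = char (distr M borel (\<lambda>\<omega>. \<eta> k \<omega> / sqrt (real n))) 1" for k
  define z where "z = complex_of_real (1 - \<sigma>2 / 2 / real n)"
  have \<eta>m: "\<eta> k \<in> borel_measurable M" if "k < n" for k using ind that by (auto simp: indep_vars_def2)
  have rd: "real_distribution (distr M borel (\<lambda>\<omega>. \<eta> k \<omega> / sqrt (real n)))" if "k < n" for k
    using \<eta>m[OF that] by (intro real_distribution_distr) auto
  have ind': "indep_vars (\<lambda>_. borel) (\<lambda>k \<omega>. \<eta> k \<omega> / sqrt (real n)) {..<n}"
    by (rule indep_vars_compose2[OF ind, of "\<lambda>_ x. x / sqrt (real n)"]) simp
  have prod: "char (distr M borel (\<lambda>\<omega>. (\<Sum>k<n. \<eta> k \<omega>) / sqrt (real n))) 1 = (\<Prod>k<n. \<phi> k)"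
    unfolding \<phi>_def char_distr_sum[OF ind', symmetric] by (simp add: sum_divide_distrib)
  have "cmod ((\<Prod>k<n. \<phi> k) - (\<Prod>k<n. z)) \<le> (\<Sum>k<n. cmod (\<phi> k - z))"
  proof (rule norm_prod_diff)
    show "cmod (\<phi> k) \<le> 1" if "k \<in> {..<n}" for k
      unfolding \<phi>_def using real_distribution.cmod_char_le_1[OF rd] that by simp
    have "\<bar>1 - \<sigma>2 / 2 / real n\<bar> \<le> 1" using \<sigma>2 n by (simp add: abs_le_iff field_simps)
    then show "cmod z \<le> 1" unfolding z_def norm_of_real .
  qed
  also have "\<dots> \<le> (\<Sum>k<n. (1 + K) / (6 * (real n * sqrt (real n))))"
  proof (rule sum_mono)
    fix k assume "k \<in> {..<n}"
    then have k: "k < n" by simp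
    define X where "X \<omega> = \<eta> k \<omega> / sqrt (real n)" for \<omega>
    have Xm[measurable]: "X \<in> borel_measurable M" unfolding X_def[abs_def] using \<eta>m[OF k] by simp
    note i = integrable_power_le4[OF \<eta>m[OF k] \<eta>4(1)[OF k]]
    have X2: "integrable M (\<lambda>\<omega>. (X \<omega>)\<^sup>2)" "integrable M X" "expectation X = 0"
      using i(1)[of 2] i(1)[of 1] \<eta>1[OF k] by (auto simp: X_def[abs_def] power_divide)
    have var: "variance X = \<sigma>2 / real n"
      using \<eta>2[OF k] i(1)[of 2] unfolding X2(3) by (simp add: X_def[abs_def] power_divide)
    have "cmod (\<phi> k - z) = cmod (char (distr M borel X) 1 - (1 - 1\<^sup>2 * (\<sigma>2 / real n) / 2))"
      by (simp add: \<phi>_def z_def X_def[abs_def] mult.commute)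
    also have "\<dots> \<le> (1\<^sup>2 / 6) * expectation (\<lambda>x. min (6 * (X x)\<^sup>2) (\<bar>1\<bar> * \<bar>X x\<bar> ^ 3))"
      by (rule char_approx3'[OF Xm X2(2,1,3) var refl])
    also have "\<dots> \<le> (1 / 6) * expectation (\<lambda>x. \<bar>\<eta> k x\<bar> ^ 3 / (real n * sqrt (real n)))"
    proof -
      have X3: "\<bar>X x\<bar> ^ 3 = \<bar>\<eta> k x\<bar> ^ 3 / (real n * sqrt (real n))" for x
        using n by (simp add: X_def power_divide power3_eq_cube)
      have i3: "integrable M (\<lambda>x. \<bar>X x\<bar> ^ 3)" unfolding X3 using i(2)[of 3] by simp
      have "expectation (\<lambda>x. min (6 * (X x)\<^sup>2) (\<bar>1\<bar> * \<bar>X x\<bar> ^ 3)) \<le> expectation (\<lambda>x. \<bar>X x\<bar> ^ 3)"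
        using X2(1) i3 by (intro integral_mono integrable_min) auto
      then show ?thesis unfolding X3 by simp
    qed
    also have "\<dots> = (1 / 6) * (expectation (\<lambda>x. \<bar>\<eta> k x\<bar> ^ 3) / (real n * sqrt (real n)))"
      by simp
    also have "\<dots> \<le> (1 / 6) * ((1 + K) / (real n * sqrt (real n)))"
      using i(3)[of 3] \<eta>4(2)[OF k] by (intro mult_left_mono divide_right_mono) auto
    finally show "cmod (\<phi> k - z) \<le> (1 + K) / (6 * (real n * sqrt (real n)))" by simp
  qed
  also have "\<dots> = (1 + K) / (6 * sqrt (real n))" using n by simp
  finally show ?thesis unfolding prod z_def by simp
qed

text \<open>The summands of row \<open>n\<close> live on a probability space of their own, and they need not be identically distributed: equal
variances and a common bound on the fourth moments are enough.\<close>

theorem lyapunov_triangular_array: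
  fixes P :: "nat \<Rightarrow> 'a measure" and \<eta> :: "nat \<Rightarrow> nat \<Rightarrow> 'a \<Rightarrow> real"
  assumes P: "\<And>n. n \<ge> n0 \<Longrightarrow> prob_space (P n)"
    and ind: "\<And>n. n \<ge> n0 \<Longrightarrow> prob_space.indep_vars (P n) (\<lambda>_. borel) (\<eta> n) {..<n}"
    and \<eta>4: "\<And>n k. n \<ge> n0 \<Longrightarrow> k < n \<Longrightarrow> integrable (P n) (\<lambda>\<omega>. \<eta> n k \<omega> ^ 4)" "\<And>n k. n \<ge> n0 \<Longrightarrow> k < n \<Longrightarrow> (\<integral>\<omega>. \<eta> n k \<omega> ^ 4 \<partial>P n) \<le> K"
    and \<eta>1: "\<And>n k. n \<ge> n0 \<Longrightarrow> k < n \<Longrightarrow> (\<integral>\<omega>. \<eta> n k \<omega> \<partial>P n) = 0"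
    and \<eta>2: "\<And>n k. n \<ge> n0 \<Longrightarrow> k < n \<Longrightarrow> (\<integral>\<omega>. (\<eta> n k \<omega>)\<^sup>2 \<partial>P n) = \<sigma>2" and \<sigma>2: "\<sigma>2 \<ge> 0"
  shows "(\<lambda>n. \<integral>\<omega>. cos ((\<Sum>k<n. \<eta> n k \<omega>) / sqrt (real n) + \<theta>) \<partial>P n) \<longlonglongrightarrow> exp (- \<sigma>2 / 2) * cos \<theta>"
proof -
  define \<phi> where "\<phi> n = char (distr (P n) borel (\<lambda>\<omega>. (\<Sum>k<n. \<eta> n k \<omega>) / sqrt (real n))) 1" for n
  define n1 where "n1 = max n0 (Suc (nat \<lceil>\<sigma>2\<rceil>))"
  have n1: "n \<ge> n0" "n > 0" "\<sigma>2 \<le> 2 * real n" if "n \<ge> n1" for n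
  proof -
    show "n \<ge> n0" "n > 0" using that by (auto simp: n1_def)
    have "\<sigma>2 \<le> real (nat \<lceil>\<sigma>2\<rceil>)" by linarith
    moreover have "nat \<lceil>\<sigma>2\<rceil> \<le> n" using that unfolding n1_def by (meson Suc_leD max.boundedE)
    ultimately have "\<sigma>2 \<le> real n" by linarith
    then show "\<sigma>2 \<le> 2 * real n" by simp
  qed
  have est: "cmod (\<phi> n - of_real ((1 - \<sigma>2 / 2 / real n) ^ n)) \<le> (1 + K) / (6 * sqrt (real n))" if "n \<ge> n1" for n
    unfolding \<phi>_def
    by (rule prob_space.char_normalised_sum[OF P ind]) (use n1[OF that] \<eta>4 \<eta>1 \<eta>2 \<sigma>2 in auto)
  have "(\<lambda>n. (1 + K) / (6 * sqrt (real n))) \<longlonglongrightarrow> 0" by real_asymp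
  then have "(\<lambda>n. \<phi> n - of_real ((1 - \<sigma>2 / 2 / real n) ^ n)) \<longlonglongrightarrow> 0"
    by (rule Lim_null_comparison[rotated]) (use est in \<open>auto simp: eventually_sequentially\<close>)
  moreover have "(\<lambda>n. (1 + (- \<sigma>2 / 2) / real n) ^ n) \<longlonglongrightarrow> exp (- \<sigma>2 / 2)"
    by (rule tendsto_exp_limit_sequentially)
  then have "(\<lambda>n. complex_of_real ((1 - \<sigma>2 / 2 / real n) ^ n)) \<longlonglongrightarrow> of_real (exp (- \<sigma>2 / 2))"
    by (intro tendsto_of_real) (simp add: minus_divide_left[symmetric])
  ultimately have "(\<lambda>n. (\<phi> n - of_real ((1 - \<sigma>2 / 2 / real n) ^ n)) + of_real ((1 - \<sigma>2 / 2 / real n) ^ n)) \<longlonglongrightarrow> 0 + of_real (exp (- \<sigma>2 / 2))"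
    by (rule tendsto_add)
  then have "\<phi> \<longlonglongrightarrow> of_real (exp (- \<sigma>2 / 2))" by simp
  then have "(\<lambda>n. Re (cis \<theta> * \<phi> n)) \<longlonglongrightarrow> Re (cis \<theta> * of_real (exp (- \<sigma>2 / 2)))"
    by (intro tendsto_intros)
  then have lim: "(\<lambda>n. Re (cis \<theta> * \<phi> n)) \<longlonglongrightarrow> exp (- \<sigma>2 / 2) * cos \<theta>" by (simp add: mult.commute)
  have "eventually (\<lambda>n. Re (cis \<theta> * \<phi> n) = (\<integral>\<omega>. cos ((\<Sum>k<n. \<eta> n k \<omega>) / sqrt (real n) + \<theta>) \<partial>P n)) sequentially"
    using eventually_ge_at_top[of n0]
  proof eventually_elim
    case (elim n)
    interpret prob_space "P n" using P elim by simp
    have "\<eta> n k \<in> borel_measurable (P n)" if "k < n" for k using ind[OF elim] that by (auto simp: indep_vars_def2)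
    then have "(\<lambda>\<omega>. (\<Sum>k<n. \<eta> n k \<omega>) / sqrt (real n)) \<in> borel_measurable (P n)" by simp
    from expectation_cos_char[OF this] show ?case by (simp add: \<phi>_def)
  qed
  then show ?thesis by (rule Lim_transform_eventually[OF lim])
qed

section \<open>Quadratic functionals of Brownian motions\<close>

definition bm_family :: "'a measure \<Rightarrow> ('i \<Rightarrow> real \<Rightarrow> 'a \<Rightarrow> real) \<Rightarrow> 'i set \<Rightarrow> bool" where
  "bm_family P \<beta> I \<longleftrightarrow> prob_space P \<and> (\<forall>p\<in>I. standard_BM P (\<beta> p)) \<and> independent_processes P \<beta> I"

lemma bm_family_reindex:
  assumes "bm_family P \<beta> I" "inj_on h J" "h ` J \<subseteq> I"
  shows "bm_family P (\<lambda>j. \<beta> (h j)) J"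
  using assms prob_space.indep_vars_reindex[of P "\<lambda>_. trajectory_space" "\<lambda>i. trajectory (\<beta> i)" I h J]
  by (auto simp: bm_family_def independent_processes_def)

lemma trajectory_apply: "t \<ge> 0 \<Longrightarrow> trajectory Z \<omega> t = Z t \<omega>"
  by (simp add: trajectory_def)

lemma bm_increments:
  assumes fam: "bm_family P \<beta> J" and \<tau>: "0 \<le> \<tau> 0" "\<And>m. m < n \<Longrightarrow> \<tau> m < \<tau> (Suc m)"
  shows "prob_space.indep_vars P (\<lambda>_. borel)
      (\<lambda>(p, m) \<omega>. \<beta> p (\<tau> (Suc m)) \<omega> - \<beta> p (\<tau> m) \<omega>) (J \<times> {..<n::nat})"
    "\<And>p m. p \<in> J \<Longrightarrow> m < n \<Longrightarrow>
      distributed P lborel (\<lambda>\<omega>. \<beta> p (\<tau> (Suc m)) \<omega> - \<beta> p (\<tau> m) \<omega>) (normal_density 0 (sqrt (\<tau> (Suc m) - \<tau> m)))"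
proof -
  interpret prob_space P using fam by (simp add: bm_family_def)
  have bm: "standard_BM P (\<beta> p)" if "p \<in> J" for p using fam that by (simp add: bm_family_def)
  have pos: "0 \<le> \<tau> m" if "m \<le> n" for m
    using that
  proof (induction m)
    case (Suc m)
    then show ?case using \<tau>(2)[of m] by simp
  qed (use \<tau> in auto)
  have "indep_vars (\<lambda>(p, m). borel) (\<lambda>(p, m) \<omega>. trajectory (\<beta> p) \<omega> (\<tau> (Suc m)) - trajectory (\<beta> p) \<omega> (\<tau> m)) (SIGMA p:J. {..<n})"
  proof (rule indep_vars_Sigma[where g = "\<lambda>p m (z :: real \<Rightarrow> real). z (\<tau> (Suc m)) - z (\<tau> m)" and X = "\<lambda>p. trajectory (\<beta> p)"])
    show "indep_vars (\<lambda>_. trajectory_space) (\<lambda>p. trajectory (\<beta> p)) J"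
      using fam by (simp add: bm_family_def independent_processes_def)
    show "(\<lambda>z :: real \<Rightarrow> real. z (\<tau> (Suc m)) - z (\<tau> m)) \<in> borel_measurable trajectory_space" if "m \<in> {..<n}" for m
      using that pos[of m] pos[of "Suc m"] by (intro borel_measurable_diff measurable_component_singleton) auto
    show "indep_vars (\<lambda>_. borel) (\<lambda>m \<omega>. trajectory (\<beta> p) \<omega> (\<tau> (Suc m)) - trajectory (\<beta> p) \<omega> (\<tau> m)) {..<n}" if "p \<in> J" for p
    proof (rule indep_vars_cong_space)
      show "indep_vars (\<lambda>_. borel) (\<lambda>m \<omega>. \<beta> p (\<tau> (Suc m)) \<omega> - \<beta> p (\<tau> m) \<omega>) {..<n}"
        using bm[OF that] \<tau> by (simp add: standard_BM_def)
    qed (use pos in \<open>auto simp: trajectory_apply\<close>)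
  qed
  then have "indep_vars (\<lambda>_. borel) (\<lambda>(p, m) \<omega>. trajectory (\<beta> p) \<omega> (\<tau> (Suc m)) - trajectory (\<beta> p) \<omega> (\<tau> m)) (J \<times> {..<n})"
    by (simp add: case_prod_beta')
  then show "indep_vars (\<lambda>_. borel) (\<lambda>(p, m) \<omega>. \<beta> p (\<tau> (Suc m)) \<omega> - \<beta> p (\<tau> m) \<omega>) (J \<times> {..<n})"
    by (rule indep_vars_cong_space) (use pos in \<open>auto simp: trajectory_apply\<close>)
  show "distributed P lborel (\<lambda>\<omega>. \<beta> p (\<tau> (Suc m)) \<omega> - \<beta> p (\<tau> m) \<omega>) (normal_density 0 (sqrt (\<tau> (Suc m) - \<tau> m)))"
    if "p \<in> J" "m < n" for p m
    using bm[OF that(1)] \<tau>(2)[OF that(2)] pos[of m] that(2) by (simp add: standard_BM_def)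
qed

text \<open>The pairs \<open>(m, m')\<close> with maximum \<open>m\<close> contribute \<open>2 \<tau>\<^sub>m h\<^sub>m + h\<^sub>m\<^sup>2 = \<tau>\<^bsub>m+1\<^esub>\<^sup>2 - \<tau>\<^sub>m\<^sup>2\<close>, where
\<open>h\<^sub>m = \<tau>\<^bsub>m+1\<^esub> - \<tau>\<^sub>m\<close>. This is where the clock \<open>t\<^sup>2\<close> of the limit comes from.\<close>

lemma sum_max_telescope:
  fixes \<tau> :: "nat \<Rightarrow> real"
  assumes "\<tau> 0 = 0"
  shows "(\<Sum>m<n. \<Sum>m'<n. a (max m m') * ((\<tau> (Suc m) - \<tau> m) * (\<tau> (Suc m') - \<tau> m'))) = (\<Sum>m<n. a m * ((\<tau> (Suc m))\<^sup>2 - (\<tau> m)\<^sup>2))"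
proof (induction n)
  case (Suc n)
  define h where "h m = \<tau> (Suc m) - \<tau> m" for m
  have s: "(\<Sum>m<n. h m) = \<tau> n" using assms by (simp add: h_def sum_lessThan_telescope)
  have "(\<Sum>m<Suc n. \<Sum>m'<Suc n. a (max m m') * (h m * h m'))
     = (\<Sum>m<n. \<Sum>m'<n. a (max m m') * (h m * h m')) + (\<Sum>m<n. a (max m n) * (h m * h n))
       + ((\<Sum>m'<n. a (max n m') * (h n * h m')) + a n * (h n * h n))"
    by (simp add: sum.distrib)
  also have "(\<Sum>m<n. a (max m n) * (h m * h n)) = (\<Sum>m<n. h m) * (a n * h n)"
    unfolding sum_distrib_right by (intro sum.cong) (auto simp: max_absorb2 mult_ac)
  also have "(\<Sum>m'<n. a (max n m') * (h n * h m')) = (\<Sum>m<n. h m) * (a n * h n)"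
    unfolding sum_distrib_right by (intro sum.cong) (auto simp: max_absorb1 mult_ac)
  finally show ?case
    unfolding s using Suc.IH by (simp add: h_def power2_eq_square algebra_simps)
qed simp

text \<open>Writing \<open>\<beta>\<^sub>p(\<tau>\<^sub>l)\<close> as the sum of its increments before \<open>\<tau>\<^sub>l\<close>, the increments numbered \<open>m\<close> and \<open>m'\<close> both occur in it exactly if
\<open>max m m' < l\<close>. So \<open>\<Phi>\<close> is a quadratic form in the normalised increments whose coefficients are \<open>T (max m m')\<close>, up to the
square roots of the lengths of the time intervals.\<close>

lemma bm_quadratic:
  fixes S :: "nat \<Rightarrow> 'i \<Rightarrow> 'i \<Rightarrow> real" and \<tau> :: "nat \<Rightarrow> real"
  assumes fam: "bm_family P \<beta> J" and J: "finite J" and \<tau>: "\<tau> 0 = 0" "\<And>m. m < n \<Longrightarrow> \<tau> m < \<tau> (Suc m)"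
    and sym: "\<And>l p q. S l p q = S l q p"
  defines "T \<equiv> \<lambda>m p q. \<Sum>l\<in>{m<..n}. S l p q"
  defines "\<Phi> \<equiv> \<lambda>\<omega>. \<Sum>l\<le>n. \<Sum>p\<in>J. \<Sum>q\<in>J. S l p q * (\<beta> p (\<tau> l) \<omega> * \<beta> q (\<tau> l) \<omega> - (if p = q then \<tau> l else 0))"
  shows "\<Phi> \<in> borel_measurable P" "(\<integral>\<omega>. \<Phi> \<omega> \<partial>P) = 0"
    "(\<integral>\<omega>. (\<Phi> \<omega>)\<^sup>2 \<partial>P) = 2 * (\<Sum>m<n. (\<Sum>p\<in>J. \<Sum>q\<in>J. (T m p q)\<^sup>2) * ((\<tau> (Suc m))\<^sup>2 - (\<tau> m)\<^sup>2))"
    "integrable P (\<lambda>\<omega>. \<Phi> \<omega> ^ 4)"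
    "(\<integral>\<omega>. \<Phi> \<omega> ^ 4 \<partial>P) \<le> 1688 * real (card J * n) ^ 6 *
       (\<Sum>p\<in>J. \<Sum>q\<in>J. \<Sum>m<n. \<Sum>m'<n. T (max m m') p q ^ 4 * ((\<tau> (Suc m) - \<tau> m)\<^sup>2 * (\<tau> (Suc m') - \<tau> m')\<^sup>2))"
proof -
  interpret prob_space P using fam by (simp add: bm_family_def)
  define h where "h m = \<tau> (Suc m) - \<tau> m" for m
  have h: "h m > 0" if "m < n" for m using \<tau>(2)[OF that] by (simp add: h_def)
  define A where "A = J \<times> {..<n}"
  have A: "finite A" using J by (simp add: A_def)
  define g where "g a \<omega> = (\<beta> (fst a) (\<tau> (Suc (snd a))) \<omega> - \<beta> (fst a) (\<tau> (snd a)) \<omega>) / sqrt (h (snd a))" for a \<omega>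
  define C where "C a b = T (max (snd a) (snd b)) (fst a) (fst b) * (sqrt (h (snd a)) * sqrt (h (snd b)))" for a b
  have T_sym: "T m p q = T m q p" for m p q unfolding T_def using sym by (intro sum.cong) auto
  have C_sym: "C a b = C b a" for a b
    unfolding C_def using T_sym[of _ "fst a" "fst b"] by (simp add: max.commute mult.commute)
  have \<tau>0: "0 \<le> \<tau> 0" using \<tau>(1) by simp
  have "indep_vars (\<lambda>_. borel) (\<lambda>a \<omega>. (case a of (p, m) \<Rightarrow> \<lambda>\<omega>. \<beta> p (\<tau> (Suc m)) \<omega> - \<beta> p (\<tau> m) \<omega>) \<omega> / sqrt (h (snd a))) A"
    unfolding A_def by (rule indep_vars_compose2[OF bm_increments(1)[OF fam \<tau>0 \<tau>(2)], where Y = "\<lambda>a x. x / sqrt (h (snd a))"]) auto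
  then have ind: "indep_vars (\<lambda>_. borel) g A"
    by (simp add: g_def[abs_def] case_prod_beta')
  have normal: "distributed P lborel (g a) (normal_density 0 (sqrt 1))" if "a \<in> A" for a
  proof -
    define p m where "p = fst a" and "m = snd a"
    have a: "a = (p, m)" "p \<in> J" "m < n" using that by (auto simp: A_def p_def m_def)
    have "distributed P lborel (\<lambda>\<omega>. \<beta> p (\<tau> (Suc m)) \<omega> - \<beta> p (\<tau> m) \<omega>) (normal_density 0 (sqrt (h m)))"
      unfolding h_def by (rule bm_increments(2)[OF fam \<tau>0 \<tau>(2) a(2,3)])
    then have "distributed P lborel (\<lambda>\<omega>. 0 + (1 / sqrt (h m)) * (\<beta> p (\<tau> (Suc m)) \<omega> - \<beta> p (\<tau> m) \<omega>))
       (normal_density (0 + (1 / sqrt (h m)) * 0) (\<bar>1 / sqrt (h m)\<bar> * sqrt (h m)))"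
      using h[OF a(3)] by (intro normal_density_affine) auto
    then show ?thesis using h[OF a(3)] by (simp add: a(1) g_def[abs_def])
  qed
  define Q where "Q \<omega> = (\<Sum>a\<in>A. \<Sum>b\<in>A. C a b * (g a \<omega> * g b \<omega> - (if a = b then 1 else 0)))" for \<omega>
  note QF = gaussian_quadratic_form[where g = g and A = A and v = 1 and C = C, OF ind A]
  have Q1: "Q \<in> borel_measurable P"
    unfolding Q_def[abs_def] by (rule QF(1)) (use normal C_sym in simp_all)
  have Q2: "(\<integral>\<omega>. Q \<omega> \<partial>P) = 0"
    unfolding Q_def[abs_def] by (rule QF(2)) (use normal C_sym in simp_all)
  have Q3: "(\<integral>\<omega>. (Q \<omega>)\<^sup>2 \<partial>P) = 2 * 1\<^sup>2 * (\<Sum>a\<in>A. \<Sum>b\<in>A. (C a b)\<^sup>2)"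
    unfolding Q_def[abs_def] by (rule QF(3)) (use normal C_sym in simp_all)
  have Q4: "integrable P (\<lambda>\<omega>. Q \<omega> ^ 4)"
    unfolding Q_def[abs_def] by (rule QF(4)) (use normal C_sym in simp_all)
  have Q5: "(\<integral>\<omega>. Q \<omega> ^ 4 \<partial>P) \<le> real (card (A \<times> A)) ^ 3 * (\<Sum>(a, b)\<in>A \<times> A. C a b ^ 4) * (1688 * 1 ^ 4)"
    unfolding Q_def[abs_def] by (rule QF(5)) (use normal C_sym in simp_all)
  note Q = Q1 Q2 Q3 Q4 Q5
  have eq: "\<Phi> \<omega> = Q \<omega>" if \<omega>: "\<omega> \<in> space P" for \<omega>
  proof -
    define u where "u p m = sqrt (h m) * g (p, m) \<omega>" for p m
    have u: "u p m = \<beta> p (\<tau> (Suc m)) \<omega> - \<beta> p (\<tau> m) \<omega>" if "m < n" for p m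
      using h[OF that] by (simp add: u_def g_def)
    have \<beta>: "\<beta> p (\<tau> l) \<omega> = (\<Sum>m<n. of_bool (m < l) * u p m)" if "p \<in> J" "l \<le> n" for p l
    proof -
      have "\<beta> p (\<tau> 0) \<omega> = 0" using fam that \<omega> \<tau>(1) by (simp add: bm_family_def standard_BM_def)
      then have "\<beta> p (\<tau> l) \<omega> = (\<Sum>m<l. \<beta> p (\<tau> (Suc m)) \<omega> - \<beta> p (\<tau> m) \<omega>)"
        using sum_lessThan_telescope[of "\<lambda>m. \<beta> p (\<tau> m) \<omega>" l] by simp
      also have "\<dots> = (\<Sum>m<l. u p m)" using u that by (intro sum.cong) auto
      also have "\<dots> = (\<Sum>m<n. of_bool (m < l) * u p m)"
        using that by (intro sum.mono_neutral_cong_left) auto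
      finally show ?thesis .
    qed
    have \<tau>l: "\<tau> l = (\<Sum>m<n. of_bool (m < l) * h m)" if "l \<le> n" for l
    proof -
      have "\<tau> l = (\<Sum>m<l. h m)" using \<tau>(1) by (simp add: h_def sum_lessThan_telescope)
      also have "\<dots> = (\<Sum>m<n. of_bool (m < l) * h m)"
        using that by (intro sum.mono_neutral_cong_left) auto
      finally show ?thesis .
    qed
    define G where "G p q m m' = u p m * u q m' - (if p = q \<and> m = m' then h m else 0)" for p q m m'
    have summand: "\<beta> p (\<tau> l) \<omega> * \<beta> q (\<tau> l) \<omega> - (if p = q then \<tau> l else 0)
       = (\<Sum>m<n. \<Sum>m'<n. of_bool (max m m' < l) * G p q m m')" if "p \<in> J" "q \<in> J" "l \<le> n" for p q l
    proof -
      have 1: "\<beta> p (\<tau> l) \<omega> * \<beta> q (\<tau> l) \<omega> = (\<Sum>m<n. \<Sum>m'<n. of_bool (max m m' < l) * (u p m * u q m'))"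
        unfolding \<beta>[OF that(1,3)] \<beta>[OF that(2,3)] sum_product
        by (intro sum.cong refl) (auto simp: of_bool_def)
      have 2: "(\<Sum>m<n. \<Sum>m'<n. of_bool (max m m' < l) * (if m = m' then h m else 0)) = \<tau> l"
        unfolding \<tau>l[OF that(3)]
      proof (rule sum.cong[OF refl])
        fix m assume m: "m \<in> {..<n}"
        have "(\<Sum>m'<n. of_bool (max m m' < l) * (if m = m' then h m else 0)) = (\<Sum>m'<n. if m = m' then of_bool (m < l) * h m else 0)"
          by (intro sum.cong) auto
        then show "(\<Sum>m'<n. of_bool (max m m' < l) * (if m = m' then h m else 0)) = of_bool (m < l) * h m"
          using m by simp
      qed
      have "(\<Sum>m<n. \<Sum>m'<n. of_bool (max m m' < l) * G p q m m') = (\<Sum>m<n. \<Sum>m'<n. of_bool (max m m' < l) * (u p m * u q m'))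
         - (\<Sum>m<n. \<Sum>m'<n. of_bool (max m m' < l) * (if p = q \<and> m = m' then h m else 0))"
        by (simp add: G_def right_diff_distrib sum_subtractf)
      then show ?thesis using 1 2 by (cases "p = q") auto
    qed
    have "\<Phi> \<omega> = (\<Sum>l\<le>n. \<Sum>p\<in>J. \<Sum>q\<in>J. S l p q * (\<Sum>m<n. \<Sum>m'<n. of_bool (max m m' < l) * G p q m m'))"
      unfolding \<Phi>_def by (intro sum.cong refl arg_cong2[where f = "(*)"] summand) auto
    also have "\<dots> = (\<Sum>p\<in>J. \<Sum>q\<in>J. \<Sum>m<n. \<Sum>m'<n. \<Sum>l\<le>n. S l p q * (of_bool (max m m' < l) * G p q m m'))"
      unfolding sum_distrib_left
      apply (subst sum.swap, rule sum.cong[OF refl])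
      apply (subst sum.swap, rule sum.cong[OF refl])
      apply (subst sum.swap, rule sum.cong[OF refl])
      apply (subst sum.swap, rule sum.cong[OF refl])
      apply (rule refl)
      done
    also have "\<dots> = (\<Sum>p\<in>J. \<Sum>q\<in>J. \<Sum>m<n. \<Sum>m'<n. T (max m m') p q * G p q m m')"
    proof (intro sum.cong refl)
      fix p q m m' assume "m \<in> {..<n}" "m' \<in> {..<n}"
      have "(\<Sum>l\<le>n. S l p q * (of_bool (max m m' < l) * G p q m m')) = (\<Sum>l\<in>{max m m'<..n}. S l p q * G p q m m')"
        by (rule sum.mono_neutral_cong_right) auto
      then show "(\<Sum>l\<le>n. S l p q * (of_bool (max m m' < l) * G p q m m')) = T (max m m') p q * G p q m m'"
        by (simp add: T_def sum_distrib_right)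
    qed
    also have "\<dots> = (\<Sum>p\<in>J. \<Sum>m<n. \<Sum>q\<in>J. \<Sum>m'<n. T (max m m') p q * G p q m m')"
      by (rule sum.cong[OF refl], rule sum.swap)
    also have "\<dots> = (\<Sum>p\<in>J. \<Sum>m<n. \<Sum>q\<in>J. \<Sum>m'<n. C (p, m) (q, m') * (g (p, m) \<omega> * g (q, m') \<omega> - (if (p, m) = (q, m') then 1 else 0)))"
    proof (intro sum.cong refl)
      fix p m q m' assume m: "m \<in> {..<n}" "m' \<in> {..<n}"
      show "T (max m m') p q * G p q m m' = C (p, m) (q, m') * (g (p, m) \<omega> * g (q, m') \<omega> - (if (p, m) = (q, m') then 1 else 0))"
      proof -
        define \<delta> where "\<delta> = (if p = q \<and> m = m' then 1 else (0::real))"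
        have 1: "(if (p, m) = (q, m') then 1 else (0::real)) = \<delta>" by (simp add: \<delta>_def)
        have 2: "(if p = q \<and> m = m' then h m else 0) = \<delta> * (sqrt (h m) * sqrt (h m'))"
        proof (cases "p = q \<and> m = m'")
          case True
          then show ?thesis using h[of m] m by (simp add: \<delta>_def)
        next
          case False
          then have "\<delta> = 0" unfolding \<delta>_def by (rule if_not_P)
          then show ?thesis unfolding if_not_P[OF False] by simp
        qed
        show ?thesis unfolding C_def G_def u_def 1 2 by (simp add: algebra_simps)
      qed
    qed
    also have "\<dots> = Q \<omega>" by (simp add: Q_def A_def sum.cartesian_product')
    finally show ?thesis .
  qed
  have Qm: "Q \<in> borel_measurable P" using Q(1) by simp
  then show "\<Phi> \<in> borel_measurable P" using eq by (subst measurable_cong[where g = Q]) auto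
  have int: "(\<integral>\<omega>. f (\<Phi> \<omega>) \<partial>P) = (\<integral>\<omega>. f (Q \<omega>) \<partial>P)" for f :: "real \<Rightarrow> real"
    using eq by (intro Bochner_Integration.integral_cong) auto
  show "(\<integral>\<omega>. \<Phi> \<omega> \<partial>P) = 0" using int[of "\<lambda>x. x"] Q(2) by simp
  have "(\<integral>\<omega>. (\<Phi> \<omega>)\<^sup>2 \<partial>P) = 2 * (\<Sum>a\<in>A. \<Sum>b\<in>A. (C a b)\<^sup>2)" using int[of "\<lambda>x. x\<^sup>2"] Q(3) by simp
  also have "(\<Sum>a\<in>A. \<Sum>b\<in>A. (C a b)\<^sup>2) = (\<Sum>p\<in>J. \<Sum>m<n. \<Sum>q\<in>J. \<Sum>m'<n. (C (p, m) (q, m'))\<^sup>2)"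
    by (simp add: A_def sum.cartesian_product')
  also have "\<dots> = (\<Sum>p\<in>J. \<Sum>m<n. \<Sum>q\<in>J. \<Sum>m'<n. (T (max m m') p q)\<^sup>2 * (h m * h m'))"
    using h by (intro sum.cong refl) (simp add: C_def power_mult_distrib order_less_imp_le)
  also have "\<dots> = (\<Sum>p\<in>J. \<Sum>q\<in>J. \<Sum>m<n. \<Sum>m'<n. (T (max m m') p q)\<^sup>2 * (h m * h m'))"
    by (rule sum.cong[OF refl], rule sum.swap)
  also have "\<dots> = (\<Sum>p\<in>J. \<Sum>q\<in>J. \<Sum>m<n. (T m p q)\<^sup>2 * ((\<tau> (Suc m))\<^sup>2 - (\<tau> m)\<^sup>2))"
    unfolding h_def
    by (rule sum.cong[OF refl], rule sum.cong[OF refl])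
      (rule sum_max_telescope[where \<tau> = \<tau> and a = "\<lambda>m. (T m _ _)\<^sup>2", OF \<tau>(1)])
  also have "\<dots> = (\<Sum>m<n. (\<Sum>p\<in>J. \<Sum>q\<in>J. (T m p q)\<^sup>2) * ((\<tau> (Suc m))\<^sup>2 - (\<tau> m)\<^sup>2))"
    unfolding sum_distrib_right
    by (rule trans[OF sum.cong[OF refl sum.swap] sum.swap])
  finally show "(\<integral>\<omega>. (\<Phi> \<omega>)\<^sup>2 \<partial>P) = 2 * (\<Sum>m<n. (\<Sum>p\<in>J. \<Sum>q\<in>J. (T m p q)\<^sup>2) * ((\<tau> (Suc m))\<^sup>2 - (\<tau> m)\<^sup>2))" .
  show "integrable P (\<lambda>\<omega>. \<Phi> \<omega> ^ 4)"
    using Q(4) eq by (subst Bochner_Integration.integrable_cong[where g = "\<lambda>\<omega>. Q \<omega> ^ 4"]) auto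
  have "(\<integral>\<omega>. \<Phi> \<omega> ^ 4 \<partial>P) \<le> real (card (A \<times> A)) ^ 3 * (\<Sum>(a, b)\<in>A \<times> A. C a b ^ 4) * 1688"
    using int[of "\<lambda>x. x ^ 4"] Q(5) by simp
  also have "(\<Sum>(a, b)\<in>A \<times> A. C a b ^ 4) = (\<Sum>p\<in>J. \<Sum>m<n. \<Sum>q\<in>J. \<Sum>m'<n. (C (p, m) (q, m')) ^ 4)"
    by (simp add: A_def sum.cartesian_product' case_prod_beta')
  also have "\<dots> = (\<Sum>p\<in>J. \<Sum>m<n. \<Sum>q\<in>J. \<Sum>m'<n. T (max m m') p q ^ 4 * ((h m)\<^sup>2 * (h m')\<^sup>2))"
  proof (intro sum.cong refl)
    fix p m q m' assume "m \<in> {..<n}" "m' \<in> {..<n}"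
    then have "sqrt (h m) ^ 4 = (h m)\<^sup>2" "sqrt (h m') ^ 4 = (h m')\<^sup>2"
      using h[of m] h[of m'] by (simp_all add: power4_eq_xxxx power2_eq_square)
    then show "C (p, m) (q, m') ^ 4 = T (max m m') p q ^ 4 * ((h m)\<^sup>2 * (h m')\<^sup>2)"
      by (simp add: C_def power_mult_distrib)
  qed
  also have "\<dots> = (\<Sum>p\<in>J. \<Sum>q\<in>J. \<Sum>m<n. \<Sum>m'<n. T (max m m') p q ^ 4 * ((h m)\<^sup>2 * (h m')\<^sup>2))"
    by (rule sum.cong[OF refl], rule sum.swap)
  also have "real (card (A \<times> A)) ^ 3 = real (card J * n) ^ 6"
    by (simp add: A_def card_cartesian_product power_mult_distrib flip: power_mult)
      (simp add: power_mult_distrib power3_eq_cube eval_nat_numeral mult_ac)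
  finally show "(\<integral>\<omega>. \<Phi> \<omega> ^ 4 \<partial>P) \<le> 1688 * real (card J * n) ^ 6 *
       (\<Sum>p\<in>J. \<Sum>q\<in>J. \<Sum>m<n. \<Sum>m'<n. T (max m m') p q ^ 4 * ((\<tau> (Suc m) - \<tau> m)\<^sup>2 * (\<tau> (Suc m') - \<tau> m')\<^sup>2))"
    by (simp add: h_def mult_ac)
qed

section \<open>Convergence of eigenvalue paths\<close>

lemma dyadic_floor_Suc:
  assumes "t \<ge> 0"
  shows "dyadic_floor (Suc m) t = 2 * dyadic_floor m t \<or> dyadic_floor (Suc m) t = Suc (2 * dyadic_floor m t)"
proof -
  have "real (dyadic_floor m t) \<le> 2 ^ m * t" "2 ^ m * t < real (dyadic_floor m t) + 1"
    "real (dyadic_floor (Suc m) t) \<le> 2 * (2 ^ m * t)" "2 * (2 ^ m * t) < real (dyadic_floor (Suc m) t) + 1"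
    using dyadic_floor_bounds[OF assms, of m] dyadic_floor_bounds[OF assms, of "Suc m"] by (simp_all add: field_simps)
  then have "real (dyadic_floor (Suc m) t) < 2 * real (dyadic_floor m t) + 2" "2 * real (dyadic_floor m t) < real (dyadic_floor (Suc m) t) + 1"
    by linarith+
  then have "dyadic_floor (Suc m) t < 2 * dyadic_floor m t + 2" "2 * dyadic_floor m t < dyadic_floor (Suc m) t + 1"
    by linarith+
  then show ?thesis by linarith
qed

lemma dyadic_floor_tendsto:
  assumes "t \<ge> 0"
  shows "(\<lambda>m. real (dyadic_floor m t) / 2 ^ m) \<longlonglongrightarrow> t"
proof -
  have "(\<lambda>m. real (dyadic_floor m t) / 2 ^ m - t) \<longlonglongrightarrow> 0"
  proof (rule Lim_null_comparison[OF always_eventually])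
    show "\<forall>m. norm (real (dyadic_floor m t) / 2 ^ m - t) \<le> (1 / 2) ^ m"
      using dyadic_floor_bounds[OF assms] by (simp add: add_divide_distrib power_divide abs_le_iff less_imp_le)
        (smt (verit, best) divide_nonneg_nonneg zero_le_power)
    show "(\<lambda>m. (1 / 2 :: real) ^ m) \<longlonglongrightarrow> 0" by (rule LIMSEQ_power_zero) simp
  qed
  then show ?thesis by (simp add: LIM_zero_iff)
qed

text \<open>A substitute for Hoelder's inequality that is linear in the fourth power.\<close>

lemma le_add_power4:
  fixes a x :: real
  assumes "a > 0" "x \<ge> 0"
  shows "x \<le> a + (1 / a ^ 3) * x ^ 4"
proof (cases "x \<le> a")
  case True
  have "0 \<le> (1 / a ^ 3) * x ^ 4" using assms by simp
  then show ?thesis using True by linarith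
next
  case False
  then have "a ^ 3 * x \<le> x ^ 3 * x" using assms by (intro mult_right_mono power_mono) auto
  then have "x \<le> (1 / a ^ 3) * x ^ 4" using assms by (simp add: field_simps eval_nat_numeral)
  then show ?thesis using assms by linarith
qed

text \<open>Consecutive dyadic approximations of \<open>t\<close> are equal or adjacent at the finer level, so the distance from \<open>R t\<close> to \<open>R\<close> at the
approximation of level \<open>n\<close> is at most the sum over \<open>m \<ge> n\<close> of the largest increment at level \<open>m + 1\<close>. By \<open>le_add_power4\<close> the
latter is at most \<open>r\<^bsup>m+1\<^esup>\<close> plus a multiple of the sum of all fourth powers; the fourth-moment hypothesis
makes the expectation of this geometrically small. The dominating variable \<open>G\<close> replaces the supremum over \<open>t\<close>, whose
measurability is then not an issue.\<close>

lemma dyadic_chaining: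
  fixes R :: "real \<Rightarrow> 'a \<Rightarrow> real"
  assumes P: "prob_space P" and meas: "\<And>t. t \<ge> 0 \<Longrightarrow> R t \<in> borel_measurable P"
    and cont: "\<And>\<omega>. \<omega> \<in> space P \<Longrightarrow> continuous_on {0..} (\<lambda>t. R t \<omega>)" and C: "C \<ge> 0"
    and mom: "\<And>s t. 0 \<le> s \<Longrightarrow> s < t \<Longrightarrow> t \<le> real k \<Longrightarrow>
       integrable P (\<lambda>\<omega>. (R t \<omega> - R s \<omega>) ^ 4) \<and> (\<integral>\<omega>. (R t \<omega> - R s \<omega>) ^ 4 \<partial>P) \<le> C * (t - s)\<^sup>2"
  obtains G where "G \<in> borel_measurable P"
    "\<And>\<omega> t. \<omega> \<in> space P \<Longrightarrow> 0 \<le> t \<Longrightarrow> t \<le> real k \<Longrightarrow> ennreal \<bar>R t \<omega> - R (real (dyadic_floor n t) / 2 ^ n) \<omega>\<bar> \<le> G \<omega>"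
    "(\<integral>\<^sup>+\<omega>. G \<omega> \<partial>P) \<le> ennreal (10 * (1 + real k * C) * (9 / 10) ^ Suc n)"
proof -
  interpret prob_space P by fact
  \<comment> \<open>Any ratio \<open>r < 1\<close> with \<open>1 / (2 r\<^sup>3) \<le> r\<close> would do, with another constant.\<close>
  define r :: real where "r = 9 / 10"
  have r: "r > 0" by (simp add: r_def)
  define d where "d m j \<omega> = R (real (Suc j) / 2 ^ Suc m) \<omega> - R (real j / 2 ^ Suc m) \<omega>" for m j \<omega>
  define g where "g m \<omega> = r ^ Suc m + (1 / (r ^ Suc m) ^ 3) * (\<Sum>j<k * 2 ^ Suc m. d m j \<omega> ^ 4)" for m \<omega>
  have g0: "g m \<omega> \<ge> 0" for m \<omega> unfolding g_def using r by (intro add_nonneg_nonneg mult_nonneg_nonneg sum_nonneg) auto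
  have dm: "d m j \<in> borel_measurable P" for m j unfolding d_def[abs_def] by (intro borel_measurable_diff meas) auto
  have gm: "g m \<in> borel_measurable P" for m unfolding g_def[abs_def] using dm by measurable
  have d4: "integrable P (\<lambda>\<omega>. d m j \<omega> ^ 4)" "(\<integral>\<omega>. d m j \<omega> ^ 4 \<partial>P) \<le> C * (1 / 2 ^ Suc m)\<^sup>2" if j: "j < k * 2 ^ Suc m" for m j
  proof -
    have "real (Suc j) \<le> real (k * 2 ^ Suc m)" using j by (intro of_nat_mono) simp
    then have le: "real (Suc j) / 2 ^ Suc m \<le> real k" by (simp add: pos_divide_le_eq del: power_Suc)
    have lt: "real j / 2 ^ Suc m < real (Suc j) / 2 ^ Suc m" by (intro divide_strict_right_mono) auto
    have "real (Suc j) / 2 ^ Suc m - real j / 2 ^ Suc m = 1 / 2 ^ Suc m"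
      by (simp add: diff_divide_distrib[symmetric] del: power_Suc)
    then show "integrable P (\<lambda>\<omega>. d m j \<omega> ^ 4)" "(\<integral>\<omega>. d m j \<omega> ^ 4 \<partial>P) \<le> C * (1 / 2 ^ Suc m)\<^sup>2"
      using mom[OF _ lt le] unfolding d_def by simp_all
  qed
  have step: "\<bar>R (real (dyadic_floor (Suc m) t) / 2 ^ Suc m) \<omega> - R (real (dyadic_floor m t) / 2 ^ m) \<omega>\<bar> \<le> g m \<omega>"
    if t: "0 \<le> t" "t \<le> real k" for t \<omega> m
  proof -
    define j where "j = 2 * dyadic_floor m t"
    have j: "real (dyadic_floor m t) / 2 ^ m = real j / 2 ^ Suc m" by (simp add: j_def)
    show ?thesis
    proof (cases "dyadic_floor (Suc m) t = j")
      case True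
      then show ?thesis using j g0 by simp
    next
      case False
      then have s: "dyadic_floor (Suc m) t = Suc j" using dyadic_floor_Suc[OF t(1), of m] by (simp add: j_def)
      then have jk: "j < k * 2 ^ Suc m" using dyadic_floor_le[OF t, of "Suc m"] by simp
      have "\<bar>d m j \<omega>\<bar> \<le> r ^ Suc m + (1 / (r ^ Suc m) ^ 3) * \<bar>d m j \<omega>\<bar> ^ 4"
        using r by (intro le_add_power4) auto
      also have "\<dots> \<le> g m \<omega>"
        unfolding g_def using jk r
        by (intro add_left_mono mult_left_mono) (auto intro!: member_le_sum[of j _ "\<lambda>j. d m j \<omega> ^ 4"] simp del: power_Suc)
      finally show ?thesis unfolding j s d_def .
    qed
  qed
  define G where "G \<omega> = (\<Sum>m. ennreal (g (n + m) \<omega>))" for \<omega>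
  have Gm: "G \<in> borel_measurable P" unfolding G_def[abs_def] using gm by measurable
  have "ennreal \<bar>R t \<omega> - R (real (dyadic_floor n t) / 2 ^ n) \<omega>\<bar> \<le> G \<omega>" if \<omega>: "\<omega> \<in> space P" and t: "0 \<le> t" "t \<le> real k" for \<omega> t
  proof -
    define a where "a m = R (real (dyadic_floor m t) / 2 ^ m) \<omega>" for m
    have tele: "\<bar>a (n + m) - a n\<bar> \<le> (\<Sum>i<m. g (n + i) \<omega>)" for m
    proof (induction m)
      case (Suc m)
      then show ?case using step[OF t, of "n + m" \<omega>] by (simp add: a_def)
    qed simp
    have le: "ennreal \<bar>a (n + m) - a n\<bar> \<le> G \<omega>" for m
    proof -
      have "ennreal \<bar>a (n + m) - a n\<bar> \<le> ennreal (\<Sum>i<m. g (n + i) \<omega>)" using tele by (rule ennreal_leI)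
      also have "\<dots> = (\<Sum>i<m. ennreal (g (n + i) \<omega>))" using g0 by simp
      also have "\<dots> \<le> G \<omega>" unfolding G_def by (rule sum_le_suminf) auto
      finally show ?thesis .
    qed
    have lim: "(\<lambda>m. ennreal \<bar>a (n + m) - a n\<bar>) \<longlonglongrightarrow> ennreal \<bar>R t \<omega> - a n\<bar>"
    proof -
      have "a \<longlonglongrightarrow> R t \<omega>" unfolding a_def
        by (rule continuous_on_tendsto_compose[OF cont[OF \<omega>] dyadic_floor_tendsto[OF t(1)]]) (use t in auto)
      then have "(\<lambda>m. a (n + m)) \<longlonglongrightarrow> R t \<omega>" using LIMSEQ_ignore_initial_segment[of a _ n] by (simp add: add.commute)
      then show ?thesis by (intro tendsto_ennrealI tendsto_rabs tendsto_diff tendsto_const)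
    qed
    have "ennreal \<bar>R t \<omega> - a n\<bar> \<le> G \<omega>"
      by (rule LIMSEQ_le_const2[OF lim]) (simp add: le)
    then show ?thesis by (simp add: a_def)
  qed
  moreover have "(\<integral>\<^sup>+\<omega>. G \<omega> \<partial>P) \<le> ennreal (10 * (1 + real k * C) * (9 / 10) ^ Suc n)"
  proof -
    have int_g: "(\<integral>\<^sup>+\<omega>. ennreal (g m \<omega>) \<partial>P) \<le> ennreal ((1 + real k * C) * r ^ Suc m)" for m
    proof -
      have i: "integrable P (g m)" unfolding g_def[abs_def]
        by (intro Bochner_Integration.integrable_add integrable_mult_right Bochner_Integration.integrable_sum d4(1)) auto
      have "(\<integral>\<omega>. g m \<omega> \<partial>P) = r ^ Suc m + (1 / (r ^ Suc m) ^ 3) * (\<Sum>j<k * 2 ^ Suc m. \<integral>\<omega>. d m j \<omega> ^ 4 \<partial>P)"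
      proof -
        have "integrable P (\<lambda>\<omega>. \<Sum>j<k * 2 ^ Suc m. d m j \<omega> ^ 4)"
          by (intro Bochner_Integration.integrable_sum d4(1)) auto
        moreover have "(\<integral>\<omega>. (\<Sum>j<k * 2 ^ Suc m. d m j \<omega> ^ 4) \<partial>P) = (\<Sum>j<k * 2 ^ Suc m. \<integral>\<omega>. d m j \<omega> ^ 4 \<partial>P)"
          by (intro Bochner_Integration.integral_sum d4(1)) auto
        ultimately show ?thesis unfolding g_def by (simp add: prob_space del: power_Suc)
      qed
      also have "\<dots> \<le> r ^ Suc m + (1 / (r ^ Suc m) ^ 3) * (\<Sum>j<k * 2 ^ Suc m. C * (1 / 2 ^ Suc m)\<^sup>2)"
        using d4(2) r by (intro add_left_mono mult_left_mono sum_mono) auto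
      also have "\<dots> = r ^ Suc m + real k * C * (1 / (2 * r ^ 3)) ^ Suc m"
        by (simp add: power_divide power_mult_distrib power2_eq_square del: power_Suc flip: power_mult)
          (simp add: mult.commute)
      also have "\<dots> \<le> r ^ Suc m + real k * C * r ^ Suc m"
        using C by (intro add_left_mono mult_left_mono power_mono) (auto simp: r_def power3_eq_cube)
      also have "\<dots> = (1 + real k * C) * r ^ Suc m" by (simp add: distrib_right)
      finally show ?thesis using nn_integral_eq_integral[OF i] g0 by (simp add: ennreal_leI)
    qed
    have "(\<integral>\<^sup>+\<omega>. G \<omega> \<partial>P) = (\<Sum>m. \<integral>\<^sup>+\<omega>. ennreal (g (n + m) \<omega>) \<partial>P)"
      unfolding G_def using gm by (intro nn_integral_suminf) auto
    also have "\<dots> \<le> (\<Sum>m. ennreal ((1 + real k * C) * r ^ Suc n * r ^ m))"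
      using int_g[of "n + _"] by (intro suminf_le) (auto simp: power_add mult_ac)
    also have "\<dots> = ennreal ((1 + real k * C) * r ^ Suc n * (1 / (1 - r)))"
      using r C by (intro suminf_ennreal_eq sums_mult geometric_sums) (auto simp: r_def)
    also have "(1 + real k * C) * r ^ Suc n * (1 / (1 - r)) = 10 * (1 + real k * C) * (9 / 10) ^ Suc n"
      by (simp add: r_def algebra_simps)
    finally show ?thesis .
  qed
  ultimately show thesis using that[OF Gm] by blast
qed

text \<open>Entries on and above the diagonal carry the real parts, entries below the diagonal the imaginary parts of the
transposed entries.\<close>

definition hermitian_of :: "nat \<Rightarrow> (nat \<Rightarrow> nat \<Rightarrow> real) \<Rightarrow> complex mat" where
  "hermitian_of N x = mat N N (\<lambda>(i, j). if i = j then of_real (x i i)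
     else if i < j then Complex (x i j) (x j i) else Complex (x j i) (- x i j))"

lemma hermitian_hermitian_of: "hermitian_mat N (hermitian_of N x)"
  by (auto simp: hermitian_mat_def hermitian_of_def complex_eq_iff)

lemma eigenvalue_hermitian_of_Lipschitz:
  assumes "i < N"
  shows "\<bar>ordered_eigenvalue (hermitian_of N x) i - ordered_eigenvalue (hermitian_of N y) i\<bar> \<le> 2 * (\<Sum>k<N. \<Sum>l<N. \<bar>x k l - y k l\<bar>)"
proof -
  have "\<bar>ordered_eigenvalue (hermitian_of N x) i - ordered_eigenvalue (hermitian_of N y) i\<bar>
     \<le> (\<Sum>k<N. \<Sum>l<N. cmod (hermitian_of N x $$ (k, l) - hermitian_of N y $$ (k, l)))"
    by (rule weyl_inequality[OF hermitian_hermitian_of hermitian_hermitian_of assms])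
  also have "\<dots> \<le> (\<Sum>k<N. \<Sum>l<N. \<bar>x k l - y k l\<bar> + \<bar>x l k - y l k\<bar>)"
  proof (intro sum_mono)
    fix k l assume kl: "k \<in> {..<N}" "l \<in> {..<N}"
    have c: "cmod (Complex a b - Complex a' b') \<le> \<bar>a - a'\<bar> + \<bar>b - b'\<bar>" for a b a' b'
      using cmod_le[of "Complex a b - Complex a' b'"] by simp
    show "cmod (hermitian_of N x $$ (k, l) - hermitian_of N y $$ (k, l)) \<le> \<bar>x k l - y k l\<bar> + \<bar>x l k - y l k\<bar>"
      using kl c[of "x k l" "x l k" "y k l" "y l k"] c[of "x l k" "- x k l" "y l k" "- y k l"]
      by (auto simp: hermitian_of_def simp flip: of_real_diff)
  qed
  also have "\<dots> = (\<Sum>k<N. \<Sum>l<N. \<bar>x k l - y k l\<bar>) + (\<Sum>k<N. \<Sum>l<N. \<bar>x l k - y l k\<bar>)"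
    by (simp add: sum.distrib)
  also have "(\<Sum>k<N. \<Sum>l<N. \<bar>x l k - y l k\<bar>) = (\<Sum>k<N. \<Sum>l<N. \<bar>x k l - y k l\<bar>)" by (rule sum.swap)
  finally show ?thesis by simp
qed

definition eigen_path :: "nat \<Rightarrow> (nat \<Rightarrow> nat \<Rightarrow> real \<Rightarrow> 'a \<Rightarrow> real) \<Rightarrow> 'a \<Rightarrow> real \<Rightarrow> nat \<Rightarrow> real" where
  "eigen_path N R \<omega> = (\<lambda>t\<in>{0..}. \<lambda>i. if i < N then ordered_eigenvalue (hermitian_of N (\<lambda>i j. R i j t \<omega>)) i else 0)"

text \<open>Processes of Hermitian matrices, in real coordinates, with the control of increments that chaining needs. The
constants \<open>C k\<close> must be the same for all \<open>M\<close> when this is applied to a sequence.\<close>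

definition matrix_process :: "'a measure \<Rightarrow> nat \<Rightarrow> (nat \<Rightarrow> real) \<Rightarrow> (nat \<Rightarrow> nat \<Rightarrow> real \<Rightarrow> 'a \<Rightarrow> real) \<Rightarrow> bool" where
  "matrix_process P N C R \<longleftrightarrow> prob_space P \<and>
     (\<forall>i<N. \<forall>j<N. (\<forall>t\<ge>0. R i j t \<in> borel_measurable P) \<and>
       (\<forall>\<omega>\<in>space P. R i j 0 \<omega> = 0 \<and> continuous_on {0..} (\<lambda>t. R i j t \<omega>)) \<and>
       (\<forall>k s t. 0 \<le> s \<and> s < t \<and> t \<le> real k \<longrightarrow> integrable P (\<lambda>\<omega>. (R i j t \<omega> - R i j s \<omega>) ^ 4) \<and>
          (\<integral>\<omega>. (R i j t \<omega> - R i j s \<omega>) ^ 4 \<partial>P) \<le> C k * (t - s)\<^sup>2))"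

lemma eigen_path_in_path_space:
  assumes R: "matrix_process P N C R" and \<omega>: "\<omega> \<in> space P"
  shows "eigen_path N R \<omega> \<in> path_space N"
proof -
  have "continuous_on {0..} (\<lambda>t. ordered_eigenvalue (hermitian_of N (\<lambda>k l. R k l t \<omega>)) i)" if i: "i < N" for i
    unfolding continuous_on_def
  proof
    fix t :: real assume t: "t \<in> {0..}"
    have "((\<lambda>s. 2 * (\<Sum>k<N. \<Sum>l<N. \<bar>R k l s \<omega> - R k l t \<omega>\<bar>)) \<longlongrightarrow> 2 * (\<Sum>k<N. \<Sum>l<N. \<bar>R k l t \<omega> - R k l t \<omega>\<bar>)) (at t within {0..})"
      using R \<omega> t by (intro tendsto_intros) (auto simp: matrix_process_def continuous_on_def)
    then have lim: "((\<lambda>s. 2 * (\<Sum>k<N. \<Sum>l<N. \<bar>R k l s \<omega> - R k l t \<omega>\<bar>)) \<longlongrightarrow> 0) (at t within {0..})" by simp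
    have "((\<lambda>s. ordered_eigenvalue (hermitian_of N (\<lambda>k l. R k l s \<omega>)) i - ordered_eigenvalue (hermitian_of N (\<lambda>k l. R k l t \<omega>)) i) \<longlongrightarrow> 0) (at t within {0..})"
      by (rule Lim_null_comparison[OF always_eventually lim])
        (use eigenvalue_hermitian_of_Lipschitz[OF i, of "\<lambda>k l. R k l _ \<omega>"] in simp)
    then show "((\<lambda>s. ordered_eigenvalue (hermitian_of N (\<lambda>k l. R k l s \<omega>)) i) \<longlongrightarrow> ordered_eigenvalue (hermitian_of N (\<lambda>k l. R k l t \<omega>)) i) (at t within {0..})"
      by (simp add: LIM_zero_iff)
  qed
  then have "continuous_on {0..} (\<lambda>t. eigen_path N R \<omega> t i)" for i
    by (cases "i < N"; subst continuous_on_cong[OF refl, where g = "\<lambda>t. if i < N then ordered_eigenvalue (hermitian_of N (\<lambda>k l. R k l t \<omega>)) i else 0"])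
      (auto simp: eigen_path_def)
  then show ?thesis by (auto simp: path_space_iff eigen_path_def)
qed

lemma eigen_path_measurable:
  assumes R: "matrix_process P N C R" and t: "t \<ge> 0" and i: "i < N"
  shows "(\<lambda>\<omega>. eigen_path N R \<omega> t i) \<in> borel_measurable P"
proof -
  define f where "f v = ordered_eigenvalue (hermitian_of N (\<lambda>k l. v (k, l))) i" for v :: "nat \<times> nat \<Rightarrow> real"
  have "\<bar>f v - f w\<bar> \<le> 2 * (\<Sum>kl\<in>{..<N} \<times> {..<N}. \<bar>v kl - w kl\<bar>)" for v w
    using eigenvalue_hermitian_of_Lipschitz[OF i, of "\<lambda>k l. v (k, l)" "\<lambda>k l. w (k, l)"]
    by (simp add: f_def sum.cartesian_product')
  then have "continuous_on UNIV f"
    by (rule continuous_on_finitely_many_coordinates[rotated]) simp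
  then have f: "f \<in> borel_measurable borel" by (rule borel_measurable_continuous_onI)
  have "(\<lambda>\<omega> (k, l). if k < N \<and> l < N then R k l t \<omega> else 0) \<in> borel_measurable P"
  proof (rule measurable_coordinatewise_then_product)
    fix kl :: "nat \<times> nat"
    show "(\<lambda>\<omega>. case kl of (k, l) \<Rightarrow> if k < N \<and> l < N then R k l t \<omega> else 0) \<in> borel_measurable P"
      using R t by (cases kl; cases "fst kl < N \<and> snd kl < N") (auto simp: matrix_process_def)
  qed
  from measurable_compose[OF this f]
  have "(\<lambda>\<omega>. f (\<lambda>(k, l). if k < N \<and> l < N then R k l t \<omega> else 0)) \<in> borel_measurable P" .
  also have "(\<lambda>\<omega>. f (\<lambda>(k, l). if k < N \<and> l < N then R k l t \<omega> else 0)) = (\<lambda>\<omega>. eigen_path N R \<omega> t i)"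
  proof
    fix \<omega>
    have "hermitian_of N (\<lambda>k l. if k < N \<and> l < N then R k l t \<omega> else 0) = hermitian_of N (\<lambda>k l. R k l t \<omega>)"
      by (rule eq_matI) (auto simp: hermitian_of_def)
    then show "f (\<lambda>(k, l). if k < N \<and> l < N then R k l t \<omega> else 0) = eigen_path N R \<omega> t i"
      using t i by (simp add: f_def eigen_path_def)
  qed
  finally show ?thesis .
qed

lemma eigen_path_step_approximation:
  assumes N: "N \<ge> 1" and R: "matrix_process P N C R" and C: "C k \<ge> 0" and F: "\<forall>g\<in>path_space N. \<bar>F g\<bar> \<le> B"
  shows "\<bar>(\<integral>\<omega>. lip_env N F k (eigen_path N R \<omega>) \<partial>P) - (\<integral>\<omega>. lip_env N F k (step_path n (eigen_path N R \<omega>)) \<partial>P)\<bar>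
     \<le> real k * 2 * (real N)\<^sup>2 * (10 * (1 + real k * C k) * (9 / 10) ^ Suc n)"
proof -
  interpret prob_space P using R by (simp add: matrix_process_def)
  define c where "c = 10 * (1 + real k * C k) * (9 / 10) ^ Suc n"
  have c0: "c \<ge> 0" unfolding c_def using C by simp
  define dominates where "dominates ij G \<longleftrightarrow> G \<in> borel_measurable P \<and>
    (\<forall>\<omega>\<in>space P. \<forall>t. 0 \<le> t \<and> t \<le> real k \<longrightarrow> ennreal \<bar>R (fst ij) (snd ij) t \<omega> - R (fst ij) (snd ij) (real (dyadic_floor n t) / 2 ^ n) \<omega>\<bar> \<le> G \<omega>) \<and>
    (\<integral>\<^sup>+\<omega>. G \<omega> \<partial>P) \<le> ennreal c" for ij G
  have "\<exists>G. dominates ij G" if "ij \<in> {..<N} \<times> {..<N}" for ij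
  proof -
    have ij: "fst ij < N" "snd ij < N" using that by auto
    show ?thesis
    proof (rule dyadic_chaining[of P "R (fst ij) (snd ij)" "C k" k n])
      fix G assume "G \<in> borel_measurable P"
        "\<And>\<omega> t. \<omega> \<in> space P \<Longrightarrow> 0 \<le> t \<Longrightarrow> t \<le> real k \<Longrightarrow> ennreal \<bar>R (fst ij) (snd ij) t \<omega> - R (fst ij) (snd ij) (real (dyadic_floor n t) / 2 ^ n) \<omega>\<bar> \<le> G \<omega>"
        "(\<integral>\<^sup>+\<omega>. G \<omega> \<partial>P) \<le> ennreal (10 * (1 + real k * C k) * (9 / 10) ^ Suc n)"
      then have "dominates ij G" unfolding dominates_def c_def by simp
      then show ?thesis by (rule exI[of _ G])
    qed (use R ij C in \<open>auto simp: matrix_process_def\<close>)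
  qed
  then have "\<forall>ij\<in>{..<N} \<times> {..<N}. \<exists>G. dominates ij G" by simp
  from bchoice[OF this] obtain G where dom: "\<forall>ij\<in>{..<N} \<times> {..<N}. dominates ij (G ij)" ..
  have G: "G ij \<in> borel_measurable P" "(\<integral>\<^sup>+\<omega>. G ij \<omega> \<partial>P) \<le> ennreal c"
    "\<omega> \<in> space P \<Longrightarrow> 0 \<le> t \<Longrightarrow> t \<le> real k \<Longrightarrow>
        ennreal \<bar>R (fst ij) (snd ij) t \<omega> - R (fst ij) (snd ij) (real (dyadic_floor n t) / 2 ^ n) \<omega>\<bar> \<le> G ij \<omega>"
    if "ij \<in> {..<N} \<times> {..<N}" for ij \<omega> t
    using bspec[OF dom that] unfolding dominates_def by simp_all
  define H where "H \<omega> = 2 * (\<Sum>ij\<in>{..<N} \<times> {..<N}. G ij \<omega>)" for \<omega>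
  have dist: "ennreal (path_dist N k (eigen_path N R \<omega>) (step_path n (eigen_path N R \<omega>))) \<le> H \<omega>" if \<omega>: "\<omega> \<in> space P" for \<omega>
  proof (cases "H \<omega> = \<infinity>")
    case False
    then obtain h where h: "H \<omega> = ennreal h" "h \<ge> 0" by (cases "H \<omega>") auto
    have "path_dist N k (eigen_path N R \<omega>) (step_path n (eigen_path N R \<omega>)) \<le> h"
    proof (rule path_dist_least[OF N])
      fix t i assume t: "0 \<le> t" "t \<le> real k" and i: "i < N"
      define t' where "t' = real (dyadic_floor n t) / 2 ^ n"
      have t': "t' \<ge> 0" by (simp add: t'_def)
      have "\<bar>eigen_path N R \<omega> t i - step_path n (eigen_path N R \<omega>) t i\<bar> \<le> 2 * (\<Sum>k<N. \<Sum>l<N. \<bar>R k l t \<omega> - R k l t' \<omega>\<bar>)"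
        using eigenvalue_hermitian_of_Lipschitz[OF i, of "\<lambda>k l. R k l t \<omega>" "\<lambda>k l. R k l t' \<omega>"] t i t'
        by (simp add: step_path_def eigen_path_def t'_def)
      also have "\<dots> = 2 * (\<Sum>ij\<in>{..<N} \<times> {..<N}. \<bar>R (fst ij) (snd ij) t \<omega> - R (fst ij) (snd ij) t' \<omega>\<bar>)"
        by (simp add: sum.cartesian_product')
      finally have "ennreal \<bar>eigen_path N R \<omega> t i - step_path n (eigen_path N R \<omega>) t i\<bar>
         \<le> ennreal (2 * (\<Sum>ij\<in>{..<N} \<times> {..<N}. \<bar>R (fst ij) (snd ij) t \<omega> - R (fst ij) (snd ij) t' \<omega>\<bar>))" by (rule ennreal_leI)
      also have "\<dots> = 2 * (\<Sum>ij\<in>{..<N} \<times> {..<N}. ennreal \<bar>R (fst ij) (snd ij) t \<omega> - R (fst ij) (snd ij) t' \<omega>\<bar>)"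
        by (simp add: ennreal_mult sum_nonneg)
      also have "\<dots> \<le> H \<omega>"
        unfolding H_def t'_def by (intro mult_left_mono sum_mono G(3)[OF _ \<omega> t]) auto
      finally have "\<bar>eigen_path N R \<omega> t i - step_path n (eigen_path N R \<omega>) t i\<bar> \<le> h" using h by simp
      then show "min 1 \<bar>eigen_path N R \<omega> t i - step_path n (eigen_path N R \<omega>) t i\<bar> \<le> h" by (intro min.coboundedI2)
    qed
    then show ?thesis using h by (simp add: ennreal_leI)
  qed simp
  have Z: "\<forall>\<omega>\<in>space P. eigen_path N R \<omega> \<in> path_space N" using eigen_path_in_path_space[OF R] by blast
  have Zm: "\<forall>t\<ge>0. \<forall>i<N. (\<lambda>\<omega>. eigen_path N R \<omega> t i) \<in> borel_measurable P" using eigen_path_measurable[OF R] by blast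
  have i1: "integrable P (\<lambda>\<omega>. lip_env N F k (eigen_path N R \<omega>))"
    by (rule integrable_const_bound[where B = "B + real k"])
      (use lip_env_abs[OF N F] lip_env_measurable(1)[OF N F Z Zm] in auto)
  have i2: "integrable P (\<lambda>\<omega>. lip_env N F k (step_path n (eigen_path N R \<omega>)))"
    by (rule integrable_const_bound[where B = "B + real k"])
      (use lip_env_abs[OF N F] lip_env_measurable(2)[OF N F Z Zm] in auto)
  have "ennreal \<bar>(\<integral>\<omega>. lip_env N F k (eigen_path N R \<omega>) \<partial>P) - (\<integral>\<omega>. lip_env N F k (step_path n (eigen_path N R \<omega>)) \<partial>P)\<bar>
    = ennreal (norm (\<integral>\<omega>. lip_env N F k (eigen_path N R \<omega>) - lip_env N F k (step_path n (eigen_path N R \<omega>)) \<partial>P))"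
    using i1 i2 by simp
  also have "\<dots> \<le> (\<integral>\<^sup>+\<omega>. norm (lip_env N F k (eigen_path N R \<omega>) - lip_env N F k (step_path n (eigen_path N R \<omega>))) \<partial>P)"
    using i1 i2 by (intro integral_norm_bound_ennreal) auto
  also have "\<dots> \<le> (\<integral>\<^sup>+\<omega>. ennreal (real k) * H \<omega> \<partial>P)"
  proof (rule nn_integral_mono)
    fix \<omega> assume \<omega>: "\<omega> \<in> space P"
    have "ennreal (norm (lip_env N F k (eigen_path N R \<omega>) - lip_env N F k (step_path n (eigen_path N R \<omega>))))
       \<le> ennreal (real k * path_dist N k (eigen_path N R \<omega>) (step_path n (eigen_path N R \<omega>)))"
      using lip_env_Lipschitz[OF N F] by (intro ennreal_leI) simp
    also have "\<dots> = ennreal (real k) * ennreal (path_dist N k (eigen_path N R \<omega>) (step_path n (eigen_path N R \<omega>)))"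
      using path_dist_nonneg[OF N] by (simp add: ennreal_mult)
    also have "\<dots> \<le> ennreal (real k) * H \<omega>" using dist[OF \<omega>] by (intro mult_left_mono) auto
    finally show "ennreal (norm (lip_env N F k (eigen_path N R \<omega>) - lip_env N F k (step_path n (eigen_path N R \<omega>)))) \<le> ennreal (real k) * H \<omega>" .
  qed
  also have "\<dots> = ennreal (real k) * (2 * (\<Sum>ij\<in>{..<N} \<times> {..<N}. \<integral>\<^sup>+\<omega>. G ij \<omega> \<partial>P))"
    unfolding H_def using G(1) by (simp add: nn_integral_cmult nn_integral_sum borel_measurable_sum)
  also have "\<dots> \<le> ennreal (real k) * (2 * (\<Sum>ij\<in>{..<N} \<times> {..<N}. ennreal c))"
    using G(2) by (intro mult_left_mono sum_mono) auto
  also have "\<dots> = ennreal (real k * (2 * (\<Sum>ij\<in>{..<N} \<times> {..<N}. c)))"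
    using c0 by (simp add: ennreal_mult sum_nonneg ennreal_of_nat_eq_real_of_nat)
  finally have "\<bar>(\<integral>\<omega>. lip_env N F k (eigen_path N R \<omega>) \<partial>P) - (\<integral>\<omega>. lip_env N F k (step_path n (eigen_path N R \<omega>)) \<partial>P)\<bar>
    \<le> real k * (2 * (\<Sum>ij\<in>{..<N} \<times> {..<N}. c))"
    using c0 by (subst (asm) ennreal_le_iff) (auto intro!: mult_nonneg_nonneg sum_nonneg)
  then show ?thesis unfolding c_def by (simp add: power2_eq_square mult_ac)
qed

definition grid_values :: "nat \<Rightarrow> nat \<Rightarrow> (nat \<Rightarrow> nat \<Rightarrow> real \<Rightarrow> 'a \<Rightarrow> real) \<Rightarrow> 'a \<Rightarrow> nat \<times> nat \<times> nat \<Rightarrow> real" where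
  "grid_values N n X \<omega> = (\<lambda>(l, i, j). if i < N \<and> j < N then X i j (real l / 2 ^ n) \<omega> else 0)"

text \<open>Combines the criterion on the path space with Weyl's inequality: after discretisation the envelope is a Lipschitz function of
the coordinates at the times \<open>l / 2\<^sup>n\<close>, \<open>l \<le> k 2\<^sup>n\<close>.\<close>

theorem eigen_path_convergence:
  fixes P :: "nat \<Rightarrow> 'a measure" and Q :: "'b measure"
  assumes N: "N \<ge> 1" and C: "\<And>k. C k \<ge> 0"
    and R: "\<And>M. M \<ge> M0 \<Longrightarrow> matrix_process (P M) N C (R M)" and S: "matrix_process Q N C S"
    and cos: "\<And>n k w \<theta>. (\<lambda>M. \<integral>\<omega>. cos ((\<Sum>l\<le>k. \<Sum>i<N. \<Sum>j<N. w l i j * R M i j (real l / 2 ^ n) \<omega>) + \<theta>) \<partial>P M)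
       \<longlonglongrightarrow> (\<integral>\<omega>. cos ((\<Sum>l\<le>k. \<Sum>i<N. \<Sum>j<N. w l i j * S i j (real l / 2 ^ n) \<omega>) + \<theta>) \<partial>Q)"
    and Z: "\<And>M \<omega>. M \<ge> M0 \<Longrightarrow> \<omega> \<in> space (P M) \<Longrightarrow> Z M \<omega> = eigen_path N (R M) \<omega>"
    and W: "\<And>\<omega>. \<omega> \<in> space Q \<Longrightarrow> W \<omega> = eigen_path N S \<omega>"
  shows "converges_in_distribution (path_topology N) P Z Q W"
proof (rule converges_in_distribution_pathI[where ?M0.0 = M0 and
      r = "\<lambda>k n. real k * 2 * (real N)\<^sup>2 * (10 * (1 + real k * C k) * (9 / 10) ^ Suc n)", OF N])
  have pR: "prob_space (P M)" if "M \<ge> M0" for M using R[OF that] by (simp add: matrix_process_def)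
  have pS: "prob_space Q" using S by (simp add: matrix_process_def)
  show "prob_space (P M)" if "M \<ge> M0" for M by (rule pR[OF that])
  show "prob_space Q" by (rule pS)
  show "\<forall>\<omega>\<in>space (P M). Z M \<omega> \<in> path_space N" if "M \<ge> M0" for M
    using eigen_path_in_path_space[OF R[OF that]] Z[OF that] by simp
  show "\<forall>\<omega>\<in>space Q. W \<omega> \<in> path_space N"
    using eigen_path_in_path_space[OF S] W by simp
  show "\<forall>t\<ge>0. \<forall>i<N. (\<lambda>\<omega>. Z M \<omega> t i) \<in> borel_measurable (P M)" if "M \<ge> M0" for M
  proof (intro allI impI)
    fix t i assume ti: "0 \<le> (t::real)" "i < N"
    have "(\<lambda>\<omega>. Z M \<omega> t i) \<in> borel_measurable (P M) \<longleftrightarrow> (\<lambda>\<omega>. eigen_path N (R M) \<omega> t i) \<in> borel_measurable (P M)"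
      by (rule measurable_cong) (simp add: Z[OF that])
    then show "(\<lambda>\<omega>. Z M \<omega> t i) \<in> borel_measurable (P M)" using eigen_path_measurable[OF R[OF that] ti] by simp
  qed
  show "\<forall>t\<ge>0. \<forall>i<N. (\<lambda>\<omega>. W \<omega> t i) \<in> borel_measurable Q"
  proof (intro allI impI)
    fix t i assume ti: "0 \<le> (t::real)" "i < N"
    have "(\<lambda>\<omega>. W \<omega> t i) \<in> borel_measurable Q \<longleftrightarrow> (\<lambda>\<omega>. eigen_path N S \<omega> t i) \<in> borel_measurable Q"
      by (rule measurable_cong) (simp add: W)
    then show "(\<lambda>\<omega>. W \<omega> t i) \<in> borel_measurable Q" using eigen_path_measurable[OF S ti] by simp
  qed
  show "(\<lambda>n. real k * 2 * (real N)\<^sup>2 * (10 * (1 + real k * C k) * (9 / 10) ^ Suc n)) \<longlonglongrightarrow> 0" for k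
    by (intro tendsto_mult_right_zero LIMSEQ_Suc LIMSEQ_power_zero) simp
  have ZI: "(\<integral>\<omega>. f (Z M \<omega>) \<partial>P M) = (\<integral>\<omega>. f (eigen_path N (R M) \<omega>) \<partial>P M)" if "M \<ge> M0" for M and f :: "_ \<Rightarrow> real"
    using Z[OF that] by (intro Bochner_Integration.integral_cong) auto
  have WI: "(\<integral>\<omega>. f (W \<omega>) \<partial>Q) = (\<integral>\<omega>. f (eigen_path N S \<omega>) \<partial>Q)" for f :: "_ \<Rightarrow> real"
    using W by (intro Bochner_Integration.integral_cong) auto
  show "\<bar>(\<integral>\<omega>. lip_env N F k (Z M \<omega>) \<partial>P M) - (\<integral>\<omega>. lip_env N F k (step_path n (Z M \<omega>)) \<partial>P M)\<bar>
     \<le> real k * 2 * (real N)\<^sup>2 * (10 * (1 + real k * C k) * (9 / 10) ^ Suc n)"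
    if F: "\<forall>g\<in>path_space N. \<bar>F g\<bar> \<le> B" and M: "M \<ge> M0" for F B k n M
    unfolding ZI[OF M, of "lip_env N F k"] ZI[OF M, of "\<lambda>z. lip_env N F k (step_path n z)"]
    by (rule eigen_path_step_approximation[OF N R[OF M] C F])
  show "\<bar>(\<integral>\<omega>. lip_env N F k (W \<omega>) \<partial>Q) - (\<integral>\<omega>. lip_env N F k (step_path n (W \<omega>)) \<partial>Q)\<bar>
     \<le> real k * 2 * (real N)\<^sup>2 * (10 * (1 + real k * C k) * (9 / 10) ^ Suc n)"
    if F: "\<forall>g\<in>path_space N. \<bar>F g\<bar> \<le> B" for F B k n
    unfolding WI[of "lip_env N F k"] WI[of "\<lambda>z. lip_env N F k (step_path n z)"]
    by (rule eigen_path_step_approximation[OF N S C F])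
  fix F :: "(real \<Rightarrow> nat \<Rightarrow> real) \<Rightarrow> real" and B :: real and k n :: nat
  assume F: "\<forall>g\<in>path_space N. \<bar>F g\<bar> \<le> B"
  define I where "I = {..k * 2 ^ n} \<times> {..<N} \<times> {..<N}"
  define E where "E v = (\<lambda>t i. if i < N then ordered_eigenvalue (hermitian_of N (\<lambda>k l. v (dyadic_floor n t, k, l))) i else 0)"
    for v :: "nat \<times> nat \<times> nat \<Rightarrow> real"
  define \<psi> where "\<psi> v = lip_env N F k (E v)" for v
  have EV: "step_path n (eigen_path N X \<omega>) = E (grid_values N n X \<omega>)" for X :: "nat \<Rightarrow> nat \<Rightarrow> real \<Rightarrow> 'c \<Rightarrow> real" and \<omega>
  proof (intro ext)
    fix t i
    have "hermitian_of N (\<lambda>k l. grid_values N n X \<omega> (dyadic_floor n t, k, l)) = hermitian_of N (\<lambda>k l. X k l (real (dyadic_floor n t) / 2 ^ n) \<omega>)"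
      by (rule eq_matI) (auto simp: hermitian_of_def grid_values_def)
    then show "step_path n (eigen_path N X \<omega>) t i = E (grid_values N n X \<omega>) t i"
      by (simp add: step_path_def eigen_path_def E_def)
  qed
  have Lip: "\<bar>\<psi> v - \<psi> w\<bar> \<le> (real k * 2) * (\<Sum>lij\<in>I. \<bar>v lij - w lij\<bar>)" for v w
  proof -
    have "path_dist N k (E v) (E w) \<le> 2 * (\<Sum>lij\<in>I. \<bar>v lij - w lij\<bar>)"
    proof (rule path_dist_least[OF N])
      fix t i assume t: "0 \<le> t" "t \<le> real k" and i: "i < N"
      define l where "l = dyadic_floor n t"
      have l: "l \<le> k * 2 ^ n" unfolding l_def by (rule dyadic_floor_le[OF t])
      have "\<bar>E v t i - E w t i\<bar> \<le> 2 * (\<Sum>a<N. \<Sum>b<N. \<bar>v (l, a, b) - w (l, a, b)\<bar>)"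
        using eigenvalue_hermitian_of_Lipschitz[OF i] i by (simp add: E_def l_def)
      also have "\<dots> \<le> 2 * (\<Sum>l'\<le>k * 2 ^ n. \<Sum>a<N. \<Sum>b<N. \<bar>v (l', a, b) - w (l', a, b)\<bar>)"
        using l by (intro mult_left_mono member_le_sum[of l]) (auto intro!: sum_nonneg)
      also have "\<dots> = 2 * (\<Sum>lij\<in>I. \<bar>v lij - w lij\<bar>)"
        by (simp add: I_def sum.cartesian_product')
      finally show "min 1 \<bar>E v t i - E w t i\<bar> \<le> 2 * (\<Sum>lij\<in>I. \<bar>v lij - w lij\<bar>)" by (intro min.coboundedI2)
    qed
    then have "real k * path_dist N k (E v) (E w) \<le> real k * (2 * (\<Sum>lij\<in>I. \<bar>v lij - w lij\<bar>))"
      by (intro mult_left_mono) auto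
    then show ?thesis using lip_env_Lipschitz[OF N F, of k "E v" "E w"] by (simp add: \<psi>_def mult.assoc)
  qed
  define K where "K = 1 + C (Suc k) * (real (Suc k))\<^sup>2"
  have I: "finite I" by (simp add: I_def)
  have Vm: "(\<lambda>\<omega>. grid_values N n X \<omega> lij) \<in> borel_measurable p" if "matrix_process p N C X" for p :: "'c measure" and X lij
  proof -
    obtain l i j where lij: "lij = (l, i, j)" by (metis surj_pair)
    show ?thesis
      using that by (cases "i < N \<and> j < N") (auto simp: lij grid_values_def matrix_process_def)
  qed
  have V2: "integrable p (\<lambda>\<omega>. (grid_values N n X \<omega> lij)\<^sup>2) \<and> (\<integral>\<omega>. (grid_values N n X \<omega> lij)\<^sup>2 \<partial>p) \<le> K"
    if X: "matrix_process p N C X" and lij: "lij \<in> I" for p :: "'c measure" and X lij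
  proof -
    obtain l i j where lij': "lij = (l, i, j)" by (metis surj_pair)
    then have ij: "l \<le> k * 2 ^ n" "i < N" "j < N" using lij by (auto simp: I_def)
    interpret p: prob_space p using X by (simp add: matrix_process_def)
    define t where "t = real l / 2 ^ n"
    have V: "grid_values N n X \<omega> lij = X i j t \<omega>" for \<omega> using ij by (simp add: grid_values_def lij' t_def)
    have X0: "X i j 0 \<omega> = 0" if "\<omega> \<in> space p" for \<omega> using X ij that by (simp add: matrix_process_def)
    have K1: "K \<ge> 1" using C[of "Suc k"] by (simp add: K_def)
    show ?thesis
    proof (cases "l = 0")
      case True
      then have "grid_values N n X \<omega> lij = 0" if "\<omega> \<in> space p" for \<omega> using X0[OF that] V by (simp add: t_def)
      then have 0: "integrable p (\<lambda>\<omega>. (grid_values N n X \<omega> lij)\<^sup>2) = integrable p (\<lambda>\<omega>. 0 :: real)" "(\<integral>\<omega>. (grid_values N n X \<omega> lij)\<^sup>2 \<partial>p) = (\<integral>\<omega>. 0 \<partial>p)"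
        by (intro Bochner_Integration.integrable_cong Bochner_Integration.integral_cong; simp)+
      then show ?thesis using K1 by simp
    next
      case False
      have "real l \<le> real (k * 2 ^ n)" using ij(1) by (rule of_nat_mono)
      then have t: "0 < t" "t \<le> real k" using False by (simp_all add: t_def pos_divide_le_eq)
      have m: "X i j t \<in> borel_measurable p" using X ij t by (simp add: matrix_process_def)
      have "integrable p (\<lambda>\<omega>. (X i j t \<omega> - X i j 0 \<omega>) ^ 4) \<and> (\<integral>\<omega>. (X i j t \<omega> - X i j 0 \<omega>) ^ 4 \<partial>p) \<le> C (Suc k) * (t - 0)\<^sup>2"
      proof -
        have "\<forall>k s t. 0 \<le> s \<and> s < t \<and> t \<le> real k \<longrightarrow> integrable p (\<lambda>\<omega>. (X i j t \<omega> - X i j s \<omega>) ^ 4) \<and>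
          (\<integral>\<omega>. (X i j t \<omega> - X i j s \<omega>) ^ 4 \<partial>p) \<le> C k * (t - s)\<^sup>2"
          using X ij unfolding matrix_process_def by blast
        from this[rule_format, of 0 t "Suc k"] t show ?thesis by simp
      qed
      moreover have "integrable p (\<lambda>\<omega>. (X i j t \<omega> - X i j 0 \<omega>) ^ 4) = integrable p (\<lambda>\<omega>. (X i j t \<omega>) ^ 4)"
        "(\<integral>\<omega>. (X i j t \<omega> - X i j 0 \<omega>) ^ 4 \<partial>p) = (\<integral>\<omega>. (X i j t \<omega>) ^ 4 \<partial>p)"
        using X0 by (intro Bochner_Integration.integrable_cong Bochner_Integration.integral_cong; simp)+
      ultimately have X4: "integrable p (\<lambda>\<omega>. (X i j t \<omega>) ^ 4)" "(\<integral>\<omega>. (X i j t \<omega>) ^ 4 \<partial>p) \<le> C (Suc k) * t\<^sup>2" by auto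
      have "C (Suc k) * t\<^sup>2 \<le> C (Suc k) * (real (Suc k))\<^sup>2" using t C by (intro mult_left_mono power_mono) auto
      then have X4': "(\<integral>\<omega>. (X i j t \<omega>) ^ 4 \<partial>p) \<le> C (Suc k) * (real (Suc k))\<^sup>2" using X4(2) by linarith
      have sq: "x\<^sup>2 \<le> 1 + x ^ 4" for x :: real
      proof -
        have "2 * x\<^sup>2 \<le> x ^ 4 + 1" using sum_squares_bound[of "x\<^sup>2" 1] by simp
        then show ?thesis using zero_le_power2[of x] by linarith
      qed
      have i: "integrable p (\<lambda>\<omega>. 1 + (X i j t \<omega>) ^ 4)" using X4(1) by simp
      have i2: "integrable p (\<lambda>\<omega>. (X i j t \<omega>)\<^sup>2)"
        by (rule Bochner_Integration.integrable_bound[OF i]) (use m sq in \<open>auto intro: order_trans[OF _ abs_ge_self]\<close>)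
      have "(\<integral>\<omega>. (X i j t \<omega>)\<^sup>2 \<partial>p) \<le> (\<integral>\<omega>. 1 + (X i j t \<omega>) ^ 4 \<partial>p)" by (rule integral_mono[OF i2 i sq])
      also have "\<dots> = 1 + (\<integral>\<omega>. (X i j t \<omega>) ^ 4 \<partial>p)" using X4(1) by (simp add: p.prob_space)
      finally show ?thesis using i2 X4' V by (simp add: K_def)
    qed
  qed
  have sum_V: "(\<Sum>lij\<in>I. w lij * grid_values N n X \<omega> lij) = (\<Sum>l\<le>k * 2 ^ n. \<Sum>i<N. \<Sum>j<N. w (l, i, j) * X i j (real l / 2 ^ n) \<omega>)"
    for w and X :: "nat \<Rightarrow> nat \<Rightarrow> real \<Rightarrow> 'c \<Rightarrow> real" and \<omega>
    unfolding I_def sum.cartesian_product' by (intro sum.cong refl) (simp add: grid_values_def)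
  have "(\<lambda>M. \<integral>\<omega>. \<psi> (grid_values N n (R M) \<omega>) \<partial>P M) \<longlonglongrightarrow> (\<integral>\<omega>. \<psi> (grid_values N n S \<omega>) \<partial>Q)"
  proof (rule convergence_from_cosines[where \<psi> = \<psi> and V = "\<lambda>M. grid_values N n (R M)" and W = "grid_values N n S"
        and K = K and ?M0.0 = M0 and B = "B + real k", OF I])
    show "continuous_on UNIV \<psi>" by (rule continuous_on_finitely_many_coordinates[OF I Lip])
    show "\<bar>\<psi> v\<bar> \<le> B + real k" for v unfolding \<psi>_def by (rule lip_env_abs[OF N F])
    show "\<psi> v = \<psi> w" if "\<And>i. i \<in> I \<Longrightarrow> v i = w i" for v w using Lip[of v w] that by simp
    show "(\<lambda>\<omega>. grid_values N n (R M) \<omega> i) \<in> borel_measurable (P M)" if "M \<ge> M0" for M i by (rule Vm[OF R[OF that]])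
    show "(\<lambda>\<omega>. grid_values N n S \<omega> i) \<in> borel_measurable Q" for i by (rule Vm[OF S])
    show "integrable (P M) (\<lambda>\<omega>. (grid_values N n (R M) \<omega> i)\<^sup>2) \<and> (\<integral>\<omega>. (grid_values N n (R M) \<omega> i)\<^sup>2 \<partial>P M) \<le> K"
      if "M \<ge> M0" "i \<in> I" for M i by (rule V2[OF R[OF that(1)] that(2)])
    show "integrable Q (\<lambda>\<omega>. (grid_values N n S \<omega> i)\<^sup>2) \<and> (\<integral>\<omega>. (grid_values N n S \<omega> i)\<^sup>2 \<partial>Q) \<le> K"
      if "i \<in> I" for i by (rule V2[OF S that])
    show "(\<lambda>M. \<integral>\<omega>. cos ((\<Sum>i\<in>I. w i * grid_values N n (R M) \<omega> i) + \<theta>) \<partial>P M)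
       \<longlonglongrightarrow> (\<integral>\<omega>. cos ((\<Sum>i\<in>I. w i * grid_values N n S \<omega> i) + \<theta>) \<partial>Q)" for w \<theta>
      unfolding sum_V by (rule cos)
  qed (use pR pS in simp_all)
  then have lim: "(\<lambda>M. \<integral>\<omega>. \<psi> (grid_values N n (R M) \<omega>) \<partial>P M) \<longlonglongrightarrow> (\<integral>\<omega>. lip_env N F k (step_path n (W \<omega>)) \<partial>Q)"
    unfolding WI[of "\<lambda>z. lip_env N F k (step_path n z)"] EV \<psi>_def .
  show "(\<lambda>M. \<integral>\<omega>. lip_env N F k (step_path n (Z M \<omega>)) \<partial>P M) \<longlonglongrightarrow> (\<integral>\<omega>. lip_env N F k (step_path n (W \<omega>)) \<partial>Q)"
  proof (rule Lim_transform_eventually[OF lim])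
    show "\<forall>\<^sub>F M in sequentially. (\<integral>\<omega>. \<psi> (grid_values N n (R M) \<omega>) \<partial>P M) = (\<integral>\<omega>. lip_env N F k (step_path n (Z M \<omega>)) \<partial>P M)"
      using eventually_ge_at_top[of M0]
    proof eventually_elim
      case (elim M)
      show ?case unfolding ZI[OF elim, of "\<lambda>z. lip_env N F k (step_path n z)"] EV \<psi>_def ..
    qed
  qed
qed

section \<open>Quadratic functionals of one column\<close>

text \<open>The index \<open>c\<close> selects the real (\<open>True\<close>) or the imaginary (\<open>False\<close>) part. The set \<open>C i\<close> allows for real processes, such as
the diagonal entries of Hermitian Brownian motion, where only the real part is a Brownian motion.\<close>

lemma bm_family_of_parts:
  assumes P: "prob_space P" and Z: "independent_processes P (Z :: 'i \<Rightarrow> real \<Rightarrow> 'a \<Rightarrow> complex) I"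
    and bm: "\<And>i c. i \<in> I \<Longrightarrow> c \<in> C i \<Longrightarrow> standard_BM P (\<beta> (i, c))"
    and inner: "\<And>i. i \<in> I \<Longrightarrow> prob_space.indep_vars P (\<lambda>_. trajectory_space) (\<lambda>c. trajectory (\<beta> (i, c))) (C i)"
    and eq: "\<And>i c t \<omega>. i \<in> I \<Longrightarrow> c \<in> C i \<Longrightarrow> t \<ge> 0 \<Longrightarrow> \<omega> \<in> space P \<Longrightarrow>
        \<beta> (i, c) t \<omega> = s i * (if c then Re (Z i t \<omega>) else Im (Z i t \<omega>))"
  shows "bm_family P \<beta> (SIGMA i:I. C i)"
proof -
  interpret prob_space P by fact
  define g where "g i c z = (\<lambda>t\<in>{0..}. s i * (if c then Re (z t) else Im (z t)))" for i c and z :: "real \<Rightarrow> complex"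
  have gm: "g i c \<in> measurable trajectory_space trajectory_space" for i c
    unfolding g_def[abs_def]
  proof (rule measurable_restrict)
    fix t :: real assume t: "t \<in> {0..}"
    have c: "(\<lambda>z. z t) \<in> measurable trajectory_space (borel :: complex measure)"
      using t by (rule measurable_component_singleton)
    show "(\<lambda>z. s i * (if c then Re (z t) else Im (z t))) \<in> measurable trajectory_space borel"
      by (cases c) (use measurable_compose[OF c, of Re borel] measurable_compose[OF c, of Im borel] in auto)
  qed
  have eq_tr: "trajectory (\<beta> (i, c)) \<omega> = g i c (trajectory (Z i) \<omega>)" if "i \<in> I" "c \<in> C i" "\<omega> \<in> space P" for i c \<omega>
    using eq[OF that(1,2) _ that(3)] by (auto simp: trajectory_def g_def restrict_def)
  have "indep_vars (\<lambda>(i, c). trajectory_space) (\<lambda>(i, c) \<omega>. g i c (trajectory (Z i) \<omega>)) (SIGMA i:I. C i)"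
  proof (rule indep_vars_Sigma[where g = g and X = "\<lambda>i. trajectory (Z i)" and M' = "\<lambda>_. trajectory_space" and N = "\<lambda>_ _. trajectory_space"])
    show "indep_vars (\<lambda>_. trajectory_space) (\<lambda>i. trajectory (Z i)) I"
      using Z by (simp add: independent_processes_def)
    show "g i c \<in> measurable trajectory_space trajectory_space" for i c by (rule gm)
    show "indep_vars (\<lambda>_. trajectory_space) (\<lambda>c \<omega>. g i c (trajectory (Z i) \<omega>)) (C i)" if "i \<in> I" for i
      by (rule indep_vars_cong_space[OF inner[OF that]]) (simp add: eq_tr that)
  qed
  then have "indep_vars (\<lambda>_. trajectory_space) (\<lambda>(i, c) \<omega>. g i c (trajectory (Z i) \<omega>)) (SIGMA i:I. C i)"
    by (simp add: case_prod_beta')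
  then have "indep_vars (\<lambda>_. trajectory_space) (\<lambda>ic. trajectory (\<beta> ic)) (SIGMA i:I. C i)"
    by (rule indep_vars_cong_space) (auto simp: eq_tr)
  then show ?thesis using P bm by (auto simp: bm_family_def independent_processes_def)
qed

lemma complex_BM_parts:
  assumes "standard_complex_BM P Z"
  obtains \<beta> where "\<And>c. standard_BM P (\<beta> c)"
    "prob_space.indep_vars P (\<lambda>_. trajectory_space) (\<lambda>c. trajectory (\<beta> c)) (UNIV :: bool set)"
    "\<And>c t \<omega>. t \<ge> 0 \<Longrightarrow> \<omega> \<in> space P \<Longrightarrow> \<beta> c t \<omega> = sqrt 2 * (if c then Re (Z t \<omega>) else Im (Z t \<omega>))"
proof -
  obtain b b' where b: "standard_BM P b" "standard_BM P b'"
        "prob_space.indep_var P trajectory_space (trajectory b) trajectory_space (trajectory b')"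
        "\<And>t \<omega>. t \<ge> 0 \<Longrightarrow> \<omega> \<in> space P \<Longrightarrow> Z t \<omega> = (of_real (b t \<omega>) + \<i> * of_real (b' t \<omega>)) / of_real (sqrt 2)"
    using assms unfolding standard_complex_BM_def by blast
  interpret prob_space P using b(1) by (simp add: standard_BM_def)
  show thesis
  proof (rule that[of "\<lambda>c. if c then b else b'"])
    show "standard_BM P (if c then b else b')" for c using b by simp
    have "case_bool trajectory_space trajectory_space = (\<lambda>_. trajectory_space :: (real \<Rightarrow> real) measure)" by (auto split: bool.split)
    moreover have "case_bool (trajectory b) (trajectory b') = (\<lambda>c. trajectory (if c then b else b'))" by (auto split: bool.split)
    ultimately show "indep_vars (\<lambda>_. trajectory_space) (\<lambda>c. trajectory (if c then b else b')) UNIV"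
      using b(3) unfolding indep_var_def by simp
    show "(if c then b else b') t \<omega> = sqrt 2 * (if c then Re (Z t \<omega>) else Im (Z t \<omega>))" if "t \<ge> 0" "\<omega> \<in> space P" for c t \<omega>
      unfolding b(4)[OF that] by (simp add: Re_divide_of_real Im_divide_of_real)
  qed
qed

text \<open>The coordinates, in the sense of \<open>hermitian_of\<close>, of \<open>a a* - t I\<close> for the column \<open>a\<close> with entries
\<open>(v(i,True) + \<i> v(i,False)) / \<surd>2\<close>.\<close>

definition column_value :: "(nat \<times> bool \<Rightarrow> real) \<Rightarrow> real \<Rightarrow> nat \<Rightarrow> nat \<Rightarrow> real" where
  "column_value v t i j =
    (if i = j then ((v (i, True))\<^sup>2 + (v (i, False))\<^sup>2) / 2 - t
     else if i < j then (v (i, True) * v (j, True) + v (i, False) * v (j, False)) / 2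
     else (v (j, False) * v (i, True) - v (j, True) * v (i, False)) / 2)"

text \<open>The symmetric matrix of the real quadratic form \<open>v \<mapsto> \<Sum>\<^sub>i\<^sub>j w\<^sub>i\<^sub>j column_value v 0 i j\<close>; see \<open>column_form_value\<close>.\<close>

definition column_form :: "(nat \<Rightarrow> nat \<Rightarrow> real) \<Rightarrow> nat \<times> bool \<Rightarrow> nat \<times> bool \<Rightarrow> real" where
  "column_form w p q = (case p of (i, a) \<Rightarrow> case q of (j, b) \<Rightarrow>
     if i = j then (if a = b then w i i / 2 else 0)
     else if a = b then w (min i j) (max i j) / 4
     else if (i < j) = (\<not> a) then w (max i j) (min i j) / 4
     else - w (max i j) (min i j) / 4)"

text \<open>The variance at time \<open>1\<close> of the coordinates of Hermitian Brownian motion: the off-diagonal ones are real and imaginary parts of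
standard complex Brownian motions.\<close>

definition entry_variance :: "nat \<Rightarrow> nat \<Rightarrow> real" where
  "entry_variance i j = (if i = j then 1 else 1 / 2)"

lemma column_form_sym: "column_form w p q = column_form w q p"
  by (cases p; cases q) (auto simp: column_form_def min.commute max.commute)

lemma column_form_sum: "(\<Sum>l\<in>L. column_form (w l) p q) = column_form (\<lambda>i j. \<Sum>l\<in>L. w l i j) p q"
  by (cases p; cases q) (auto simp: column_form_def sum_divide_distrib sum_negf)

lemma sum_symmetrise:
  fixes f g :: "nat \<Rightarrow> nat \<Rightarrow> real"
  assumes "\<And>i j. f i j + f j i = g i j + g j i"
  shows "(\<Sum>i<N. \<Sum>j<N. f i j) = (\<Sum>i<N. \<Sum>j<N. g i j)"
proof -
  have dbl: "2 * (\<Sum>i<N. \<Sum>j<N. h i j) = (\<Sum>i<N. \<Sum>j<N. h i j + h j i)" for h :: "nat \<Rightarrow> nat \<Rightarrow> real"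
  proof -
    have "(\<Sum>i<N. \<Sum>j<N. h i j) = (\<Sum>i<N. \<Sum>j<N. h j i)" by (rule sum.swap)
    then show ?thesis by (simp add: sum.distrib)
  qed
  have "2 * (\<Sum>i<N. \<Sum>j<N. f i j) = 2 * (\<Sum>i<N. \<Sum>j<N. g i j)" unfolding dbl assms ..
  then show ?thesis by simp
qed

lemma sum_coordinates: "(\<Sum>p\<in>{..<N} \<times> (UNIV :: bool set). f p) = (\<Sum>i<N. f (i, True) + f (i, False))"
  by (simp add: sum.cartesian_product' UNIV_bool add.commute)

lemma column_form_value:
  "(\<Sum>p\<in>{..<N} \<times> UNIV. \<Sum>q\<in>{..<N} \<times> UNIV. column_form w p q * (v p * v q - (if p = q then t else 0)))
    = (\<Sum>i<N. \<Sum>j<N. w i j * column_value v t i j)"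
proof -
  define f where "f i j = (\<Sum>a\<in>UNIV. \<Sum>b\<in>UNIV. column_form w (i, a) (j, b) * (v (i, a) * v (j, b) - (if (i, a) = (j, b) then t else 0)))" for i j
  have "(\<Sum>p\<in>{..<N} \<times> UNIV. \<Sum>q\<in>{..<N} \<times> UNIV. column_form w p q * (v p * v q - (if p = q then t else 0))) = (\<Sum>i<N. \<Sum>j<N. f i j)"
    unfolding sum_coordinates f_def by (simp add: UNIV_bool sum.distrib)
  also have "\<dots> = (\<Sum>i<N. \<Sum>j<N. w i j * column_value v t i j)"
  proof (rule sum_symmetrise)
    fix i j :: nat
    consider "i = j" | "i < j" | "j < i" by linarith
    then show "f i j + f j i = w i j * column_value v t i j + w j i * column_value v t j i"
      by cases (simp_all add: f_def UNIV_bool column_form_def column_value_def min_def max_def power2_eq_square algebra_simps add_divide_distrib diff_divide_distrib)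
  qed
  finally show ?thesis .
qed

text \<open>The variances of the two models agree because of this identity: by \<open>gaussian_quadratic_form\<close> the left-hand side is the variance of
the quadratic form, the right-hand side that of \<open>\<Sum>\<^sub>i\<^sub>j w\<^sub>i\<^sub>j X\<^sub>i\<^sub>j\<close> for the coordinates
\<open>X\<^sub>i\<^sub>j\<close> of Hermitian Brownian motion at time \<open>1\<close>.\<close>

lemma column_form_norm:
  "2 * (\<Sum>p\<in>{..<N} \<times> UNIV. \<Sum>q\<in>{..<N} \<times> UNIV. (column_form w p q)\<^sup>2) = (\<Sum>i<N. \<Sum>j<N. entry_variance i j * (w i j)\<^sup>2)"
proof -
  define f where "f i j = 2 * (\<Sum>a\<in>UNIV. \<Sum>b\<in>UNIV. (column_form w (i, a) (j, b))\<^sup>2)" for i j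
  have "2 * (\<Sum>p\<in>{..<N} \<times> UNIV. \<Sum>q\<in>{..<N} \<times> UNIV. (column_form w p q)\<^sup>2) = (\<Sum>i<N. \<Sum>j<N. f i j)"
    unfolding sum_coordinates f_def by (simp add: UNIV_bool sum.distrib sum_distrib_left)
  also have "\<dots> = (\<Sum>i<N. \<Sum>j<N. entry_variance i j * (w i j)\<^sup>2)"
  proof (rule sum_symmetrise)
    fix i j :: nat
    consider "i = j" | "i < j" | "j < i" by linarith
    then show "f i j + f j i = entry_variance i j * (w i j)\<^sup>2 + entry_variance j i * (w j i)\<^sup>2"
      by cases (simp_all add: f_def UNIV_bool column_form_def entry_variance_def min_def max_def power_divide)
  qed
  finally show ?thesis .
qed

definition column_moment_bound :: "nat \<Rightarrow> nat \<Rightarrow> (nat \<Rightarrow> real) \<Rightarrow> (nat \<Rightarrow> nat \<Rightarrow> nat \<Rightarrow> real) \<Rightarrow> real" where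
  "column_moment_bound N n \<tau> w = 1688 * real (2 * N * n) ^ 6 *
     (\<Sum>p\<in>{..<N} \<times> UNIV. \<Sum>q\<in>{..<N} \<times> UNIV. \<Sum>m<n. \<Sum>m'<n.
        column_form (\<lambda>i j. \<Sum>l\<in>{max m m'<..n}. w l i j) p q ^ 4 *
          ((\<tau> (Suc m) - \<tau> m)\<^sup>2 * (\<tau> (Suc m') - \<tau> m')\<^sup>2))"

text \<open>The variance of \<open>\<Sum>\<^sub>l\<^sub>i\<^sub>j w\<^sub>l\<^sub>i\<^sub>j X\<^sub>i\<^sub>j(\<tau>\<^sub>l\<^sup>2)\<close>, with \<open>X\<^sub>i\<^sub>j\<close> the coordinates of Hermitian Brownian motion, after summation by parts: the increment of \<open>X\<close>
over \<open>[\<tau>\<^sub>m\<^sup>2, \<tau>\<^bsub>m+1\<^esub>\<^sup>2]\<close> occurs in all \<open>X(\<tau>\<^sub>l\<^sup>2)\<close> with \<open>l > m\<close>.\<close>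

definition limit_variance :: "nat \<Rightarrow> nat \<Rightarrow> (nat \<Rightarrow> real) \<Rightarrow> (nat \<Rightarrow> nat \<Rightarrow> nat \<Rightarrow> real) \<Rightarrow> real" where
  "limit_variance N n \<tau> w = (\<Sum>m<n. (\<Sum>i<N. \<Sum>j<N. entry_variance i j * (\<Sum>l\<in>{m<..n}. w l i j)\<^sup>2) * ((\<tau> (Suc m))\<^sup>2 - (\<tau> m)\<^sup>2))"

lemma column_functional:
  fixes w :: "nat \<Rightarrow> nat \<Rightarrow> nat \<Rightarrow> real" and \<tau> :: "nat \<Rightarrow> real"
  assumes fam: "bm_family P \<beta> ({..<N} \<times> UNIV)" and \<tau>: "\<tau> 0 = 0" "\<And>m. m < n \<Longrightarrow> \<tau> m < \<tau> (Suc m)"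
  defines "\<Phi> \<equiv> \<lambda>\<omega>. \<Sum>l\<le>n. \<Sum>i<N. \<Sum>j<N. w l i j * column_value (\<lambda>p. \<beta> p (\<tau> l) \<omega>) (\<tau> l) i j"
  shows "\<Phi> \<in> borel_measurable P" "(\<integral>\<omega>. \<Phi> \<omega> \<partial>P) = 0"
    "(\<integral>\<omega>. (\<Phi> \<omega>)\<^sup>2 \<partial>P) = limit_variance N n \<tau> w"
    "integrable P (\<lambda>\<omega>. \<Phi> \<omega> ^ 4)"
    "(\<integral>\<omega>. \<Phi> \<omega> ^ 4 \<partial>P) \<le> column_moment_bound N n \<tau> w"
proof -
  let ?J = "{..<N} \<times> (UNIV :: bool set)"
  define U where "U m i j = (\<Sum>l\<in>{m<..n}. w l i j)" for m i j
  have U: "U m = (\<lambda>i j. \<Sum>l\<in>{m<..n}. w l i j)" for m by (simp add: U_def[abs_def])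
  have \<Phi>: "\<Phi> = (\<lambda>\<omega>. \<Sum>l\<le>n. \<Sum>p\<in>?J. \<Sum>q\<in>?J. column_form (w l) p q * (\<beta> p (\<tau> l) \<omega> * \<beta> q (\<tau> l) \<omega> - (if p = q then \<tau> l else 0)))"
    unfolding \<Phi>_def by (simp only: column_form_value)
  have fin: "finite ?J" by simp
  have T: "(\<Sum>l\<in>{m<..n}. column_form (w l) p q) = column_form (U m) p q" for m p q
    unfolding U by (rule column_form_sum)
  note Q = bm_quadratic[where \<tau> = \<tau> and n = n and S = "\<lambda>l. column_form (w l)", OF fam fin \<tau>(1), unfolded T]
  have c: "real (card ?J * n) = real (2 * N * n)" by (simp add: card_cartesian_product mult_ac)
  show "\<Phi> \<in> borel_measurable P" unfolding \<Phi> using Q(1) \<tau>(2) column_form_sym by blast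
  show "(\<integral>\<omega>. \<Phi> \<omega> \<partial>P) = 0" unfolding \<Phi> using Q(2) \<tau>(2) column_form_sym by blast
  show "integrable P (\<lambda>\<omega>. \<Phi> \<omega> ^ 4)" unfolding \<Phi> using Q(4) \<tau>(2) column_form_sym by blast
  have "(\<integral>\<omega>. (\<Phi> \<omega>)\<^sup>2 \<partial>P) = 2 * (\<Sum>m<n. (\<Sum>p\<in>?J. \<Sum>q\<in>?J. (column_form (U m) p q)\<^sup>2) * ((\<tau> (Suc m))\<^sup>2 - (\<tau> m)\<^sup>2))"
    unfolding \<Phi> using Q(3) \<tau>(2) column_form_sym by blast
  then show "(\<integral>\<omega>. (\<Phi> \<omega>)\<^sup>2 \<partial>P) = limit_variance N n \<tau> w"
    unfolding limit_variance_def U_def[symmetric] column_form_norm[symmetric] by (simp only: mult.assoc sum_distrib_left[where A = "{..<n}"])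
  show "(\<integral>\<omega>. \<Phi> \<omega> ^ 4 \<partial>P) \<le> column_moment_bound N n \<tau> w"
    unfolding \<Phi> column_moment_bound_def U[symmetric] c[symmetric] using Q(5) \<tau>(2) column_form_sym by blast
qed

section \<open>The Laguerre process as a normalised sum over columns\<close>

definition scaled_columns :: "nat \<Rightarrow> ((nat \<times> nat) \<times> bool \<Rightarrow> real \<Rightarrow> 'a \<Rightarrow> real) \<Rightarrow> nat \<Rightarrow> nat \<Rightarrow> real \<Rightarrow> 'a \<Rightarrow> real" where
  "scaled_columns M \<beta> i j t \<omega> = (\<Sum>k<M. column_value (\<lambda>(a, c). \<beta> ((a, k), c) t \<omega>) t i j) / sqrt (real M)"

definition column_sum ::
    "nat \<Rightarrow> ((nat \<times> nat) \<times> bool \<Rightarrow> real \<Rightarrow> 'a \<Rightarrow> real) \<Rightarrow> nat \<Rightarrow> (nat \<Rightarrow> real) \<Rightarrow> (nat \<Rightarrow> nat \<Rightarrow> nat \<Rightarrow> real) \<Rightarrow> nat \<Rightarrow> 'a \<Rightarrow> real" where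
  "column_sum N \<beta> n \<tau> w k \<omega> =
     (\<Sum>l\<le>n. \<Sum>i<N. \<Sum>j<N. w l i j * column_value (\<lambda>(a, c). \<beta> ((a, k), c) (\<tau> l) \<omega>) (\<tau> l) i j)"

lemma scaled_columns_linear:
  "(\<Sum>l\<le>n. \<Sum>i<N. \<Sum>j<N. w l i j * scaled_columns M \<beta> i j (\<tau> l) \<omega>)
    = (\<Sum>k<M. column_sum N \<beta> n \<tau> w k \<omega>) / sqrt (real M)"
proof -
  have "(\<Sum>l\<le>n. \<Sum>i<N. \<Sum>j<N. w l i j * scaled_columns M \<beta> i j (\<tau> l) \<omega>)
    = (\<Sum>l\<le>n. \<Sum>i<N. \<Sum>j<N. \<Sum>k<M. w l i j * column_value (\<lambda>(a, c). \<beta> ((a, k), c) (\<tau> l) \<omega>) (\<tau> l) i j) / sqrt (real M)"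
    by (simp add: scaled_columns_def sum_divide_distrib sum_distrib_left)
  also have "(\<Sum>l\<le>n. \<Sum>i<N. \<Sum>j<N. \<Sum>k<M. w l i j * column_value (\<lambda>(a, c). \<beta> ((a, k), c) (\<tau> l) \<omega>) (\<tau> l) i j)
     = (\<Sum>l\<le>n. \<Sum>i<N. \<Sum>k<M. \<Sum>j<N. w l i j * column_value (\<lambda>(a, c). \<beta> ((a, k), c) (\<tau> l) \<omega>) (\<tau> l) i j)"
    by (rule sum.cong[OF refl], rule sum.cong[OF refl], rule sum.swap)
  also have "\<dots> = (\<Sum>l\<le>n. \<Sum>k<M. \<Sum>i<N. \<Sum>j<N. w l i j * column_value (\<lambda>(a, c). \<beta> ((a, k), c) (\<tau> l) \<omega>) (\<tau> l) i j)"
    by (rule sum.cong[OF refl], rule sum.swap)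
  also have "\<dots> = (\<Sum>k<M. column_sum N \<beta> n \<tau> w k \<omega>)"
    unfolding column_sum_def by (rule sum.swap)
  finally show ?thesis .
qed

lemma column_family:
  assumes fam: "bm_family P \<beta> (({..<N} \<times> {..<M}) \<times> UNIV)" and k: "k < M"
  shows "bm_family P (\<lambda>(a, c). \<beta> ((a, k), c)) ({..<N} \<times> UNIV)"
proof -
  have "bm_family P (\<lambda>p. \<beta> ((\<lambda>(a, c). ((a, k), c)) p)) ({..<N} \<times> UNIV)"
    by (rule bm_family_reindex[OF fam]) (use k in \<open>auto simp: inj_on_def\<close>)
  then show ?thesis by (simp add: case_prod_beta')
qed

lemma column_sum_moments:
  fixes w :: "nat \<Rightarrow> nat \<Rightarrow> nat \<Rightarrow> real" and \<tau> :: "nat \<Rightarrow> real"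
  assumes fam: "bm_family P \<beta> (({..<N} \<times> {..<M}) \<times> UNIV)" and k: "k < M"
    and \<tau>: "\<tau> 0 = 0" "\<And>m. m < n \<Longrightarrow> \<tau> m < \<tau> (Suc m)"
  shows "column_sum N \<beta> n \<tau> w k \<in> borel_measurable P" "(\<integral>\<omega>. column_sum N \<beta> n \<tau> w k \<omega> \<partial>P) = 0"
    "(\<integral>\<omega>. (column_sum N \<beta> n \<tau> w k \<omega>)\<^sup>2 \<partial>P) = limit_variance N n \<tau> w"
    "integrable P (\<lambda>\<omega>. column_sum N \<beta> n \<tau> w k \<omega> ^ 4)"
    "(\<integral>\<omega>. column_sum N \<beta> n \<tau> w k \<omega> ^ 4 \<partial>P) \<le> column_moment_bound N n \<tau> w"
proof -
  have c: "column_sum N \<beta> n \<tau> w k = (\<lambda>\<omega>. \<Sum>l\<le>n. \<Sum>i<N. \<Sum>j<N. w l i j * column_value (\<lambda>p. (\<lambda>(a, c). \<beta> ((a, k), c)) p (\<tau> l) \<omega>) (\<tau> l) i j)"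
    by (auto simp: column_sum_def case_prod_beta')
  note F = column_functional[where \<tau> = \<tau> and n = n and w = w, OF column_family[OF fam k] \<tau>(1)]
  show "column_sum N \<beta> n \<tau> w k \<in> borel_measurable P" unfolding c using F(1) \<tau>(2) by blast
  show "(\<integral>\<omega>. column_sum N \<beta> n \<tau> w k \<omega> \<partial>P) = 0" unfolding c using F(2) \<tau>(2) by blast
  show "(\<integral>\<omega>. (column_sum N \<beta> n \<tau> w k \<omega>)\<^sup>2 \<partial>P) = limit_variance N n \<tau> w"
    unfolding c using F(3) \<tau>(2) by blast
  show "integrable P (\<lambda>\<omega>. column_sum N \<beta> n \<tau> w k \<omega> ^ 4)" unfolding c using F(4) \<tau>(2) by blast
  show "(\<integral>\<omega>. column_sum N \<beta> n \<tau> w k \<omega> ^ 4 \<partial>P) \<le> column_moment_bound N n \<tau> w"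
    unfolding c using F(5) \<tau>(2) by blast
qed

text \<open>Different columns use disjoint parts of the family of Brownian motions, and \<open>column_sum\<close> is a measurable function of their
trajectories at finitely many times.\<close>

lemma column_sums_independent:
  assumes fam: "bm_family P \<beta> (({..<N} \<times> {..<M}) \<times> UNIV)" and \<tau>: "\<And>l. l \<le> n \<Longrightarrow> \<tau> l \<ge> 0"
  shows "prob_space.indep_vars P (\<lambda>_. borel) (column_sum N \<beta> n \<tau> w) {..<M}"
proof -
  interpret prob_space P using fam by (simp add: bm_family_def)
  define K where "K k = ({..<N} \<times> {k}) \<times> (UNIV :: bool set)" for k :: nat
  define h where "h k v = (\<Sum>l\<le>n. \<Sum>i<N. \<Sum>j<N. w l i j * column_value (\<lambda>(a, c). v ((a, k), c) (\<tau> l)) (\<tau> l) i j)"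
    for k and v :: "(nat \<times> nat) \<times> bool \<Rightarrow> real \<Rightarrow> real"
  have r: "indep_vars (\<lambda>k. PiM (K k) (\<lambda>_. trajectory_space)) (\<lambda>k \<omega>. restrict (\<lambda>p. trajectory (\<beta> p) \<omega>) (K k)) {..<M}"
    by (rule indep_vars_restrict[where I = "({..<N} \<times> {..<M}) \<times> UNIV"])
      (use fam in \<open>auto simp: bm_family_def independent_processes_def K_def disjoint_family_on_def\<close>)
  have hm: "h k \<in> borel_measurable (PiM (K k) (\<lambda>_. trajectory_space))" for k
  proof -
    have c: "(\<lambda>v :: (nat \<times> nat) \<times> bool \<Rightarrow> real \<Rightarrow> real. v ((a, k), c) (\<tau> l)) \<in> borel_measurable (PiM (K k) (\<lambda>_. trajectory_space))" if "a < N" "l \<le> n" for a c l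
    proof -
      have 1: "(\<lambda>v. v ((a, k), c)) \<in> measurable (PiM (K k) (\<lambda>_. trajectory_space)) (trajectory_space :: (real \<Rightarrow> real) measure)"
        by (rule measurable_component_singleton) (use that in \<open>simp add: K_def\<close>)
      have 2: "(\<lambda>z. z (\<tau> l)) \<in> measurable trajectory_space (borel :: real measure)"
        by (rule measurable_component_singleton) (use \<tau>[OF that(2)] in simp)
      show ?thesis by (rule measurable_compose[OF 1 2])
    qed
    have "(\<lambda>v :: (nat \<times> nat) \<times> bool \<Rightarrow> real \<Rightarrow> real. column_value (\<lambda>(a, c). v ((a, k), c) (\<tau> l)) (\<tau> l) i j) \<in> borel_measurable (PiM (K k) (\<lambda>_. trajectory_space))"
      if "i < N" "j < N" "l \<le> n" for i j l
      unfolding column_value_def using c[OF that(1,3)] c[OF that(2,3)]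
      by (cases "i = j"; cases "i < j") simp_all
    then show ?thesis unfolding h_def[abs_def]
      by (intro borel_measurable_sum borel_measurable_times borel_measurable_const) auto
  qed
  have "indep_vars (\<lambda>_. borel) (\<lambda>k \<omega>. h k (restrict (\<lambda>p. trajectory (\<beta> p) \<omega>) (K k))) {..<M}"
    by (rule indep_vars_compose2[OF r hm])
  then show ?thesis
  proof (rule indep_vars_cong_space)
    fix k \<omega>
    show "column_sum N \<beta> n \<tau> w k \<omega> = h k (restrict (\<lambda>p. trajectory (\<beta> p) \<omega>) (K k))"
      unfolding column_sum_def h_def
    proof (intro sum.cong refl arg_cong2[where f = "(*)"])
      fix l i j assume "l \<in> {..n}" "i \<in> {..<N}" "j \<in> {..<N}"
      then show "column_value (\<lambda>(a, c). \<beta> ((a, k), c) (\<tau> l) \<omega>) (\<tau> l) i j =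
         column_value (\<lambda>(a, c). restrict (\<lambda>p. trajectory (\<beta> p) \<omega>) (K k) ((a, k), c) (\<tau> l)) (\<tau> l) i j"
        using \<tau>[of l] by (simp add: column_value_def K_def trajectory_apply)
    qed
  qed
qed

definition tightness_constant :: "nat \<Rightarrow> nat \<Rightarrow> real" where
  "tightness_constant N k = 1688 * real (4 * N) ^ 6 * (real (2 * N))\<^sup>2 * (3 * (real k)\<^sup>2)"

lemma column_form_le_1:
  assumes "\<And>i j. \<bar>w i j\<bar> \<le> 1"
  shows "column_form w p q ^ 4 \<le> 1"
proof -
  have b: "\<bar>w i j / 2\<bar> \<le> 1" "\<bar>w i j / 4\<bar> \<le> 1" for i j using assms[of i j] by auto
  have "\<bar>column_form w p q\<bar> \<le> 1"
    by (cases p; cases q) (auto simp: column_form_def b simp del: abs_divide)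
  then have "\<bar>column_form w p q\<bar> ^ 4 \<le> 1" by (intro power_le_one) auto
  then show ?thesis by simp
qed

text \<open>An increment of a column over \<open>[s,t]\<close> is a quadratic functional for the grid \<open>0 < s < t\<close> with weights \<open>-1\<close> and \<open>1\<close>. The weights
cancel on the increments before \<open>s\<close>, so every term of the quadratic form involves an increment over \<open>[s,t]\<close>; this yields the
factor \<open>(t - s)\<^sup>2\<close>. For \<open>s = 0\<close> this grid would not be strictly increasing, and the grid \<open>0 < t\<close> takes its place.\<close>

lemma column_increment:
  assumes fam: "bm_family P \<beta> (({..<N} \<times> {..<M}) \<times> UNIV)" and st: "0 \<le> s" "s < t" "t \<le> real K"
    and ij: "i0 < N" "j0 < N"
  obtains n \<tau> w where "\<tau> 0 = 0" "\<And>m. m < n \<Longrightarrow> \<tau> m < \<tau> (Suc m)"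
    "\<And>k \<omega>. k < M \<Longrightarrow> \<omega> \<in> space P \<Longrightarrow> column_sum N \<beta> n \<tau> w k \<omega>
       = column_value (\<lambda>(a, c). \<beta> ((a, k), c) t \<omega>) t i0 j0 - column_value (\<lambda>(a, c). \<beta> ((a, k), c) s \<omega>) s i0 j0"
    "\<And>k. k < M \<Longrightarrow> (\<integral>\<omega>. column_sum N \<beta> n \<tau> w k \<omega> ^ 4 \<partial>P) \<le> tightness_constant N K * (t - s)\<^sup>2"
proof -
  define e where "e i j = (if i = i0 \<and> j = j0 then 1 else (0::real))" for i j
  have e1: "\<bar>e i j\<bar> \<le> 1" for i j by (simp add: e_def)
  have e_sum: "(\<Sum>i<N. \<Sum>j<N. (x * e i j) * f i j) = x * f i0 j0" for x f
  proof -
    have "(\<Sum>i<N. \<Sum>j<N. (x * e i j) * f i j) = (\<Sum>i<N. if i = i0 then \<Sum>j<N. if j = j0 then x * f i j else 0 else 0)"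
    proof (intro sum.cong refl)
      fix i
      have "(\<Sum>j<N. (x * e i j) * f i j) = (\<Sum>j<N. if j = j0 then if i = i0 then x * f i j else 0 else 0)"
        by (intro sum.cong refl) (simp add: e_def)
      then show "(\<Sum>j<N. (x * e i j) * f i j) = (if i = i0 then \<Sum>j<N. if j = j0 then x * f i j else 0 else 0)"
        by simp
    qed
    also have "\<dots> = x * f i0 j0" using ij by simp
    finally show ?thesis .
  qed
  have N: "N \<ge> 1" using ij by auto
  have tK: "(t - s)\<^sup>2 \<le> (real K)\<^sup>2" using st by (intro power_mono) auto
  let ?J = "{..<N} \<times> (UNIV :: bool set)"
  have card: "real (card ?J) = real (2 * N)" by (simp add: card_cartesian_product)
  show thesis
  proof (cases "s = 0")
    case True
    define \<tau> where "\<tau> l = (if l = 0 then 0 else t)" for l :: nat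
    define w where "w l i j = real l * e i j" for l :: nat and i j
    have inc: "\<tau> m < \<tau> (Suc m)" if "m < 1" for m using that st by (simp add: \<tau>_def)
    show thesis
    proof (rule that[of \<tau> 1 w])
      show "\<tau> 0 = 0" by (simp add: \<tau>_def)
      show "\<tau> m < \<tau> (Suc m)" if "m < 1" for m by (rule inc[OF that])
      fix k assume k: "k < M"
      show "column_sum N \<beta> 1 \<tau> w k \<omega>
       = column_value (\<lambda>(a, c). \<beta> ((a, k), c) t \<omega>) t i0 j0 - column_value (\<lambda>(a, c). \<beta> ((a, k), c) s \<omega>) s i0 j0"
        if \<omega>: "\<omega> \<in> space P" for \<omega>
      proof -
        have "\<beta> ((a, k), c) 0 \<omega> = 0" if "a < N" for a c
          using fam k \<omega> that by (auto simp: bm_family_def standard_BM_def)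
        then have "column_value (\<lambda>(a, c). \<beta> ((a, k), c) s \<omega>) s i0 j0 = 0"
          using ij by (simp add: True column_value_def)
        then show ?thesis unfolding column_sum_def w_def e_sum by (simp add: \<tau>_def)
      qed
      have U: "(\<lambda>i j. \<Sum>l\<in>{m<..1}. w l i j) = e" if "m < 1" for m
      proof -
        have "{m<..1} = {1::nat}" using that by auto
        then show ?thesis by (simp add: w_def)
      qed
      have "(\<integral>\<omega>. column_sum N \<beta> 1 \<tau> w k \<omega> ^ 4 \<partial>P) \<le> 1688 * real (2 * N * 1) ^ 6 *
       (\<Sum>p\<in>?J. \<Sum>q\<in>?J. \<Sum>m<1. \<Sum>m'<1. column_form (\<lambda>i j. \<Sum>l\<in>{max m m'<..1}. w l i j) p q ^ 4 *
          ((\<tau> (Suc m) - \<tau> m)\<^sup>2 * (\<tau> (Suc m') - \<tau> m')\<^sup>2))"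
        by (rule column_sum_moments(5)[OF fam k, unfolded column_moment_bound_def]) (use inc in \<open>auto simp: \<tau>_def\<close>)
      also have "\<dots> = 1688 * real (2 * N) ^ 6 * (\<Sum>p\<in>?J. \<Sum>q\<in>?J. column_form e p q ^ 4 * ((t - s)\<^sup>2 * (t - s)\<^sup>2))"
        using U[of 0] by (simp add: \<tau>_def True)
      also have "\<dots> \<le> 1688 * real (4 * N) ^ 6 * (\<Sum>p\<in>?J. \<Sum>q\<in>?J. 1 * ((t - s)\<^sup>2 * (3 * (real K)\<^sup>2)))"
      proof (intro mult_mono sum_mono)
        show "(t - s)\<^sup>2 \<le> 3 * (real K)\<^sup>2" using tK zero_le_power2[of "real K"] by linarith
        show "column_form e p q ^ 4 \<le> 1" for p q using e1 by (rule column_form_le_1)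
      qed (auto intro!: power_mono sum_nonneg mult_nonneg_nonneg)
      also have "\<dots> = tightness_constant N K * (t - s)\<^sup>2"
        by (simp add: tightness_constant_def card power2_eq_square)
      finally show "(\<integral>\<omega>. column_sum N \<beta> 1 \<tau> w k \<omega> ^ 4 \<partial>P) \<le> tightness_constant N K * (t - s)\<^sup>2" .
    qed
  next
    case False
    then have s: "s > 0" using st by simp
    define \<tau> where "\<tau> l = (if l = 0 then 0 else if l = 1 then s else t)" for l :: nat
    define x where "x l = (if l = 1 then - 1 else if l = 2 then 1 else (0::real))" for l :: nat
    define w where "w l i j = x l * e i j" for l :: nat and i j
    have inc: "\<tau> m < \<tau> (Suc m)" if "m < 2" for m using that st s by (auto simp: \<tau>_def)
    have s2: "(\<Sum>l\<le>2. f l) = f 0 + f 1 + f (2::nat)" for f :: "nat \<Rightarrow> real"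
      by (simp add: numeral_2_eq_2)
    have s2': "(\<Sum>l<2. f l) = f 0 + f (1::nat)" for f :: "nat \<Rightarrow> real"
      by (simp add: numeral_2_eq_2)
    show thesis
    proof (rule that[of \<tau> 2 w])
      show "\<tau> 0 = 0" by (simp add: \<tau>_def)
      show "\<tau> m < \<tau> (Suc m)" if "m < 2" for m by (rule inc[OF that])
      fix k assume k: "k < M"
      show "column_sum N \<beta> 2 \<tau> w k \<omega>
       = column_value (\<lambda>(a, c). \<beta> ((a, k), c) t \<omega>) t i0 j0 - column_value (\<lambda>(a, c). \<beta> ((a, k), c) s \<omega>) s i0 j0" for \<omega>
        unfolding column_sum_def w_def e_sum s2 by (simp add: \<tau>_def x_def)
      have "{0<..2} = {1, 2::nat}" "{1<..2} = {2::nat}" by auto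
      then have U0: "(\<lambda>i j. \<Sum>l\<in>{0<..2}. w l i j) = (\<lambda>i j. 0)" and U1: "(\<lambda>i j. \<Sum>l\<in>{1<..2}. w l i j) = e"
        by (simp_all add: w_def x_def)
      have c0: "column_form (\<lambda>i j. 0) p q = 0" for p q by (cases p; cases q) (simp add: column_form_def)
      have "(\<integral>\<omega>. column_sum N \<beta> 2 \<tau> w k \<omega> ^ 4 \<partial>P) \<le> 1688 * real (2 * N * 2) ^ 6 *
       (\<Sum>p\<in>?J. \<Sum>q\<in>?J. \<Sum>m<2. \<Sum>m'<2. column_form (\<lambda>i j. \<Sum>l\<in>{max m m'<..2}. w l i j) p q ^ 4 *
          ((\<tau> (Suc m) - \<tau> m)\<^sup>2 * (\<tau> (Suc m') - \<tau> m')\<^sup>2))"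
        by (rule column_sum_moments(5)[OF fam k, unfolded column_moment_bound_def]) (use inc in \<open>auto simp: \<tau>_def\<close>)
      also have "\<dots> = 1688 * real (4 * N) ^ 6 * (\<Sum>p\<in>?J. \<Sum>q\<in>?J. column_form e p q ^ 4 * ((t - s)\<^sup>2 * (2 * s\<^sup>2 + (t - s)\<^sup>2)))"
      proof -
        have m: "max 0 1 = (1::nat)" "max 1 0 = (1::nat)" "max 1 1 = (1::nat)" "max 0 0 = (0::nat)" by auto
        have "(\<Sum>m<2. \<Sum>m'<2. column_form (\<lambda>i j. \<Sum>l\<in>{max m m'<..2}. w l i j) p q ^ 4 *
          ((\<tau> (Suc m) - \<tau> m)\<^sup>2 * (\<tau> (Suc m') - \<tau> m')\<^sup>2)) = column_form e p q ^ 4 * ((t - s)\<^sup>2 * (2 * s\<^sup>2 + (t - s)\<^sup>2))" for p q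
          unfolding s2' m U0 U1 c0 by (simp add: \<tau>_def algebra_simps)
        then show ?thesis by simp
      qed
      also have "\<dots> \<le> 1688 * real (4 * N) ^ 6 * (\<Sum>p\<in>?J. \<Sum>q\<in>?J. 1 * ((t - s)\<^sup>2 * (3 * (real K)\<^sup>2)))"
      proof (intro mult_left_mono sum_mono mult_mono)
        have "s\<^sup>2 \<le> (real K)\<^sup>2" using st by (intro power_mono) auto
        then show "2 * s\<^sup>2 + (t - s)\<^sup>2 \<le> 3 * (real K)\<^sup>2" using tK by linarith
        show "column_form e p q ^ 4 \<le> 1" for p q using e1 by (rule column_form_le_1)
      qed auto
      also have "\<dots> = tightness_constant N K * (t - s)\<^sup>2"
        by (simp add: tightness_constant_def card power2_eq_square)
      finally show "(\<integral>\<omega>. column_sum N \<beta> 2 \<tau> w k \<omega> ^ 4 \<partial>P) \<le> tightness_constant N K * (t - s)\<^sup>2" .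
    qed
  qed
qed

lemma grid_nonneg:
  fixes \<tau> :: "nat \<Rightarrow> real"
  assumes "\<tau> 0 = 0" "\<And>m. m < n \<Longrightarrow> \<tau> m < \<tau> (Suc m)" "l \<le> n"
  shows "0 \<le> \<tau> l"
  using assms(3)
proof (induction l)
  case (Suc l)
  then show ?case using assms(2)[of l] by simp
qed (use assms(1) in simp)

lemma matrix_process_scaled_columns:
  assumes fam: "bm_family P \<beta> (({..<N} \<times> {..<M}) \<times> UNIV)" and M: "M > 0"
    and C: "\<And>k. 3 * tightness_constant N k \<le> C k"
  shows "matrix_process P N C (scaled_columns M \<beta>)"
  unfolding matrix_process_def
proof (intro conjI allI impI ballI)
  interpret prob_space P using fam by (simp add: bm_family_def)
  show "prob_space P" by (rule prob_space_axioms)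
  have bm: "standard_BM P (\<beta> ((a, k), c))" if "a < N" "k < M" for a k c
    using fam that by (auto simp: bm_family_def)
  fix i j assume ij: "i < N" "j < N"
  show "scaled_columns M \<beta> i j t \<in> borel_measurable P" if t: "0 \<le> t" for t
  proof -
    have "(\<lambda>\<omega>. column_value (\<lambda>(a, c). \<beta> ((a, k), c) t \<omega>) t i j) \<in> borel_measurable P" if k: "k < M" for k
    proof -
      have b: "\<beta> ((a, k), c) t \<in> borel_measurable P" if "a < N" for a c
        using bm[OF that k] t by (simp add: standard_BM_def)
      show ?thesis unfolding column_value_def using b[OF ij(1)] b[OF ij(2)]
        by (cases "i = j"; cases "i < j") simp_all
    qed
    then show ?thesis unfolding scaled_columns_def[abs_def] by simp
  qed
  show "scaled_columns M \<beta> i j 0 \<omega> = 0" if \<omega>: "\<omega> \<in> space P" for \<omega>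
  proof -
    have "\<beta> ((a, k), c) 0 \<omega> = 0" if "a < N" "k < M" for a k c
      using bm[OF that] \<omega> by (simp add: standard_BM_def)
    then have "column_value (\<lambda>(a, c). \<beta> ((a, k), c) 0 \<omega>) 0 i j = 0" if "k < M" for k
      using ij that by (simp add: column_value_def)
    then show ?thesis by (simp add: scaled_columns_def)
  qed
  show "continuous_on {0..} (\<lambda>t. scaled_columns M \<beta> i j t \<omega>)" if \<omega>: "\<omega> \<in> space P" for \<omega>
  proof -
    have "continuous_on {0..} (\<lambda>t. column_value (\<lambda>(a, c). \<beta> ((a, k), c) t \<omega>) t i j)" if k: "k < M" for k
    proof -
      have b: "continuous_on {0..} (\<lambda>t. \<beta> ((a, k), c) t \<omega>)" if "a < N" for a c
        using bm[OF that k] \<omega> by (simp add: standard_BM_def)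
      show ?thesis unfolding column_value_def using b[OF ij(1)] b[OF ij(2)]
        by (cases "i = j"; cases "i < j") (auto intro!: continuous_intros)
    qed
    then show ?thesis unfolding scaled_columns_def using M by (intro continuous_intros) auto
  qed
  fix K :: nat and s t :: real assume st: "0 \<le> s \<and> s < t \<and> t \<le> real K"
  then have st': "0 \<le> s" "s < t" "t \<le> real K" by auto
  have "integrable P (\<lambda>\<omega>. (scaled_columns M \<beta> i j t \<omega> - scaled_columns M \<beta> i j s \<omega>) ^ 4) \<and>
     (\<integral>\<omega>. (scaled_columns M \<beta> i j t \<omega> - scaled_columns M \<beta> i j s \<omega>) ^ 4 \<partial>P) \<le> C K * (t - s)\<^sup>2"
  proof (rule column_increment[OF fam st' ij])
    fix n :: nat and \<tau> :: "nat \<Rightarrow> real" and w :: "nat \<Rightarrow> nat \<Rightarrow> nat \<Rightarrow> real"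
    assume \<tau>: "\<tau> 0 = 0" "\<And>m. m < n \<Longrightarrow> \<tau> m < \<tau> (Suc m)"
      and inc: "\<And>k \<omega>. k < M \<Longrightarrow> \<omega> \<in> space P \<Longrightarrow> column_sum N \<beta> n \<tau> w k \<omega>
       = column_value (\<lambda>(a, c). \<beta> ((a, k), c) t \<omega>) t i j - column_value (\<lambda>(a, c). \<beta> ((a, k), c) s \<omega>) s i j"
      and m4: "\<And>k. k < M \<Longrightarrow> (\<integral>\<omega>. column_sum N \<beta> n \<tau> w k \<omega> ^ 4 \<partial>P) \<le> tightness_constant N K * (t - s)\<^sup>2"
    have K: "K > 0" using st by (cases K) auto
    have D: "tightness_constant N K > 0" using ij K by (simp add: tightness_constant_def)
    define r where "r = sqrt (tightness_constant N K) * (t - s)"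
    have r: "r > 0" "r\<^sup>2 = tightness_constant N K * (t - s)\<^sup>2" using D st by (simp_all add: r_def power_mult_distrib)
    define S where "S \<omega> = (\<Sum>k<M. column_sum N \<beta> n \<tau> w k \<omega>)" for \<omega>
    have S: "integrable P (\<lambda>\<omega>. S \<omega> ^ 4)" "(\<integral>\<omega>. S \<omega> ^ 4 \<partial>P) \<le> 3 * (real M)\<^sup>2 * r\<^sup>2"
    proof -
      have \<tau>0: "0 \<le> \<tau> l" if "l \<le> n" for l using \<tau> that by (rule grid_nonneg)
      have cm: "integrable P (\<lambda>\<omega>. column_sum N \<beta> n \<tau> w k \<omega> ^ 4)" "(\<integral>\<omega>. column_sum N \<beta> n \<tau> w k \<omega> \<partial>P) = 0" if "k < M" for k
        using column_sum_moments(2,4)[where \<tau> = \<tau> and n = n and w = w, OF fam that \<tau>(1)] \<tau>(2) by blast+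
      show "integrable P (\<lambda>\<omega>. S \<omega> ^ 4)" "(\<integral>\<omega>. S \<omega> ^ 4 \<partial>P) \<le> 3 * (real M)\<^sup>2 * r\<^sup>2"
        using sum_fourth_moment[OF column_sums_independent[where \<tau> = \<tau> and n = n and w = w, OF fam \<tau>0] cm _ r(1)] m4 r(2)
        unfolding S_def by auto
    qed
    have eq: "(scaled_columns M \<beta> i j t \<omega> - scaled_columns M \<beta> i j s \<omega>) ^ 4 = S \<omega> ^ 4 / (real M)\<^sup>2" if "\<omega> \<in> space P" for \<omega>
    proof -
      have "scaled_columns M \<beta> i j t \<omega> - scaled_columns M \<beta> i j s \<omega> = S \<omega> / sqrt (real M)"
        using inc[OF _ that] by (simp add: scaled_columns_def S_def sum_subtractf diff_divide_distrib)
      moreover have "sqrt (real M) ^ 4 = (real M)\<^sup>2" by (simp add: power4_eq_xxxx power2_eq_square)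
      ultimately show ?thesis by (simp add: power_divide)
    qed
    have "integrable P (\<lambda>\<omega>. (scaled_columns M \<beta> i j t \<omega> - scaled_columns M \<beta> i j s \<omega>) ^ 4) = integrable P (\<lambda>\<omega>. S \<omega> ^ 4 / (real M)\<^sup>2)"
      using eq by (intro Bochner_Integration.integrable_cong) auto
    then have int: "integrable P (\<lambda>\<omega>. (scaled_columns M \<beta> i j t \<omega> - scaled_columns M \<beta> i j s \<omega>) ^ 4)" using S(1) by simp
    have "(\<integral>\<omega>. (scaled_columns M \<beta> i j t \<omega> - scaled_columns M \<beta> i j s \<omega>) ^ 4 \<partial>P) = (\<integral>\<omega>. S \<omega> ^ 4 / (real M)\<^sup>2 \<partial>P)"
      using eq by (intro Bochner_Integration.integral_cong) auto
    also have "\<dots> \<le> 3 * r\<^sup>2" using S(2) M by (simp add: pos_divide_le_eq mult_ac)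
    also have "\<dots> = 3 * tightness_constant N K * (t - s)\<^sup>2" by (simp add: r(2))
    also have "\<dots> \<le> C K * (t - s)\<^sup>2" using C by (intro mult_right_mono) auto
    finally show ?thesis using int by simp
  qed
  then show "integrable P (\<lambda>\<omega>. (scaled_columns M \<beta> i j t \<omega> - scaled_columns M \<beta> i j s \<omega>) ^ 4)"
    "(\<integral>\<omega>. (scaled_columns M \<beta> i j t \<omega> - scaled_columns M \<beta> i j s \<omega>) ^ 4 \<partial>P) \<le> C K * (t - s)\<^sup>2" by simp_all
qed

lemma limit_variance_nonneg:
  assumes "\<tau> 0 = 0" "\<And>m. m < n \<Longrightarrow> \<tau> m < \<tau> (Suc m)"
  shows "limit_variance N n \<tau> w \<ge> 0"
  unfolding limit_variance_def
proof (intro sum_nonneg mult_nonneg_nonneg)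
  fix m assume "m \<in> {..<n}"
  then have "0 \<le> \<tau> m" "\<tau> m < \<tau> (Suc m)" using grid_nonneg[of \<tau> n m] assms by auto
  then show "0 \<le> (\<tau> (Suc m))\<^sup>2 - (\<tau> m)\<^sup>2" using power_mono[of "\<tau> m" "\<tau> (Suc m)" 2] by simp
qed (auto simp: entry_variance_def)

lemma scaled_columns_cos:
  fixes P :: "nat \<Rightarrow> 'a measure"
  assumes fam: "\<And>M. M \<ge> M0 \<Longrightarrow> bm_family (P M) (\<beta> M) (({..<N} \<times> {..<M}) \<times> UNIV)"
    and \<tau>: "\<tau> 0 = 0" "\<And>m. m < n \<Longrightarrow> \<tau> m < \<tau> (Suc m)"
  shows "(\<lambda>M. \<integral>\<omega>. cos ((\<Sum>l\<le>n. \<Sum>i<N. \<Sum>j<N. w l i j * scaled_columns M (\<beta> M) i j (\<tau> l) \<omega>) + \<theta>) \<partial>P M)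
     \<longlonglongrightarrow> exp (- limit_variance N n \<tau> w / 2) * cos \<theta>"
  unfolding scaled_columns_linear
proof (rule lyapunov_triangular_array)
  have \<tau>0: "0 \<le> \<tau> l" if "l \<le> n" for l using \<tau> that by (rule grid_nonneg)
  show "prob_space (P M)" if "M \<ge> M0" for M using fam[OF that] by (simp add: bm_family_def)
  show "prob_space.indep_vars (P M) (\<lambda>_. borel) (column_sum N (\<beta> M) n \<tau> w) {..<M}" if "M \<ge> M0" for M
    by (rule column_sums_independent[OF fam[OF that] \<tau>0])
  fix M k assume M: "M \<ge> M0" and k: "k < M"
  note m = column_sum_moments[where \<tau> = \<tau> and n = n and w = w, OF fam[OF M] k \<tau>(1)]
  show "integrable (P M) (\<lambda>\<omega>. column_sum N (\<beta> M) n \<tau> w k \<omega> ^ 4)" using m(4) \<tau>(2) by blast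
  show "(\<integral>\<omega>. column_sum N (\<beta> M) n \<tau> w k \<omega> \<partial>P M) = 0" using m(2) \<tau>(2) by blast
  show "(\<integral>\<omega>. (column_sum N (\<beta> M) n \<tau> w k \<omega>)\<^sup>2 \<partial>P M) = limit_variance N n \<tau> w"
    using m(3) \<tau>(2) by blast
  show "(\<integral>\<omega>. column_sum N (\<beta> M) n \<tau> w k \<omega> ^ 4 \<partial>P M) \<le> column_moment_bound N n \<tau> w"
    using m(5) \<tau>(2) by blast
qed (rule limit_variance_nonneg[OF \<tau>])

section \<open>Hermitian Brownian motion at squared time\<close>

lemma standard_BM_trajectory_measurable:
  assumes "standard_BM P b"
  shows "trajectory b \<in> measurable P trajectory_space"
  unfolding trajectory_def[abs_def]
  by (rule measurable_restrict) (use assms in \<open>simp add: standard_BM_def\<close>)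

text \<open>All coordinates of Hermitian Brownian motion are, up to the factor \<open>\<surd>(1/2)\<close> off the diagonal, one jointly independent family of
real Brownian motions.\<close>

lemma hermitian_BM_representation:
  assumes "hermitian_BM Q N X"
  obtains B where "bm_family Q B ({..<N} \<times> {..<N})"
    "\<And>t \<omega>. t \<ge> 0 \<Longrightarrow> \<omega> \<in> space Q \<Longrightarrow> X t \<omega> = hermitian_of N (\<lambda>i j. sqrt (entry_variance i j) * B (i, j) t \<omega>)"
proof -
  have Q: "prob_space Q" and carrier: "\<And>t \<omega>. t \<ge> 0 \<Longrightarrow> \<omega> \<in> space Q \<Longrightarrow> X t \<omega> \<in> carrier_mat N N"
    and off: "\<And>i j. i < N \<Longrightarrow> j < N \<Longrightarrow> i < j \<Longrightarrow> standard_complex_BM Q (\<lambda>t \<omega>. X t \<omega> $$ (i, j))"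
    and diag: "\<And>i. i < N \<Longrightarrow> \<exists>b. standard_BM Q b \<and> (\<forall>t\<ge>0. \<forall>\<omega>\<in>space Q. X t \<omega> $$ (i, i) = of_real (b t \<omega>))"
    and ind: "independent_processes Q (\<lambda>ij t \<omega>. X t \<omega> $$ ij) {(i, j). i \<le> j \<and> j < N}"
    and low: "\<And>i j t \<omega>. i < N \<Longrightarrow> j < N \<Longrightarrow> j < i \<Longrightarrow> t \<ge> 0 \<Longrightarrow> \<omega> \<in> space Q \<Longrightarrow> X t \<omega> $$ (i, j) = cnj (X t \<omega> $$ (j, i))"
    using assms by (simp_all add: hermitian_BM_def)
  interpret prob_space Q by fact
  define I where "I = {(i, j). i \<le> j \<and> j < N}"
  define C where "C ij = (if fst ij = snd ij then {True} else UNIV)" for ij :: "nat \<times> nat"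
  define s where "s ij = (if fst ij = snd ij then 1 else sqrt 2)" for ij :: "nat \<times> nat"
  define parts where "parts ij \<gamma> \<longleftrightarrow> (\<forall>c\<in>C ij. standard_BM Q (\<gamma> c)) \<and>
     indep_vars (\<lambda>_. trajectory_space) (\<lambda>c. trajectory (\<gamma> c)) (C ij) \<and>
     (\<forall>c\<in>C ij. \<forall>t\<ge>0. \<forall>\<omega>\<in>space Q. \<gamma> c t \<omega> = s ij * (if c then Re (X t \<omega> $$ ij) else Im (X t \<omega> $$ ij)))"
    for ij and \<gamma> :: "bool \<Rightarrow> real \<Rightarrow> 'a \<Rightarrow> real"
  have "\<exists>\<gamma>. parts ij \<gamma>" if "ij \<in> I" for ij
  proof -
    define i j where "i = fst ij" and "j = snd ij"
    have ij: "ij = (i, j)" "i \<le> j" "j < N" using that by (auto simp: I_def i_def j_def)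
    show ?thesis
    proof (cases "i = j")
      case True
      then obtain b where b: "standard_BM Q b" "\<forall>t\<ge>0. \<forall>\<omega>\<in>space Q. X t \<omega> $$ (i, i) = of_real (b t \<omega>)"
        using diag[of i] ij by auto
      have "parts ij (\<lambda>_. b)"
        unfolding parts_def C_def s_def ij(1)
        using b True indep_vars_singleton[of "\<lambda>_. trajectory b" True "\<lambda>_. trajectory_space"]
          standard_BM_trajectory_measurable[OF b(1)] by auto
      then show ?thesis by (rule exI[of _ "\<lambda>_. b"])
    next
      case False
      then have "i < j" using ij by simp
      show ?thesis
      proof (rule complex_BM_parts[OF off[of i j]])
        fix \<gamma> assume "\<And>c. standard_BM Q (\<gamma> c)"
          "indep_vars (\<lambda>_. trajectory_space) (\<lambda>c. trajectory (\<gamma> c)) (UNIV :: bool set)"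
          "\<And>c t \<omega>. 0 \<le> t \<Longrightarrow> \<omega> \<in> space Q \<Longrightarrow> \<gamma> c t \<omega> = sqrt 2 * (if c then Re (X t \<omega> $$ (i, j)) else Im (X t \<omega> $$ (i, j)))"
        then have "parts ij \<gamma>" unfolding parts_def C_def s_def ij(1) using False by simp
        then show ?thesis by (rule exI[of _ \<gamma>])
      qed (use \<open>i < j\<close> ij in auto)
    qed
  qed
  then have "\<forall>ij\<in>I. \<exists>\<gamma>. parts ij \<gamma>" by simp
  from bchoice[OF this] obtain \<gamma> where \<gamma>: "\<forall>ij\<in>I. parts ij (\<gamma> ij)" ..
  define \<beta> where "\<beta> p = \<gamma> (fst p) (snd p)" for p
  have g: "standard_BM Q (\<beta> (ij, c))"
    "\<And>t \<omega>. t \<ge> 0 \<Longrightarrow> \<omega> \<in> space Q \<Longrightarrow> \<beta> (ij, c) t \<omega> = s ij * (if c then Re (X t \<omega> $$ ij) else Im (X t \<omega> $$ ij))"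
    if "ij \<in> I" "c \<in> C ij" for ij c
    using bspec[OF \<gamma> that(1)] that(2) unfolding parts_def \<beta>_def by auto
  have fam: "bm_family Q \<beta> (SIGMA ij:I. C ij)"
  proof (rule bm_family_of_parts[OF Q ind[folded I_def]])
    show "indep_vars (\<lambda>_. trajectory_space) (\<lambda>c. trajectory (\<beta> (ij, c))) (C ij)" if "ij \<in> I" for ij
      using bspec[OF \<gamma> that] unfolding parts_def \<beta>_def by simp
  qed (use g in auto)
  \<comment> \<open>Coordinate \<open>(i, j)\<close> is the real part of the upper entry if \<open>i \<le> j\<close>, and otherwise the imaginary part of the transposed one.\<close>
  define h where "h p = (case p of (i, j) \<Rightarrow> ((min i j, max i j), i \<le> j))" for p :: "nat \<times> nat"
  have hI: "h ` ({..<N} \<times> {..<N}) \<subseteq> (SIGMA ij:I. C ij)"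
    by (auto simp: h_def I_def C_def min_def max_def)
  have hinj: "inj_on h ({..<N} \<times> {..<N})"
    by (auto simp: inj_on_def h_def min_def max_def split: if_splits)
  define B where "B p = \<beta> (h p)" for p
  have "bm_family Q B ({..<N} \<times> {..<N})"
    unfolding B_def[abs_def] by (rule bm_family_reindex[OF fam hinj hI])
  moreover have "X t \<omega> = hermitian_of N (\<lambda>i j. sqrt (entry_variance i j) * B (i, j) t \<omega>)" if t: "t \<ge> 0" "\<omega> \<in> space Q" for t \<omega>
  proof (rule eq_matI)
    show "dim_row (X t \<omega>) = dim_row (hermitian_of N (\<lambda>i j. sqrt (entry_variance i j) * B (i, j) t \<omega>))"
      "dim_col (X t \<omega>) = dim_col (hermitian_of N (\<lambda>i j. sqrt (entry_variance i j) * B (i, j) t \<omega>))"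
      using carrier[OF t] by (auto simp: hermitian_of_def)
    fix i j assume "i < dim_row (hermitian_of N (\<lambda>i j. sqrt (entry_variance i j) * B (i, j) t \<omega>))"
      "j < dim_col (hermitian_of N (\<lambda>i j. sqrt (entry_variance i j) * B (i, j) t \<omega>))"
    then have ij: "i < N" "j < N" by (auto simp: hermitian_of_def)
    have d: "B (i, i) t \<omega> = Re (X t \<omega> $$ (i, i))" "Im (X t \<omega> $$ (i, i)) = 0" if "i < N" for i
    proof -
      show "B (i, i) t \<omega> = Re (X t \<omega> $$ (i, i))"
        using g(2)[of "(i, i)" True t \<omega>] that t by (simp add: B_def h_def I_def C_def s_def)
      show "Im (X t \<omega> $$ (i, i)) = 0" using diag[OF that] t by auto
    qed
    have r: "sqrt (1 / 2) * B (i, j) t \<omega> = Re (X t \<omega> $$ (i, j))" "sqrt (1 / 2) * B (j, i) t \<omega> = Im (X t \<omega> $$ (i, j))"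
      if "i < j" "j < N" for i j
    proof -
      have s2: "sqrt (1 / 2) * (sqrt 2 * x) = x" for x by (simp add: real_sqrt_divide)
      show "sqrt (1 / 2) * B (i, j) t \<omega> = Re (X t \<omega> $$ (i, j))"
        using g(2)[of "(i, j)" True t \<omega>] that t by (simp add: B_def h_def I_def C_def s_def s2)
      show "sqrt (1 / 2) * B (j, i) t \<omega> = Im (X t \<omega> $$ (i, j))"
        using g(2)[of "(i, j)" False t \<omega>] that t by (simp add: B_def h_def I_def C_def s_def s2)
    qed
    consider "i = j" | "i < j" | "j < i" by linarith
    then show "X t \<omega> $$ (i, j) = hermitian_of N (\<lambda>i j. sqrt (entry_variance i j) * B (i, j) t \<omega>) $$ (i, j)"
    proof cases
      case 1
      then show ?thesis using ij d[OF ij(1)] by (simp add: hermitian_of_def entry_variance_def complex_eq_iff)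
    next
      case 2
      then show ?thesis using ij r[OF 2 ij(2)] by (simp add: hermitian_of_def entry_variance_def complex_eq_iff)
    next
      case 3
      then show ?thesis using ij r[OF 3 ij(1)] low[OF ij 3 t] by (simp add: hermitian_of_def entry_variance_def complex_eq_iff)
    qed
  qed
  ultimately show thesis by (rule that)
qed

definition time_squared :: "(nat \<times> nat \<Rightarrow> real \<Rightarrow> 'a \<Rightarrow> real) \<Rightarrow> nat \<Rightarrow> nat \<Rightarrow> real \<Rightarrow> 'a \<Rightarrow> real" where
  "time_squared B i j t \<omega> = sqrt (entry_variance i j) * B (i, j) (t\<^sup>2) \<omega>"

lemma matrix_process_time_squared:
  assumes fam: "bm_family Q B ({..<N} \<times> {..<N})" and C: "\<And>k. 12 * (real k)\<^sup>2 \<le> C k"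
  shows "matrix_process Q N C (time_squared B)"
  unfolding matrix_process_def
proof (intro conjI allI impI ballI)
  interpret prob_space Q using fam by (simp add: bm_family_def)
  show "prob_space Q" by (rule prob_space_axioms)
  fix i j assume ij: "i < N" "j < N"
  have bm: "standard_BM Q (B (i, j))" using fam ij by (auto simp: bm_family_def)
  show "time_squared B i j t \<in> borel_measurable Q" if "0 \<le> t" for t
  proof -
    have "B (i, j) (t\<^sup>2) \<in> borel_measurable Q" using bm by (simp add: standard_BM_def)
    then show ?thesis unfolding time_squared_def[abs_def] by simp
  qed
  show "time_squared B i j 0 \<omega> = 0" if "\<omega> \<in> space Q" for \<omega>
    using bm that by (simp add: time_squared_def standard_BM_def)
  show "continuous_on {0..} (\<lambda>t. time_squared B i j t \<omega>)" if \<omega>: "\<omega> \<in> space Q" for \<omega>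
  proof -
    have "continuous_on {0..} (\<lambda>t. B (i, j) t \<omega>)" using bm \<omega> by (simp add: standard_BM_def)
    then have "continuous_on {0..} (\<lambda>t. B (i, j) (t\<^sup>2) \<omega>)"
      by (rule continuous_on_compose2) (auto intro!: continuous_intros)
    then show ?thesis unfolding time_squared_def by (intro continuous_intros)
  qed
  fix K :: nat and s t :: real assume "0 \<le> s \<and> s < t \<and> t \<le> real K"
  then have st: "0 \<le> s" "s < t" "t \<le> real K" by auto
  have v: "t\<^sup>2 - s\<^sup>2 > 0" using power_strict_mono[OF st(2,1), of 2] by simp
  have d: "distributed Q lborel (\<lambda>\<omega>. B (i, j) (t\<^sup>2) \<omega> - B (i, j) (s\<^sup>2) \<omega>) (normal_density 0 (sqrt (t\<^sup>2 - s\<^sup>2)))"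
    using bm v by (simp add: standard_BM_def)
  have "sqrt (t\<^sup>2 - s\<^sup>2) > 0" using v by simp
  note i = normal_moments(1)[OF d this, of 4] and m = normal_power_moment[OF d v, of 4]
  have eq: "(time_squared B i j t \<omega> - time_squared B i j s \<omega>) ^ 4 = (entry_variance i j)\<^sup>2 * (B (i, j) (t\<^sup>2) \<omega> - B (i, j) (s\<^sup>2) \<omega>) ^ 4" for \<omega>
  proof -
    have "sqrt (entry_variance i j) ^ 4 = (entry_variance i j)\<^sup>2"
      by (simp add: entry_variance_def power4_eq_xxxx power2_eq_square)
    then show ?thesis unfolding time_squared_def right_diff_distrib[symmetric] power_mult_distrib by simp
  qed
  show "integrable Q (\<lambda>\<omega>. (time_squared B i j t \<omega> - time_squared B i j s \<omega>) ^ 4)" unfolding eq using i by simp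
  have "(\<integral>\<omega>. (time_squared B i j t \<omega> - time_squared B i j s \<omega>) ^ 4 \<partial>Q) = (entry_variance i j)\<^sup>2 * (3 * (t\<^sup>2 - s\<^sup>2)\<^sup>2)"
    unfolding eq using m by (simp add: gaussian_moment_simps)
  also have "\<dots> \<le> 1 * (3 * (t\<^sup>2 - s\<^sup>2)\<^sup>2)"
    by (intro mult_right_mono) (auto simp: entry_variance_def power2_eq_square)
  also have "(t\<^sup>2 - s\<^sup>2)\<^sup>2 = (t - s)\<^sup>2 * (t + s)\<^sup>2"
    by (simp add: power2_eq_square algebra_simps)
  also have "1 * (3 * ((t - s)\<^sup>2 * (t + s)\<^sup>2)) \<le> 1 * (3 * ((t - s)\<^sup>2 * (2 * real K)\<^sup>2))"
    using st by (intro mult_left_mono power_mono) auto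
  also have "\<dots> = 12 * (real K)\<^sup>2 * (t - s)\<^sup>2" by (simp add: power_mult_distrib)
  also have "\<dots> \<le> C K * (t - s)\<^sup>2" using C by (intro mult_right_mono) auto
  finally show "(\<integral>\<omega>. (time_squared B i j t \<omega> - time_squared B i j s \<omega>) ^ 4 \<partial>Q) \<le> C K * (t - s)\<^sup>2" .
qed

text \<open>Summation by parts in time turns the functional into a linear combination of independent normal increments.\<close>

lemma time_squared_cos:
  assumes fam: "bm_family Q B ({..<N} \<times> {..<N})" and \<tau>: "\<tau> 0 = 0" "\<And>m. m < n \<Longrightarrow> \<tau> m < \<tau> (Suc m)"
  shows "(\<integral>\<omega>. cos ((\<Sum>l\<le>n. \<Sum>i<N. \<Sum>j<N. w l i j * time_squared B i j (\<tau> l) \<omega>) + \<theta>) \<partial>Q)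
     = exp (- limit_variance N n \<tau> w / 2) * cos \<theta>"
proof -
  interpret prob_space Q using fam by (simp add: bm_family_def)
  define \<sigma> where "\<sigma> m = (\<tau> m)\<^sup>2" for m
  have \<sigma>0: "0 \<le> \<sigma> 0" by (simp add: \<sigma>_def)
  have \<sigma>: "\<sigma> m < \<sigma> (Suc m)" if "m < n" for m
    unfolding \<sigma>_def using \<tau>(2)[OF that] grid_nonneg[OF \<tau>, of m] that by (intro power_strict_mono) auto
  define \<Delta> where "\<Delta> a \<omega> = B (fst a) (\<sigma> (Suc (snd a))) \<omega> - B (fst a) (\<sigma> (snd a)) \<omega>" for a \<omega>
  define u where "u a = sqrt (entry_variance (fst (fst a)) (snd (fst a))) * (\<Sum>l\<in>{snd a<..n}. w l (fst (fst a)) (snd (fst a)))" for a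
  define A where "A = ({..<N} \<times> {..<N}) \<times> {..<n}"
  have ind: "indep_vars (\<lambda>_. borel) \<Delta> A"
    using bm_increments(1)[where \<tau> = \<sigma> and n = n, OF fam \<sigma>0 \<sigma>] unfolding A_def \<Delta>_def[abs_def] by (simp add: case_prod_beta')
  have eq: "(\<Sum>l\<le>n. \<Sum>i<N. \<Sum>j<N. w l i j * time_squared B i j (\<tau> l) \<omega>) = (\<Sum>a\<in>A. u a * \<Delta> a \<omega>)" if \<omega>: "\<omega> \<in> space Q" for \<omega>
  proof -
    have B: "B (i, j) (\<sigma> l) \<omega> = (\<Sum>m<n. of_bool (m < l) * \<Delta> ((i, j), m) \<omega>)" if "i < N" "j < N" "l \<le> n" for i j l
    proof -
      have "B (i, j) (\<sigma> 0) \<omega> = 0" using fam \<omega> that \<tau>(1) by (simp add: \<sigma>_def bm_family_def standard_BM_def)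
      then have "B (i, j) (\<sigma> l) \<omega> = (\<Sum>m<l. \<Delta> ((i, j), m) \<omega>)"
        using sum_lessThan_telescope[of "\<lambda>m. B (i, j) (\<sigma> m) \<omega>" l] by (simp add: \<Delta>_def)
      also have "\<dots> = (\<Sum>m<n. of_bool (m < l) * \<Delta> ((i, j), m) \<omega>)"
        using that by (intro sum.mono_neutral_cong_left) auto
      finally show ?thesis .
    qed
    have entry: "(\<Sum>l\<le>n. w l i j * time_squared B i j (\<tau> l) \<omega>) = (\<Sum>m<n. u ((i, j), m) * \<Delta> ((i, j), m) \<omega>)" if "i < N" "j < N" for i j
    proof -
      have "(\<Sum>l\<le>n. w l i j * time_squared B i j (\<tau> l) \<omega>)
         = (\<Sum>l\<le>n. \<Sum>m<n. sqrt (entry_variance i j) * (w l i j * of_bool (m < l)) * \<Delta> ((i, j), m) \<omega>)"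
      proof (rule sum.cong[OF refl])
        fix l assume "l \<in> {..n}"
        then have "w l i j * time_squared B i j (\<tau> l) \<omega> = w l i j * (sqrt (entry_variance i j) * (\<Sum>m<n. of_bool (m < l) * \<Delta> ((i, j), m) \<omega>))"
          unfolding time_squared_def \<sigma>_def[symmetric] using B[OF that] by simp
        then show "w l i j * time_squared B i j (\<tau> l) \<omega>
           = (\<Sum>m<n. sqrt (entry_variance i j) * (w l i j * of_bool (m < l)) * \<Delta> ((i, j), m) \<omega>)"
          by (simp only: sum_distrib_left mult_ac)
      qed
      also have "\<dots> = (\<Sum>m<n. \<Sum>l\<le>n. sqrt (entry_variance i j) * (w l i j * of_bool (m < l)) * \<Delta> ((i, j), m) \<omega>)"
        by (rule sum.swap)
      also have "\<dots> = (\<Sum>m<n. u ((i, j), m) * \<Delta> ((i, j), m) \<omega>)"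
      proof (rule sum.cong[OF refl])
        fix m
        have "(\<Sum>l\<le>n. sqrt (entry_variance i j) * (w l i j * of_bool (m < l)) * \<Delta> ((i, j), m) \<omega>)
          = (\<Sum>l\<in>{m<..n}. sqrt (entry_variance i j) * w l i j * \<Delta> ((i, j), m) \<omega>)"
          by (rule sum.mono_neutral_cong_right) auto
        then show "(\<Sum>l\<le>n. sqrt (entry_variance i j) * (w l i j * of_bool (m < l)) * \<Delta> ((i, j), m) \<omega>)
          = u ((i, j), m) * \<Delta> ((i, j), m) \<omega>" by (simp add: u_def sum_distrib_left sum_distrib_right)
      qed
      finally show ?thesis .
    qed
    have "(\<Sum>l\<le>n. \<Sum>i<N. \<Sum>j<N. w l i j * time_squared B i j (\<tau> l) \<omega>)
       = (\<Sum>i<N. \<Sum>l\<le>n. \<Sum>j<N. w l i j * time_squared B i j (\<tau> l) \<omega>)" by (rule sum.swap)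
    also have "\<dots> = (\<Sum>i<N. \<Sum>j<N. \<Sum>l\<le>n. w l i j * time_squared B i j (\<tau> l) \<omega>)"
      by (rule sum.cong[OF refl], rule sum.swap)
    also have "\<dots> = (\<Sum>i<N. \<Sum>j<N. \<Sum>m<n. u ((i, j), m) * \<Delta> ((i, j), m) \<omega>)"
      by (rule sum.cong[OF refl], rule sum.cong[OF refl]) (simp add: entry)
    also have "\<dots> = (\<Sum>a\<in>A. u a * \<Delta> a \<omega>)" by (simp add: A_def sum.cartesian_product')
    finally show ?thesis .
  qed
  have "(\<integral>\<omega>. cos ((\<Sum>l\<le>n. \<Sum>i<N. \<Sum>j<N. w l i j * time_squared B i j (\<tau> l) \<omega>) + \<theta>) \<partial>Q)
    = (\<integral>\<omega>. cos ((\<Sum>a\<in>A. u a * \<Delta> a \<omega>) + \<theta>) \<partial>Q)"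
    using eq by (intro Bochner_Integration.integral_cong) auto
  also have "\<dots> = exp (- (\<Sum>a\<in>A. (u a)\<^sup>2 * (\<sigma> (Suc (snd a)) - \<sigma> (snd a))) / 2) * cos \<theta>"
  proof (rule gaussian_family_cos[OF ind])
    show "finite A" by (simp add: A_def)
    fix a assume "a \<in> A"
    then have a: "fst a \<in> {..<N} \<times> {..<N}" "snd a < n" by (auto simp: A_def)
    show "distributed Q lborel (\<Delta> a) (normal_density 0 (sqrt (\<sigma> (Suc (snd a)) - \<sigma> (snd a))))"
      unfolding \<Delta>_def[abs_def] by (rule bm_increments(2)[where \<tau> = \<sigma> and n = n, OF fam \<sigma>0 \<sigma> a])
    show "0 < \<sigma> (Suc (snd a)) - \<sigma> (snd a)" using \<sigma>[OF a(2)] by simp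
  qed
  also have "(\<Sum>a\<in>A. (u a)\<^sup>2 * (\<sigma> (Suc (snd a)) - \<sigma> (snd a)))
     = (\<Sum>i<N. \<Sum>j<N. \<Sum>m<n. entry_variance i j * (\<Sum>l\<in>{m<..n}. w l i j)\<^sup>2 * ((\<tau> (Suc m))\<^sup>2 - (\<tau> m)\<^sup>2))"
    unfolding A_def sum.cartesian_product'
    by (intro sum.cong refl) (simp add: u_def \<sigma>_def power_mult_distrib entry_variance_def)
  also have "\<dots> = (\<Sum>i<N. \<Sum>m<n. \<Sum>j<N. entry_variance i j * (\<Sum>l\<in>{m<..n}. w l i j)\<^sup>2 * ((\<tau> (Suc m))\<^sup>2 - (\<tau> m)\<^sup>2))"
    by (rule sum.cong[OF refl], rule sum.swap)
  also have "\<dots> = (\<Sum>m<n. \<Sum>i<N. \<Sum>j<N. entry_variance i j * (\<Sum>l\<in>{m<..n}. w l i j)\<^sup>2 * ((\<tau> (Suc m))\<^sup>2 - (\<tau> m)\<^sup>2))"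
    by (rule sum.swap)
  also have "\<dots> = limit_variance N n \<tau> w"
    by (simp add: limit_variance_def sum_distrib_right)
  finally show ?thesis .
qed

text \<open>In coordinates \<open>Y(t) = M t I + \<surd>M H(t)\<close>, where \<open>H\<close> has the coordinates \<open>scaled_columns\<close>; centring and scaling the matrix does
the same to its eigenvalues.\<close>

lemma laguerre_representation:
  assumes "laguerre_process P N M Y" and M: "M > 0"
  obtains \<beta> where "bm_family P \<beta> (({..<N} \<times> {..<M}) \<times> UNIV)"
    "\<And>t \<omega> i. t \<ge> 0 \<Longrightarrow> \<omega> \<in> space P \<Longrightarrow> i < N \<Longrightarrow> (ordered_eigenvalue (Y t \<omega>) i - real M * t) / sqrt (real M)
       = ordered_eigenvalue (hermitian_of N (\<lambda>i j. scaled_columns M \<beta> i j t \<omega>)) i"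
proof -
  obtain A where A: "complex_BM_matrix P N M A" and Y: "\<And>t \<omega>. t \<ge> 0 \<Longrightarrow> \<omega> \<in> space P \<Longrightarrow> Y t \<omega> = A t \<omega> * mat_adjoint (A t \<omega>)"
    using assms unfolding laguerre_process_def by blast
  have P: "prob_space P" and carrier: "\<And>t \<omega>. t \<ge> 0 \<Longrightarrow> \<omega> \<in> space P \<Longrightarrow> A t \<omega> \<in> carrier_mat N M"
    and bm: "\<And>i j. i < N \<Longrightarrow> j < M \<Longrightarrow> standard_complex_BM P (\<lambda>t \<omega>. A t \<omega> $$ (i, j))"
    and ind: "independent_processes P (\<lambda>ij t \<omega>. A t \<omega> $$ ij) ({..<N} \<times> {..<M})"
    using A unfolding complex_BM_matrix_def by blast+
  interpret prob_space P by fact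
  define parts where "parts ij \<gamma> \<longleftrightarrow> (\<forall>c. standard_BM P (\<gamma> c)) \<and>
     indep_vars (\<lambda>_. trajectory_space) (\<lambda>c. trajectory (\<gamma> c)) UNIV \<and>
     (\<forall>c. \<forall>t\<ge>0. \<forall>\<omega>\<in>space P. \<gamma> c t \<omega> = sqrt 2 * (if c then Re (A t \<omega> $$ ij) else Im (A t \<omega> $$ ij)))"
    for ij and \<gamma> :: "bool \<Rightarrow> real \<Rightarrow> 'a \<Rightarrow> real"
  have "\<exists>\<gamma>. parts ij \<gamma>" if "ij \<in> {..<N} \<times> {..<M}" for ij
  proof (rule complex_BM_parts[OF bm[of "fst ij" "snd ij"]])
    fix \<gamma> assume "\<And>c. standard_BM P (\<gamma> c)"
      "indep_vars (\<lambda>_. trajectory_space) (\<lambda>c. trajectory (\<gamma> c)) (UNIV :: bool set)"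
      "\<And>c t \<omega>. 0 \<le> t \<Longrightarrow> \<omega> \<in> space P \<Longrightarrow> \<gamma> c t \<omega> = sqrt 2 * (if c then Re (A t \<omega> $$ (fst ij, snd ij)) else Im (A t \<omega> $$ (fst ij, snd ij)))"
    then have "parts ij \<gamma>" unfolding parts_def by simp
    then show ?thesis by (rule exI[of _ \<gamma>])
  qed (use that in auto)
  then have "\<forall>ij\<in>{..<N} \<times> {..<M}. \<exists>\<gamma>. parts ij \<gamma>" by simp
  from bchoice[OF this] obtain \<gamma> where \<gamma>: "\<forall>ij\<in>{..<N} \<times> {..<M}. parts ij (\<gamma> ij)" ..
  define \<beta> where "\<beta> p = \<gamma> (fst p) (snd p)" for p
  have g: "standard_BM P (\<beta> (ij, c))"
    "\<And>t \<omega>. t \<ge> 0 \<Longrightarrow> \<omega> \<in> space P \<Longrightarrow> \<beta> (ij, c) t \<omega> = sqrt 2 * (if c then Re (A t \<omega> $$ ij) else Im (A t \<omega> $$ ij))"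
    if "ij \<in> {..<N} \<times> {..<M}" for ij c
    using bspec[OF \<gamma> that(1)] unfolding parts_def \<beta>_def by auto
  have fam: "bm_family P \<beta> (({..<N} \<times> {..<M}) \<times> UNIV)"
  proof (rule bm_family_of_parts[where s = "\<lambda>_. sqrt 2", OF P ind])
    show "indep_vars (\<lambda>_. trajectory_space) (\<lambda>c. trajectory (\<beta> (ij, c))) UNIV" if "ij \<in> {..<N} \<times> {..<M}" for ij
      using bspec[OF \<gamma> that] unfolding parts_def \<beta>_def by simp
  qed (use g in auto)
  show thesis
  proof (rule that[OF fam])
    fix t \<omega> i assume t: "t \<ge> (0::real)" "\<omega> \<in> space P" and i: "i < N"
    let ?H = "hermitian_of N (\<lambda>i j. scaled_columns M \<beta> i j t \<omega>)"
    define a where "a i k = A t \<omega> $$ (i, k)" for i k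
    define cv where "cv i j k = column_value (\<lambda>(a, c). \<beta> ((a, k), c) t \<omega>) t i j" for i j k
    have \<beta>a: "\<beta> ((i, k), True) t \<omega> = sqrt 2 * Re (a i k)" "\<beta> ((i, k), False) t \<omega> = sqrt 2 * Im (a i k)"
      if "i < N" "k < M" for i k using g(2)[of "(i, k)"] t that by (simp_all add: a_def)
    have sc: "sqrt (real M) * scaled_columns M \<beta> i j t \<omega> = (\<Sum>k<M. cv i j k)" for i j
      using M by (simp add: scaled_columns_def cv_def)
    have Yij: "Y t \<omega> $$ (i, j) = (\<Sum>k<M. a i k * cnj (a j k))" if "i < N" "j < N" for i j
      using that carrier[OF t] unfolding Y[OF t]
      by (simp add: scalar_prod_def mat_adjoint_def mat_of_rows_def atLeast0LessThan a_def)
    have cvd: "cv i i k = (Re (a i k))\<^sup>2 + (Im (a i k))\<^sup>2 - t" if "i < N" "k < M" for i k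
      using \<beta>a[OF that] by (simp add: cv_def column_value_def power_mult_distrib)
    have cvl: "cv i j k = Re (a i k * cnj (a j k))" "cv j i k = Im (a i k * cnj (a j k))" if "i < j" "j < N" "k < M" for i j k
      using \<beta>a[of i k] \<beta>a[of j k] that by (simp_all add: cv_def column_value_def algebra_simps diff_divide_distrib)
    have "ordered_eigenvalue (Y t \<omega>) i = real M * t + sqrt (real M) * ordered_eigenvalue ?H i"
    proof (rule ordered_eigenvalue_affine[OF hermitian_hermitian_of _ _ _ i])
      show "Y t \<omega> \<in> carrier_mat N N" unfolding Y[OF t] using carrier[OF t] by (auto simp: mat_adjoint_def)
      fix i j assume ij: "i < N" "j < N"
      consider "i = j" | "i < j" | "j < i" by linarith
      then show "Y t \<omega> $$ (i, j) = (if i = j then of_real (real M * t) else 0) + of_real (sqrt (real M)) * ?H $$ (i, j)"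
      proof cases
        case 1
        have "?H $$ (i, i) = complex_of_real (scaled_columns M \<beta> i i t \<omega>)" using ij by (simp add: hermitian_of_def)
        then have "of_real (real M * t) + of_real (sqrt (real M)) * ?H $$ (i, i)
           = complex_of_real (real M * t + sqrt (real M) * scaled_columns M \<beta> i i t \<omega>)"
          by (simp only: of_real_add of_real_mult)
        also have "real M * t + sqrt (real M) * scaled_columns M \<beta> i i t \<omega> = real M * t + (\<Sum>k<M. cv i i k)"
          by (simp only: sc)
        also have "real M * t + (\<Sum>k<M. cv i i k) = (\<Sum>k<M. (Re (a i k))\<^sup>2 + (Im (a i k))\<^sup>2)"
          using cvd[OF ij(1)] by (simp add: sum_subtractf)
        also have "complex_of_real \<dots> = Y t \<omega> $$ (i, i)"
          unfolding Yij[OF ij(1) ij(1)] by (simp add: complex_eq_iff power2_eq_square)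
        finally show ?thesis using 1 by simp
      next
        case 2
        have "of_real (sqrt (real M)) * ?H $$ (i, j) = Complex (\<Sum>k<M. cv i j k) (\<Sum>k<M. cv j i k)"
          using ij 2 by (simp add: hermitian_of_def complex_eq_iff sc)
        also have "\<dots> = Y t \<omega> $$ (i, j)"
          unfolding Yij[OF ij] using cvl[OF 2 ij(2)] by (simp add: complex_eq_iff del: complex_cnj times_complex.sel)
        finally show ?thesis using 2 by simp
      next
        case 3
        have "of_real (sqrt (real M)) * ?H $$ (i, j) = cnj (Complex (\<Sum>k<M. cv j i k) (\<Sum>k<M. cv i j k))"
          using ij 3 by (simp add: hermitian_of_def complex_eq_iff sc)
        also have "Complex (\<Sum>k<M. cv j i k) (\<Sum>k<M. cv i j k) = Y t \<omega> $$ (j, i)"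
          unfolding Yij[OF ij(2,1)] using cvl[OF 3 ij(1)] by (simp add: complex_eq_iff del: complex_cnj times_complex.sel)
        also have "cnj (Y t \<omega> $$ (j, i)) = Y t \<omega> $$ (i, j)"
          unfolding Yij[OF ij] Yij[OF ij(2,1)] by (simp add: mult.commute)
        finally show ?thesis using 3 by simp
      qed
    qed simp
    then show "(ordered_eigenvalue (Y t \<omega>) i - real M * t) / sqrt (real M) = ordered_eigenvalue ?H i"
      using M by simp
  qed
qed

theorem mainTheorem3:
  fixes N :: nat
    and P :: "nat \<Rightarrow> 'a measure" and Y :: "nat \<Rightarrow> real \<Rightarrow> 'a \<Rightarrow> complex mat"
    and Q :: "'b measure" and X :: "real \<Rightarrow> 'b \<Rightarrow> complex mat"
  assumes "N \<ge> 1"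
    and "\<And>M. M \<ge> N \<Longrightarrow> laguerre_process (P M) N M (Y M)"
    and "hermitian_BM Q N X"
  shows "converges_in_distribution (path_topology N)
           P (\<lambda>M \<omega>. \<lambda>t\<in>{0..}. \<lambda>i. if i < N
                then (ordered_eigenvalue (Y M t \<omega>) i - real M * t) / sqrt (real M) else 0)
           Q (\<lambda>\<omega>. \<lambda>t\<in>{0..}. \<lambda>i. if i < N
                then ordered_eigenvalue (X (t\<^sup>2) \<omega>) i else 0)"
proof -
  define rep where "rep M \<beta> \<longleftrightarrow> bm_family (P M) \<beta> (({..<N} \<times> {..<M}) \<times> UNIV) \<and>
    (\<forall>t\<ge>0. \<forall>\<omega>\<in>space (P M). \<forall>i<N. (ordered_eigenvalue (Y M t \<omega>) i - real M * t) / sqrt (real M)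
       = ordered_eigenvalue (hermitian_of N (\<lambda>i j. scaled_columns M \<beta> i j t \<omega>)) i)" for M \<beta>
  have "\<exists>\<beta>. rep M \<beta>" if M: "M \<in> {N..}" for M
  proof (rule laguerre_representation[OF assms(2)[of M]])
    fix \<beta> assume "bm_family (P M) \<beta> (({..<N} \<times> {..<M}) \<times> UNIV)"
      "\<And>t \<omega> i. t \<ge> 0 \<Longrightarrow> \<omega> \<in> space (P M) \<Longrightarrow> i < N \<Longrightarrow> (ordered_eigenvalue (Y M t \<omega>) i - real M * t) / sqrt (real M)
       = ordered_eigenvalue (hermitian_of N (\<lambda>i j. scaled_columns M \<beta> i j t \<omega>)) i"
    then have "rep M \<beta>" unfolding rep_def by simp
    then show ?thesis by (rule exI[of _ \<beta>])
  qed (use M assms(1) in auto)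
  then have "\<forall>M\<in>{N..}. \<exists>\<beta>. rep M \<beta>" by simp
  from bchoice[OF this] obtain \<beta> where \<beta>: "\<forall>M\<in>{N..}. rep M (\<beta> M)" ..
  have fam: "bm_family (P M) (\<beta> M) (({..<N} \<times> {..<M}) \<times> UNIV)"
    and eig: "\<And>t \<omega> i. t \<ge> 0 \<Longrightarrow> \<omega> \<in> space (P M) \<Longrightarrow> i < N \<Longrightarrow> (ordered_eigenvalue (Y M t \<omega>) i - real M * t) / sqrt (real M)
       = ordered_eigenvalue (hermitian_of N (\<lambda>i j. scaled_columns M (\<beta> M) i j t \<omega>)) i" if "M \<ge> N" for M
    using bspec[OF \<beta>, of M] that unfolding rep_def by auto
  obtain B where B: "bm_family Q B ({..<N} \<times> {..<N})"
    "\<And>t \<omega>. t \<ge> 0 \<Longrightarrow> \<omega> \<in> space Q \<Longrightarrow> X t \<omega> = hermitian_of N (\<lambda>i j. sqrt (entry_variance i j) * B (i, j) t \<omega>)"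
    using hermitian_BM_representation[OF assms(3)] by blast
  define C where "C k = 3 * tightness_constant N k + 12 * (real k)\<^sup>2" for k
  have tc: "tightness_constant N k \<ge> 0" for k by (simp add: tightness_constant_def)
  show ?thesis
  proof (rule eigen_path_convergence[where ?M0.0 = N and C = C and R = "\<lambda>M. scaled_columns M (\<beta> M)" and S = "time_squared B"])
    show "C k \<ge> 0" for k using tc by (simp add: C_def)
    show "matrix_process (P M) N C (scaled_columns M (\<beta> M))" if "M \<ge> N" for M
      using that assms(1) by (intro matrix_process_scaled_columns[OF fam]) (auto simp: C_def)
    show "matrix_process Q N C (time_squared B)"
      using tc by (intro matrix_process_time_squared[OF B(1)]) (simp add: C_def)
    show "(\<lambda>M. \<integral>\<omega>. cos ((\<Sum>l\<le>k. \<Sum>i<N. \<Sum>j<N. w l i j * scaled_columns M (\<beta> M) i j (real l / 2 ^ n) \<omega>) + \<theta>) \<partial>P M)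
       \<longlonglongrightarrow> (\<integral>\<omega>. cos ((\<Sum>l\<le>k. \<Sum>i<N. \<Sum>j<N. w l i j * time_squared B i j (real l / 2 ^ n) \<omega>) + \<theta>) \<partial>Q)" for n k w \<theta>
    proof -
      define \<tau> where "\<tau> l = real l / 2 ^ n" for l :: nat
      have \<tau>: "\<tau> 0 = 0" "\<tau> m < \<tau> (Suc m)" for m by (simp_all add: \<tau>_def divide_strict_right_mono)
      show ?thesis
        unfolding \<tau>_def[symmetric] time_squared_cos[where \<tau> = \<tau>, OF B(1) \<tau>]
        by (rule scaled_columns_cos[OF fam \<tau>])
    qed
    show "(\<lambda>t\<in>{0..}. \<lambda>i. if i < N then (ordered_eigenvalue (Y M t \<omega>) i - real M * t) / sqrt (real M) else 0)
       = eigen_path N (scaled_columns M (\<beta> M)) \<omega>" if "M \<ge> N" "\<omega> \<in> space (P M)" for M \<omega>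
      unfolding eigen_path_def using eig[OF that(1) _ that(2)] by (intro restrict_ext ext) simp
    show "(\<lambda>t\<in>{0..}. \<lambda>i. if i < N then ordered_eigenvalue (X (t\<^sup>2) \<omega>) i else 0) = eigen_path N (time_squared B) \<omega>"
      if "\<omega> \<in> space Q" for \<omega>
      unfolding eigen_path_def using B(2)[OF _ that] by (intro restrict_ext ext) (simp add: time_squared_def)
  qed (rule assms(1))
qed

end
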